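(* Let $(\mathcal M,\otimes_{\mathcal M},1)$ be a $\mathbf{k}$-linear monoidal abelian category, and let $\mathcal C:(\mathcal M,\otimes_{\mathcal M},1)\to(\mathrm{FDGVect}_{\mathbf k},\otimes,\underline{\mathbf k})$ be a filtered differential graded lax monoidal functor. Assume that for each $n\in\mathbb Z$ and $M\in\mathcal M$ the filtration on $\mathcal C^n(M)$ is bounded. Then there exists a functorial multiplicative spectral sequence $\{(\mathcal E_r,\times_r,d_r)\}_{r\ge 0}$ with $$\mathcal E_1^{p,q}(M)=\mathrm H^{p+q}\bigl(\mathcal F^p\mathcal C(M)/\mathcal F^{p+1}\mathcal C(M)\bigr),$$ which converges multiplicatively to the filtered graded lax monoidal functor $\mathrm H^*(\mathcal C)$.
   Context: $\mathbf{k}$ is a field, $\otimes=\otimes_{\mathbf k}$. **Filtered dg lax monoidal functors.** $\mathrm{FDGVect}_{\mathbf k}$ is the category of cochain complexes $V^\bullet$ of $\mathbf{k}$-vector spaces with a decreasing exhaustive Hausdorff filtration $F^p(V^\bullet)$ by subcomplexes; the tensor product is the usual one (differential $d(v\otimes w)=dv\otimes w+(-1)^{|v|}v\otimes dw$) with filtration $F^p(V\otimes W)=\sum_{i+j=p}F^iV\otimes F^jW$; the unit is $\mathbf{k}$ in degree $0$ with $F^p=\mathbf{k}$ for $p\le0$, $F^p=0$ for $p>0$. A filtered differential graded lax monoidal functor $\mathcal C$ is a lax monoidal functor to this category: additive functors $\mathcal C^n:\mathcal M\to\mathrm{Vect}_{\mathbf k}$, natural differentials $d:\mathcal C^n\to\mathcal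 C^{n+1}$, $d^2=0$, decreasing exhaustive Hausdorff filtrations by subcomplexes $\mathcal F^p\mathcal C$ natural in $M$, and natural associative unital exterior products $\times:\mathcal C^m(M)\otimes\mathcal C^n(N)\to\mathcal C^{m+n}(M\otimes_{\mathcal M}N)$ with $d(x\times y)=dx\times y+(-1)^{|x|}x\times dy$ and $\mathcal F^p\times\mathcal F^q\subseteq\mathcal F^{p+q}$, with unit a morphism $\underline{\mathbf k}\to\mathcal C(1)$ of filtered complexes. The filtration on $\mathcal C^n(M)$ is bounded if there are $s\le t$ (depending on $n,M$) with $\mathcal F^s\mathcal C^n(M)=\mathcal C^n(M)$ and $\mathcal F^t\mathcal C^n(M)=0$. $\mathrm H^*(\mathcal C)$ carries the induced exterior product and the filtration $\mathcal F^p\mathrm H^n(\mathcal C)=\operatorname{Im}(\mathrm H^n(\mathcal F^p\mathcal C)\to \mathrm H^n(\mathcal C))$. **Functorial multiplicative spectral sequences.** - A *differential bigraded lax monoidal functor of degree $(r,-r+1)$* is a family of additive functors $\mathcal E^{p,q}:\mathcal M\to\mathrm{Vect}_{\mathbf k}$ ($p,q\in\mathbb Z$) with natural, associative exterior products $\times:\mathcal E^{p,q}(M)\otimes\mathcal E^{u,v}(N)\to\mathcal E^{p+u,q+v}(M\otimes_{\mathcal M}N)$, a unit $\mathbf{k}\to\mathcal E^{0,0}(1)$ satisfying the usual unitality, and natural differentials $d:\mathcal E^{p,q}\to\mathcal E^{p+r,q-r+1}$, $d^2=0$, with $d(x\times y)=dx\times y+(-1)^{p+q}x\times dy$ for $x\in\mathcal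 E^{p,q}(M)$. - A *functorial multiplicative spectral sequence* starting from $a$ is a family $\{(\mathcal E_r,\times_r,d_r)\}_{r\ge a}$ of such functors, $\mathcal E_r$ of degree $(r,-r+1)$, with natural bigraded isomorphisms $\mathrm H^{*,*}(\mathcal E_r,d_r)\cong\mathcal E_{r+1}$ identifying the lax monoidal structure induced from $\times_r$ on cohomology with that of $\mathcal E_{r+1}$. - As usual, there are subfunctors $\mathcal B_r\subseteq\mathcal Z_r$ of $\mathcal E_a$ with $\mathcal E_{r+1}\cong\mathcal Z_r/\mathcal B_r$; put $\mathcal E_\infty=\bigcap_r\mathcal Z_r/\bigcup_r\mathcal B_r$, with the induced product $\times_\infty$. - A *filtered graded lax monoidal functor* is a family of additive functors $\mathcal H^n:\mathcal M\to\mathrm{Vect}_{\mathbf k}$ with natural associative unital exterior products $\mathcal H^m(M)\otimes\mathcal H^n(N)\to\mathcal H^{m+n}(M\otimes_{\mathcal M}N)$ and decreasing exhaustive Hausdorff filtrations by subfunctors $\mathcal F^p\mathcal H^n$ with $\mathcal F^p\times\mathcal F^q\subseteq\mathcal F^{p+q}$ (and the unit in $\mathcal F^0$). - The spectral sequence *converges multiplicatively* to $\mathcal H$ if there are natural isomorphisms $\mathcal E^{p,q}_\infty\cong\mathcal F^p\mathcal H^{p+q}/\mathcal F^{p+1}\mathcal H^{p+q}$ carrying $\times_\infty$ to the product induced on $\mathrm{Gr}_{\mathcal F}(\mathcal H)$. *)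

theory Defs
  imports "HOL-Algebra.Module" "HOL-Algebra.AbelCoset" "HOL-Library.Product_Plus"
begin

section \<open>Vector spaces and their subquotients\<close>

text \<open>
  A vector space over \<open>K\<close> is a \<^locale>\<open>module\<close> over a \<^locale>\<open>field\<close>. Only the
  additive part and the scalar multiplication of a \<^type>\<open>module\<close> record matter; its ring
  multiplication and ring unit are never used.
\<close>

definition linear_map ::
  "'k ring \<Rightarrow> ('k, 'v) module \<Rightarrow> ('k, 'w) module \<Rightarrow> ('v \<Rightarrow> 'w) \<Rightarrow> bool" where
  "linear_map K V W f \<longleftrightarrow>
     (\<forall>x\<in>carrier V. f x \<in> carrier W) \<and>
     (\<forall>x\<in>carrier V. \<forall>y\<in>carrier V. f (x \<oplus>\<^bsub>V\<^esub> y) = f x \<oplus>\<^bsub>W\<^esub> f y) \<and>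
     (\<forall>a\<in>carrier K. \<forall>x\<in>carrier V. f (a \<odot>\<^bsub>V\<^esub> x) = a \<odot>\<^bsub>W\<^esub> f x)"

definition bilinear_map ::
  "'k ring \<Rightarrow> ('k, 'u) module \<Rightarrow> ('k, 'v) module \<Rightarrow> ('k, 'w) module \<Rightarrow> ('u \<Rightarrow> 'v \<Rightarrow> 'w) \<Rightarrow> bool"
  where
  "bilinear_map K U V W b \<longleftrightarrow>
     (\<forall>x\<in>carrier U. linear_map K V W (b x)) \<and>
     (\<forall>y\<in>carrier V. linear_map K U W (\<lambda>x. b x y))"

definition linear_iso ::
  "'k ring \<Rightarrow> ('k, 'v) module \<Rightarrow> ('k, 'w) module \<Rightarrow> ('v \<Rightarrow> 'w) \<Rightarrow> bool" where
  "linear_iso K V W f \<longleftrightarrow> linear_map K V W f \<and> bij_betw f (carrier V) (carrier W)"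

definition koszul_sign :: "('k, 'v) module \<Rightarrow> int \<Rightarrow> 'v \<Rightarrow> 'v" where
  "koszul_sign V n x = (if even n then x else \<ominus>\<^bsub>V\<^esub> x)"

text \<open>The quotient \<open>Z / B\<close> of two subspaces \<open>B \<subseteq> Z\<close> of \<open>V\<close>; its elements are the cosets of \<open>B\<close>.\<close>

definition subquotient :: "('k, 'v) module \<Rightarrow> 'v set \<Rightarrow> 'v set \<Rightarrow> ('k, 'v set) module" where
  "subquotient V Z B =
     \<lparr>carrier = (\<lambda>x. B +>\<^bsub>V\<^esub> x) ` Z, mult = undefined, one = undefined,
      zero = B, add = (\<lambda>X Y. X <+>\<^bsub>V\<^esub> Y),
      smult = (\<lambda>a X. \<Union>x\<in>X. B +>\<^bsub>V\<^esub> (a \<odot>\<^bsub>V\<^esub> x))\<rparr>"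

text \<open>
  The map \<open>Z / B \<rightarrow> Z' / B'\<close> induced by \<open>f\<close>, for \<open>f ` Z \<subseteq> Z'\<close> and \<open>f ` B \<subseteq> B'\<close>, where \<open>Z'\<close> and
  \<open>B'\<close> are subspaces of \<open>W\<close>: all members of the union are then the same coset of \<open>B'\<close>.
\<close>

definition induced_map :: "('k, 'w) module \<Rightarrow> 'w set \<Rightarrow> ('v \<Rightarrow> 'w) \<Rightarrow> 'v set \<Rightarrow> 'w set" where
  "induced_map W B' f X = (\<Union>x\<in>X. B' +>\<^bsub>W\<^esub> f x)"


section \<open>Linear monoidal abelian categories\<close>

record ('o, 'm, 'k) linear_cat =
  Obj :: "'o set"
  Dom :: "'m \<Rightarrow> 'o"
  Cod :: "'m \<Rightarrow> 'o"
  Hom :: "'o \<Rightarrow> 'o \<Rightarrow> ('k, 'm) module"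
  Comp :: "'m \<Rightarrow> 'm \<Rightarrow> 'm" (infixr \<open>\<cdot>\<index>\<close> 75)
  Ident :: "'o \<Rightarrow> 'm"

locale linear_category = field K
  for K :: "'k ring" and M :: "('o, 'm, 'k, 'z) linear_cat_scheme" (structure) +
  assumes hom_vectorspace: "\<lbrakk>A \<in> Obj M; B \<in> Obj M\<rbrakk> \<Longrightarrow> module K (Hom M A B)"
    and hom_dom_cod:
      "\<lbrakk>A \<in> Obj M; B \<in> Obj M; f \<in> carrier (Hom M A B)\<rbrakk> \<Longrightarrow> Dom M f = A \<and> Cod M f = B"
    and comp_bilinear:
      "\<lbrakk>A \<in> Obj M; B \<in> Obj M; C \<in> Obj M\<rbrakk> \<Longrightarrow>
        bilinear_map K (Hom M B C) (Hom M A B) (Hom M A C) (\<lambda>g f. g \<cdot> f)"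
    and ident_closed: "A \<in> Obj M \<Longrightarrow> Ident M A \<in> carrier (Hom M A A)"
    and comp_assoc:
      "\<lbrakk>A \<in> Obj M; B \<in> Obj M; C \<in> Obj M; D \<in> Obj M;
        f \<in> carrier (Hom M A B); g \<in> carrier (Hom M B C); h \<in> carrier (Hom M C D)\<rbrakk> \<Longrightarrow>
        (h \<cdot> g) \<cdot> f = h \<cdot> (g \<cdot> f)"
    and comp_ident:
      "\<lbrakk>A \<in> Obj M; B \<in> Obj M; f \<in> carrier (Hom M A B)\<rbrakk> \<Longrightarrow>
        f \<cdot> Ident M A = f \<and> Ident M B \<cdot> f = f"

definition zero_object :: "('o, 'm, 'k, 'z) linear_cat_scheme \<Rightarrow> 'o \<Rightarrow> bool" where
  "zero_object M Z \<longleftrightarrow> Z \<in> Obj M \<and>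
     (\<forall>A\<in>Obj M. (\<exists>!f. f \<in> carrier (Hom M Z A)) \<and> (\<exists>!f. f \<in> carrier (Hom M A Z)))"

definition biproduct ::
  "('o, 'm, 'k, 'z) linear_cat_scheme \<Rightarrow> 'o \<Rightarrow> 'o \<Rightarrow> 'o \<Rightarrow> 'm \<Rightarrow> 'm \<Rightarrow> 'm \<Rightarrow> 'm \<Rightarrow> bool" where
  "biproduct M A B P i\<^sub>1 i\<^sub>2 p\<^sub>1 p\<^sub>2 \<longleftrightarrow> P \<in> Obj M \<and>
     i\<^sub>1 \<in> carrier (Hom M A P) \<and> i\<^sub>2 \<in> carrier (Hom M B P) \<and>
     p\<^sub>1 \<in> carrier (Hom M P A) \<and> p\<^sub>2 \<in> carrier (Hom M P B) \<and>
     p\<^sub>1 \<cdot>\<^bsub>M\<^esub> i\<^sub>1 = Ident M A \<and> p\<^sub>2 \<cdot>\<^bsub>M\<^esub> i\<^sub>2 = Ident M B \<and>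
     p\<^sub>1 \<cdot>\<^bsub>M\<^esub> i\<^sub>2 = \<zero>\<^bsub>Hom M B A\<^esub> \<and> p\<^sub>2 \<cdot>\<^bsub>M\<^esub> i\<^sub>1 = \<zero>\<^bsub>Hom M A B\<^esub> \<and>
     (i\<^sub>1 \<cdot>\<^bsub>M\<^esub> p\<^sub>1) \<oplus>\<^bsub>Hom M P P\<^esub> (i\<^sub>2 \<cdot>\<^bsub>M\<^esub> p\<^sub>2) = Ident M P"

definition is_mono :: "('o, 'm, 'k, 'z) linear_cat_scheme \<Rightarrow> 'o \<Rightarrow> 'o \<Rightarrow> 'm \<Rightarrow> bool" where
  "is_mono M A B f \<longleftrightarrow> f \<in> carrier (Hom M A B) \<and>
     (\<forall>X\<in>Obj M. \<forall>g\<in>carrier (Hom M X A). \<forall>h\<in>carrier (Hom M X A).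
        f \<cdot>\<^bsub>M\<^esub> g = f \<cdot>\<^bsub>M\<^esub> h \<longrightarrow> g = h)"

definition is_epi :: "('o, 'm, 'k, 'z) linear_cat_scheme \<Rightarrow> 'o \<Rightarrow> 'o \<Rightarrow> 'm \<Rightarrow> bool" where
  "is_epi M A B f \<longleftrightarrow> f \<in> carrier (Hom M A B) \<and>
     (\<forall>X\<in>Obj M. \<forall>g\<in>carrier (Hom M B X). \<forall>h\<in>carrier (Hom M B X).
        g \<cdot>\<^bsub>M\<^esub> f = h \<cdot>\<^bsub>M\<^esub> f \<longrightarrow> g = h)"

text \<open>\<open>k : N \<rightarrow> A\<close> is a kernel, respectively \<open>c : B \<rightarrow> N\<close> a cokernel, of \<open>f : A \<rightarrow> B\<close>.\<close>

definition is_kernel ::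
  "('o, 'm, 'k, 'z) linear_cat_scheme \<Rightarrow> 'o \<Rightarrow> 'o \<Rightarrow> 'm \<Rightarrow> 'o \<Rightarrow> 'm \<Rightarrow> bool" where
  "is_kernel M A B f N k \<longleftrightarrow>
     N \<in> Obj M \<and> k \<in> carrier (Hom M N A) \<and> f \<cdot>\<^bsub>M\<^esub> k = \<zero>\<^bsub>Hom M N B\<^esub> \<and>
     (\<forall>X\<in>Obj M. \<forall>g\<in>carrier (Hom M X A). f \<cdot>\<^bsub>M\<^esub> g = \<zero>\<^bsub>Hom M X B\<^esub> \<longrightarrow>
        (\<exists>!h. h \<in> carrier (Hom M X N) \<and> k \<cdot>\<^bsub>M\<^esub> h = g))"

definition is_cokernel ::
  "('o, 'm, 'k, 'z) linear_cat_scheme \<Rightarrow> 'o \<Rightarrow> 'o \<Rightarrow> 'm \<Rightarrow> 'o \<Rightarrow> 'm \<Rightarrow> bool" where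
  "is_cokernel M A B f N c \<longleftrightarrow>
     N \<in> Obj M \<and> c \<in> carrier (Hom M B N) \<and> c \<cdot>\<^bsub>M\<^esub> f = \<zero>\<^bsub>Hom M A N\<^esub> \<and>
     (\<forall>X\<in>Obj M. \<forall>g\<in>carrier (Hom M B X). g \<cdot>\<^bsub>M\<^esub> f = \<zero>\<^bsub>Hom M A X\<^esub> \<longrightarrow>
        (\<exists>!h. h \<in> carrier (Hom M N X) \<and> h \<cdot>\<^bsub>M\<^esub> c = g))"

definition is_isomorphism :: "('o, 'm, 'k, 'z) linear_cat_scheme \<Rightarrow> 'o \<Rightarrow> 'o \<Rightarrow> 'm \<Rightarrow> bool" where
  "is_isomorphism M A B f \<longleftrightarrow> f \<in> carrier (Hom M A B) \<and>
     (\<exists>g\<in>carrier (Hom M B A). g \<cdot>\<^bsub>M\<^esub> f = Ident M A \<and> f \<cdot>\<^bsub>M\<^esub> g = Ident M B)"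

locale linear_abelian_category = linear_category K M
  for K :: "'k ring" and M :: "('o, 'm, 'k, 'z) linear_cat_scheme" (structure) +
  assumes ex_zero_object: "\<exists>Z. zero_object M Z"
    and ex_biproduct:
      "\<lbrakk>A \<in> Obj M; B \<in> Obj M\<rbrakk> \<Longrightarrow> \<exists>P i\<^sub>1 i\<^sub>2 p\<^sub>1 p\<^sub>2. biproduct M A B P i\<^sub>1 i\<^sub>2 p\<^sub>1 p\<^sub>2"
    and ex_kernel:
      "\<lbrakk>A \<in> Obj M; B \<in> Obj M; f \<in> carrier (Hom M A B)\<rbrakk> \<Longrightarrow> \<exists>N k. is_kernel M A B f N k"
    and ex_cokernel:
      "\<lbrakk>A \<in> Obj M; B \<in> Obj M; f \<in> carrier (Hom M A B)\<rbrakk> \<Longrightarrow> \<exists>N c. is_cokernel M A B f N c"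
    and mono_is_kernel:
      "\<lbrakk>A \<in> Obj M; B \<in> Obj M; is_mono M A B f\<rbrakk> \<Longrightarrow>
        \<exists>C\<in>Obj M. \<exists>g\<in>carrier (Hom M B C). is_kernel M B C g A f"
    and epi_is_cokernel:
      "\<lbrakk>A \<in> Obj M; B \<in> Obj M; is_epi M A B f\<rbrakk> \<Longrightarrow>
        \<exists>C\<in>Obj M. \<exists>g\<in>carrier (Hom M C A). is_cokernel M C A g B f"

record ('o, 'm, 'k) monoidal_cat = "('o, 'm, 'k) linear_cat" +
  Tensor_ob :: "'o \<Rightarrow> 'o \<Rightarrow> 'o" (infixl \<open>\<otimes>\<^sub>o\<index>\<close> 77)
  Tensor_mor :: "'m \<Rightarrow> 'm \<Rightarrow> 'm" (infixl \<open>\<otimes>\<^sub>m\<index>\<close> 77)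
  Unit_ob :: "'o"
  Assoc :: "'o \<Rightarrow> 'o \<Rightarrow> 'o \<Rightarrow> 'm"
  LUnit :: "'o \<Rightarrow> 'm"
  RUnit :: "'o \<Rightarrow> 'm"

locale linear_monoidal_category = linear_category K M
  for K :: "'k ring" and M :: "('o, 'm, 'k, 'z) monoidal_cat_scheme" (structure) +
  assumes tensor_ob_closed: "\<lbrakk>A \<in> Obj M; B \<in> Obj M\<rbrakk> \<Longrightarrow> A \<otimes>\<^sub>o B \<in> Obj M"
    and unit_ob_closed: "Unit_ob M \<in> Obj M"
    and tensor_mor_bilinear:
      "\<lbrakk>A \<in> Obj M; B \<in> Obj M; A' \<in> Obj M; B' \<in> Obj M\<rbrakk> \<Longrightarrow>
        bilinear_map K (Hom M A B) (Hom M A' B') (Hom M (A \<otimes>\<^sub>o A') (B \<otimes>\<^sub>o B')) (\<lambda>f f'. f \<otimes>\<^sub>m f')"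
    and tensor_ident:
      "\<lbrakk>A \<in> Obj M; B \<in> Obj M\<rbrakk> \<Longrightarrow> Ident M A \<otimes>\<^sub>m Ident M B = Ident M (A \<otimes>\<^sub>o B)"
    and tensor_comp:
      "\<lbrakk>A \<in> Obj M; B \<in> Obj M; C \<in> Obj M; A' \<in> Obj M; B' \<in> Obj M; C' \<in> Obj M;
        f \<in> carrier (Hom M A B); g \<in> carrier (Hom M B C);
        f' \<in> carrier (Hom M A' B'); g' \<in> carrier (Hom M B' C')\<rbrakk> \<Longrightarrow>
        (g \<cdot> f) \<otimes>\<^sub>m (g' \<cdot> f') = (g \<otimes>\<^sub>m g') \<cdot> (f \<otimes>\<^sub>m f')"
    and assoc_iso:
      "\<lbrakk>A \<in> Obj M; B \<in> Obj M; C \<in> Obj M\<rbrakk> \<Longrightarrow>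
        is_isomorphism M ((A \<otimes>\<^sub>o B) \<otimes>\<^sub>o C) (A \<otimes>\<^sub>o (B \<otimes>\<^sub>o C)) (Assoc M A B C)"
    and assoc_natural:
      "\<lbrakk>A \<in> Obj M; B \<in> Obj M; C \<in> Obj M; A' \<in> Obj M; B' \<in> Obj M; C' \<in> Obj M;
        f \<in> carrier (Hom M A A'); g \<in> carrier (Hom M B B'); h \<in> carrier (Hom M C C')\<rbrakk> \<Longrightarrow>
        Assoc M A' B' C' \<cdot> ((f \<otimes>\<^sub>m g) \<otimes>\<^sub>m h) = (f \<otimes>\<^sub>m (g \<otimes>\<^sub>m h)) \<cdot> Assoc M A B C"
    and lunit_iso: "A \<in> Obj M \<Longrightarrow> is_isomorphism M (Unit_ob M \<otimes>\<^sub>o A) A (LUnit M A)"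
    and lunit_natural:
      "\<lbrakk>A \<in> Obj M; B \<in> Obj M; f \<in> carrier (Hom M A B)\<rbrakk> \<Longrightarrow>
        LUnit M B \<cdot> (Ident M (Unit_ob M) \<otimes>\<^sub>m f) = f \<cdot> LUnit M A"
    and runit_iso: "A \<in> Obj M \<Longrightarrow> is_isomorphism M (A \<otimes>\<^sub>o Unit_ob M) A (RUnit M A)"
    and runit_natural:
      "\<lbrakk>A \<in> Obj M; B \<in> Obj M; f \<in> carrier (Hom M A B)\<rbrakk> \<Longrightarrow>
        RUnit M B \<cdot> (f \<otimes>\<^sub>m Ident M (Unit_ob M)) = f \<cdot> RUnit M A"
    and pentagon:
      "\<lbrakk>A \<in> Obj M; B \<in> Obj M; C \<in> Obj M; D \<in> Obj M\<rbrakk> \<Longrightarrow>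
        Assoc M A B (C \<otimes>\<^sub>o D) \<cdot> Assoc M (A \<otimes>\<^sub>o B) C D =
        (Ident M A \<otimes>\<^sub>m Assoc M B C D) \<cdot> (Assoc M A (B \<otimes>\<^sub>o C) D \<cdot> (Assoc M A B C \<otimes>\<^sub>m Ident M D))"
    and triangle:
      "\<lbrakk>A \<in> Obj M; B \<in> Obj M\<rbrakk> \<Longrightarrow>
        (Ident M A \<otimes>\<^sub>m LUnit M B) \<cdot> Assoc M A (Unit_ob M) B = RUnit M A \<otimes>\<^sub>m Ident M B"

locale linear_monoidal_abelian_category =
  linear_monoidal_category K M + linear_abelian_category K M
  for K :: "'k ring" and M :: "('o, 'm, 'k, 'z) monoidal_cat_scheme" (structure)


section \<open>Graded lax monoidal functors to vector spaces\<close>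

text \<open>
  The grading group \<open>'i\<close> is \<^typ>\<open>int\<close> for graded and \<^typ>\<open>int \<times> int\<close> for bigraded functors.
\<close>

record ('i, 'o, 'm, 'k, 'v) graded_functor =
  ob :: "'i \<Rightarrow> 'o \<Rightarrow> ('k, 'v) module"
  mor :: "'i \<Rightarrow> 'm \<Rightarrow> 'v \<Rightarrow> 'v"

text \<open>
  A natural map \<open>E\<^sup>i(A) \<otimes> E\<^sup>j(B) \<rightarrow> E\<^sup>i\<^sup>+\<^sup>j(A \<otimes> B)\<close> is given by bilinear maps \<open>prd i j A B\<close>, and a linear
  map from the ground field to \<open>E\<^sup>0(1)\<close> by the image \<open>unt\<close> of its unit element.
\<close>

record ('i, 'o, 'm, 'k, 'v) graded_lax_functor = "('i, 'o, 'm, 'k, 'v) graded_functor" +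
  prd :: "'i \<Rightarrow> 'i \<Rightarrow> 'o \<Rightarrow> 'o \<Rightarrow> 'v \<Rightarrow> 'v \<Rightarrow> 'v"
  unt :: "'v"

locale additive_functors = linear_category K M
  for K :: "'k ring" and M :: "('o, 'm, 'k, 'z) linear_cat_scheme" (structure)
    and G :: "('i::ab_group_add, 'o, 'm, 'k, 'v, 'y) graded_functor_scheme" +
  assumes ob_vectorspace: "A \<in> Obj M \<Longrightarrow> module K (ob G i A)"
    and mor_linear:
      "\<lbrakk>A \<in> Obj M; B \<in> Obj M; f \<in> carrier (Hom M A B)\<rbrakk> \<Longrightarrow>
        linear_map K (ob G i A) (ob G i B) (mor G i f)"
    and mor_ident:
      "\<lbrakk>A \<in> Obj M; x \<in> carrier (ob G i A)\<rbrakk> \<Longrightarrow> mor G i (Ident M A) x = x"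
    and mor_comp:
      "\<lbrakk>A \<in> Obj M; B \<in> Obj M; C \<in> Obj M; f \<in> carrier (Hom M A B); g \<in> carrier (Hom M B C);
        x \<in> carrier (ob G i A)\<rbrakk> \<Longrightarrow> mor G i (g \<cdot> f) x = mor G i g (mor G i f x)"
    and mor_additive:
      "\<lbrakk>A \<in> Obj M; B \<in> Obj M; f \<in> carrier (Hom M A B); g \<in> carrier (Hom M A B);
        x \<in> carrier (ob G i A)\<rbrakk> \<Longrightarrow>
        mor G i (f \<oplus>\<^bsub>Hom M A B\<^esub> g) x = mor G i f x \<oplus>\<^bsub>ob G i B\<^esub> mor G i g x"

locale graded_lax_monoidal_functor = linear_monoidal_category K M + additive_functors K M G
  for K :: "'k ring" and M :: "('o, 'm, 'k, 'z) monoidal_cat_scheme" (structure)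
    and G :: "('i::ab_group_add, 'o, 'm, 'k, 'v) graded_lax_functor" +
  assumes prd_bilinear:
      "\<lbrakk>A \<in> Obj M; B \<in> Obj M\<rbrakk> \<Longrightarrow>
        bilinear_map K (ob G i A) (ob G j B) (ob G (i + j) (A \<otimes>\<^sub>o B)) (prd G i j A B)"
    and prd_natural:
      "\<lbrakk>A \<in> Obj M; B \<in> Obj M; A' \<in> Obj M; B' \<in> Obj M;
        f \<in> carrier (Hom M A A'); g \<in> carrier (Hom M B B');
        x \<in> carrier (ob G i A); y \<in> carrier (ob G j B)\<rbrakk> \<Longrightarrow>
        mor G (i + j) (f \<otimes>\<^sub>m g) (prd G i j A B x y) = prd G i j A' B' (mor G i f x) (mor G j g y)"
    and prd_assoc:
      "\<lbrakk>A \<in> Obj M; B \<in> Obj M; C \<in> Obj M;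
        x \<in> carrier (ob G i A); y \<in> carrier (ob G j B); z \<in> carrier (ob G k C)\<rbrakk> \<Longrightarrow>
        mor G (i + j + k) (Assoc M A B C) (prd G (i + j) k (A \<otimes>\<^sub>o B) C (prd G i j A B x y) z) =
        prd G i (j + k) A (B \<otimes>\<^sub>o C) x (prd G j k B C y z)"
    and unt_closed: "unt G \<in> carrier (ob G 0 (Unit_ob M))"
    and unt_left:
      "\<lbrakk>A \<in> Obj M; x \<in> carrier (ob G i A)\<rbrakk> \<Longrightarrow>
        mor G i (LUnit M A) (prd G 0 i (Unit_ob M) A (unt G) x) = x"
    and unt_right:
      "\<lbrakk>A \<in> Obj M; x \<in> carrier (ob G i A)\<rbrakk> \<Longrightarrow>
        mor G i (RUnit M A) (prd G i 0 A (Unit_ob M) x (unt G)) = x"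

text \<open>
  A differential \<open>d\<close> of degree \<open>\<delta>\<close>; \<open>tot\<close> is the total degree, which governs the sign in the
  Leibniz rule.
\<close>

locale differential_lax_monoidal_functor = graded_lax_monoidal_functor K M G
  for K :: "'k ring" and M :: "('o, 'm, 'k, 'z) monoidal_cat_scheme" (structure)
    and G :: "('i::ab_group_add, 'o, 'm, 'k, 'v) graded_lax_functor"
    and d :: "'i \<Rightarrow> 'o \<Rightarrow> 'v \<Rightarrow> 'v" and \<delta> :: 'i and tot :: "'i \<Rightarrow> int" +
  assumes d_linear: "A \<in> Obj M \<Longrightarrow> linear_map K (ob G i A) (ob G (i + \<delta>) A) (d i A)"
    and d_natural:
      "\<lbrakk>A \<in> Obj M; B \<in> Obj M; f \<in> carrier (Hom M A B); x \<in> carrier (ob G i A)\<rbrakk> \<Longrightarrow>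
        d i B (mor G i f x) = mor G (i + \<delta>) f (d i A x)"
    and d_square:
      "\<lbrakk>A \<in> Obj M; x \<in> carrier (ob G i A)\<rbrakk> \<Longrightarrow> d (i + \<delta>) A (d i A x) = \<zero>\<^bsub>ob G (i + \<delta> + \<delta>) A\<^esub>"
    and d_leibniz:
      "\<lbrakk>A \<in> Obj M; B \<in> Obj M; x \<in> carrier (ob G i A); y \<in> carrier (ob G j B)\<rbrakk> \<Longrightarrow>
        d (i + j) (A \<otimes>\<^sub>o B) (prd G i j A B x y) =
          prd G (i + \<delta>) j A B (d i A x) y
          \<oplus>\<^bsub>ob G (i + j + \<delta>) (A \<otimes>\<^sub>o B)\<^esub>
          koszul_sign (ob G (i + j + \<delta>) (A \<otimes>\<^sub>o B)) (tot i) (prd G i (j + \<delta>) A B x (d j B y))"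


subsection \<open>Isomorphisms\<close>

definition natural_isomorphism ::
  "'k ring \<Rightarrow> ('o, 'm, 'k, 'z) linear_cat_scheme \<Rightarrow>
   ('i, 'o, 'm, 'k, 'v, 'x) graded_functor_scheme \<Rightarrow>
   ('i, 'o, 'm, 'k, 'w, 'y) graded_functor_scheme \<Rightarrow> ('i \<Rightarrow> 'o \<Rightarrow> 'v \<Rightarrow> 'w) \<Rightarrow> bool" where
  "natural_isomorphism K M G H \<phi> \<longleftrightarrow>
     (\<forall>i. \<forall>A\<in>Obj M. linear_iso K (ob G i A) (ob H i A) (\<phi> i A)) \<and>
     (\<forall>i. \<forall>A\<in>Obj M. \<forall>B\<in>Obj M. \<forall>f\<in>carrier (Hom M A B). \<forall>x\<in>carrier (ob G i A).
        \<phi> i B (mor G i f x) = mor H i f (\<phi> i A x))"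

definition lax_monoidal_isomorphism ::
  "'k ring \<Rightarrow> ('o, 'm, 'k, 'z) monoidal_cat_scheme \<Rightarrow>
   ('i::ab_group_add, 'o, 'm, 'k, 'v) graded_lax_functor \<Rightarrow>
   ('i, 'o, 'm, 'k, 'w) graded_lax_functor \<Rightarrow> ('i \<Rightarrow> 'o \<Rightarrow> 'v \<Rightarrow> 'w) \<Rightarrow> bool" where
  "lax_monoidal_isomorphism K M G H \<phi> \<longleftrightarrow>
     natural_isomorphism K M G H \<phi> \<and>
     (\<forall>i j. \<forall>A\<in>Obj M. \<forall>B\<in>Obj M. \<forall>x\<in>carrier (ob G i A). \<forall>y\<in>carrier (ob G j B).
        \<phi> (i + j) (A \<otimes>\<^sub>o\<^bsub>M\<^esub> B) (prd G i j A B x y) = prd H i j A B (\<phi> i A x) (\<phi> j B y)) \<and>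
     \<phi> 0 (Unit_ob M) (unt G) = unt H"


subsection \<open>Subquotients and cohomology\<close>

definition subfunctor ::
  "('i, 'o, 'm, 'k, 'v, 'y) graded_functor_scheme \<Rightarrow> ('i \<Rightarrow> 'o \<Rightarrow> 'v set) \<Rightarrow>
   ('i, 'o, 'm, 'k, 'v) graded_functor" where
  "subfunctor G S = \<lparr>ob = (\<lambda>i A. (ob G i A)\<lparr>carrier := S i A\<rparr>), mor = mor G\<rparr>"

definition subquotient_functor ::
  "('o, 'm, 'k, 'z) linear_cat_scheme \<Rightarrow> ('i, 'o, 'm, 'k, 'v, 'y) graded_functor_scheme \<Rightarrow>
   ('i \<Rightarrow> 'o \<Rightarrow> 'v set) \<Rightarrow> ('i \<Rightarrow> 'o \<Rightarrow> 'v set) \<Rightarrow> ('i, 'o, 'm, 'k, 'v set) graded_functor" where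
  "subquotient_functor M G Z B =
     \<lparr>ob = (\<lambda>i A. subquotient (ob G i A) (Z i A) (B i A)),
      mor = (\<lambda>i f. induced_map (ob G i (Cod M f)) (B i (Cod M f)) (mor G i f))\<rparr>"

definition subquotient_lax_functor ::
  "('o, 'm, 'k, 'z) monoidal_cat_scheme \<Rightarrow>
   ('i::ab_group_add, 'o, 'm, 'k, 'v) graded_lax_functor \<Rightarrow>
   ('i \<Rightarrow> 'o \<Rightarrow> 'v set) \<Rightarrow> ('i \<Rightarrow> 'o \<Rightarrow> 'v set) \<Rightarrow>
   ('i, 'o, 'm, 'k, 'v set) graded_lax_functor" where
  "subquotient_lax_functor M G Z B =
     \<lparr>ob = ob (subquotient_functor M G Z B),
      mor = mor (subquotient_functor M G Z B),
      prd = (\<lambda>i j A A' X Y. \<Union>x\<in>X. \<Union>y\<in>Y.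
               B (i + j) (A \<otimes>\<^sub>o\<^bsub>M\<^esub> A') +>\<^bsub>ob G (i + j) (A \<otimes>\<^sub>o\<^bsub>M\<^esub> A')\<^esub> prd G i j A A' x y),
      unt = B 0 (Unit_ob M) +>\<^bsub>ob G 0 (Unit_ob M)\<^esub> unt G\<rparr>"

definition cocycles ::
  "('i::ab_group_add, 'o, 'm, 'k, 'v, 'y) graded_functor_scheme \<Rightarrow> ('i \<Rightarrow> 'o \<Rightarrow> 'v \<Rightarrow> 'v) \<Rightarrow> 'i \<Rightarrow>
   'i \<Rightarrow> 'o \<Rightarrow> 'v set" where
  "cocycles G d \<delta> i A = {x \<in> carrier (ob G i A). d i A x = \<zero>\<^bsub>ob G (i + \<delta>) A\<^esub>}"

definition coboundaries ::
  "('i::ab_group_add, 'o, 'm, 'k, 'v, 'y) graded_functor_scheme \<Rightarrow> ('i \<Rightarrow> 'o \<Rightarrow> 'v \<Rightarrow> 'v) \<Rightarrow> 'i \<Rightarrow>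
   'i \<Rightarrow> 'o \<Rightarrow> 'v set" where
  "coboundaries G d \<delta> i A = d (i - \<delta>) A ` carrier (ob G (i - \<delta>) A)"

definition cohomology_functor ::
  "('o, 'm, 'k, 'z) linear_cat_scheme \<Rightarrow>
   ('i::ab_group_add, 'o, 'm, 'k, 'v, 'y) graded_functor_scheme \<Rightarrow>
   ('i \<Rightarrow> 'o \<Rightarrow> 'v \<Rightarrow> 'v) \<Rightarrow> 'i \<Rightarrow> ('i, 'o, 'm, 'k, 'v set) graded_functor" where
  "cohomology_functor M G d \<delta> = subquotient_functor M G (cocycles G d \<delta>) (coboundaries G d \<delta>)"

definition cohomology_lax_functor ::
  "('o, 'm, 'k, 'z) monoidal_cat_scheme \<Rightarrow>
   ('i::ab_group_add, 'o, 'm, 'k, 'v) graded_lax_functor \<Rightarrow>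
   ('i \<Rightarrow> 'o \<Rightarrow> 'v \<Rightarrow> 'v) \<Rightarrow> 'i \<Rightarrow> ('i, 'o, 'm, 'k, 'v set) graded_lax_functor" where
  "cohomology_lax_functor M G d \<delta> =
     subquotient_lax_functor M G (cocycles G d \<delta>) (coboundaries G d \<delta>)"


section \<open>Filtered functors\<close>

text \<open>\<open>F p n A\<close> is the \<open>p\<close>-th step of the filtration on \<open>H\<^sup>n(A)\<close>.\<close>

locale filtered_graded_lax_monoidal_functor = graded_lax_monoidal_functor K M H
  for K :: "'k ring" and M :: "('o, 'm, 'k, 'z) monoidal_cat_scheme" (structure)
    and H :: "(int, 'o, 'm, 'k, 'v) graded_lax_functor"
    and F :: "int \<Rightarrow> int \<Rightarrow> 'o \<Rightarrow> 'v set" +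
  assumes filtration_subspace: "A \<in> Obj M \<Longrightarrow> submodule (F p n A) K (ob H n A)"
    and filtration_decreasing: "\<lbrakk>A \<in> Obj M; p \<le> q\<rbrakk> \<Longrightarrow> F q n A \<subseteq> F p n A"
    and filtration_exhaustive: "A \<in> Obj M \<Longrightarrow> (\<Union>p. F p n A) = carrier (ob H n A)"
    and filtration_hausdorff: "A \<in> Obj M \<Longrightarrow> (\<Inter>p. F p n A) = {\<zero>\<^bsub>ob H n A\<^esub>}"
    and filtration_natural:
      "\<lbrakk>A \<in> Obj M; B \<in> Obj M; f \<in> carrier (Hom M A B); x \<in> F p n A\<rbrakk> \<Longrightarrow> mor H n f x \<in> F p n B"
    and filtration_prd:
      "\<lbrakk>A \<in> Obj M; B \<in> Obj M; x \<in> F p m A; y \<in> F q n B\<rbrakk> \<Longrightarrow>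
        prd H m n A B x y \<in> F (p + q) (m + n) (A \<otimes>\<^sub>o B)"
    and filtration_unt: "unt H \<in> F 0 0 (Unit_ob M)"

text \<open>
  The unit complex is concentrated in degree \<open>0\<close> and in filtration \<open>\<le> 0\<close>, so the unit is a
  morphism of filtered complexes iff \<open>unt C\<close> is a cocycle lying in \<open>F\<^sup>0 C\<^sup>0(1)\<close>.
\<close>

locale filtered_dg_lax_monoidal_functor =
  differential_lax_monoidal_functor K M C d 1 "\<lambda>n. n" +
  filtered_graded_lax_monoidal_functor K M C F
  for K :: "'k ring" and M :: "('o, 'm, 'k, 'z) monoidal_cat_scheme" (structure)
    and C :: "(int, 'o, 'm, 'k, 'v) graded_lax_functor"
    and d :: "int \<Rightarrow> 'o \<Rightarrow> 'v \<Rightarrow> 'v"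
    and F :: "int \<Rightarrow> int \<Rightarrow> 'o \<Rightarrow> 'v set" +
  assumes filtration_d: "\<lbrakk>A \<in> Obj M; x \<in> F p n A\<rbrakk> \<Longrightarrow> d n A x \<in> F p (n + 1) A"
    and d_unt: "d 0 (Unit_ob M) (unt C) = \<zero>\<^bsub>ob C 1 (Unit_ob M)\<^esub>"

definition bounded_filtration ::
  "('i, 'o, 'm, 'k, 'v, 'y) graded_functor_scheme \<Rightarrow> (int \<Rightarrow> 'i \<Rightarrow> 'o \<Rightarrow> 'v set) \<Rightarrow>
   'i \<Rightarrow> 'o \<Rightarrow> bool" where
  "bounded_filtration C F n A \<longleftrightarrow>
     (\<exists>s t. s \<le> t \<and> F s n A = carrier (ob C n A) \<and> F t n A = {\<zero>\<^bsub>ob C n A\<^esub>})"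

text \<open>The image of \<open>H\<^sup>n(F\<^sup>p C) \<rightarrow> H\<^sup>n(C)\<close>.\<close>

definition cohomology_filtration ::
  "('o, 'm, 'k, 'z) linear_cat_scheme \<Rightarrow> (int, 'o, 'm, 'k, 'v, 'y) graded_functor_scheme \<Rightarrow>
   (int \<Rightarrow> 'o \<Rightarrow> 'v \<Rightarrow> 'v) \<Rightarrow> (int \<Rightarrow> int \<Rightarrow> 'o \<Rightarrow> 'v set) \<Rightarrow> int \<Rightarrow> int \<Rightarrow> 'o \<Rightarrow> 'v set set" where
  "cohomology_filtration M C d F p n A =
     induced_map (ob C n A) (coboundaries C d 1 n A) (\<lambda>x. x) `
       carrier (ob (cohomology_functor M (subfunctor C (F p)) d 1) n A)"

text \<open>The associated graded functor, \<open>(p, q) \<mapsto> F\<^sup>p H\<^sup>p\<^sup>+\<^sup>q / F\<^sup>p\<^sup>+\<^sup>1 H\<^sup>p\<^sup>+\<^sup>q\<close>.\<close>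

definition bigrade ::
  "(int, 'o, 'm, 'k, 'v) graded_lax_functor \<Rightarrow> (int \<times> int, 'o, 'm, 'k, 'v) graded_lax_functor" where
  "bigrade H =
     \<lparr>ob = (\<lambda>(p, q). ob H (p + q)), mor = (\<lambda>(p, q). mor H (p + q)),
      prd = (\<lambda>(p, q) (u, v). prd H (p + q) (u + v)), unt = unt H\<rparr>"

definition associated_graded ::
  "('o, 'm, 'k, 'z) monoidal_cat_scheme \<Rightarrow> (int, 'o, 'm, 'k, 'v) graded_lax_functor \<Rightarrow>
   (int \<Rightarrow> int \<Rightarrow> 'o \<Rightarrow> 'v set) \<Rightarrow> (int \<times> int, 'o, 'm, 'k, 'v set) graded_lax_functor" where
  "associated_graded M H F =
     subquotient_lax_functor M (bigrade H)
       (\<lambda>(p, q). F p (p + q)) (\<lambda>(p, q). F (p + 1) (p + q))"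

text \<open>The family of functors \<open>(p, q) \<mapsto> H\<^sup>p\<^sup>+\<^sup>q(F\<^sup>p C / F\<^sup>p\<^sup>+\<^sup>1 C)\<close>.\<close>

definition graded_piece ::
  "('o, 'm, 'k, 'z) linear_cat_scheme \<Rightarrow> (int, 'o, 'm, 'k, 'v, 'y) graded_functor_scheme \<Rightarrow>
   (int \<Rightarrow> int \<Rightarrow> 'o \<Rightarrow> 'v set) \<Rightarrow> int \<Rightarrow> (int, 'o, 'm, 'k, 'v set) graded_functor" where
  "graded_piece M C F p = subquotient_functor M C (F p) (F (p + 1))"

definition graded_piece_differential ::
  "(int, 'o, 'm, 'k, 'v, 'y) graded_functor_scheme \<Rightarrow> (int \<Rightarrow> 'o \<Rightarrow> 'v \<Rightarrow> 'v) \<Rightarrow>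
   (int \<Rightarrow> int \<Rightarrow> 'o \<Rightarrow> 'v set) \<Rightarrow> int \<Rightarrow> int \<Rightarrow> 'o \<Rightarrow> 'v set \<Rightarrow> 'v set" where
  "graded_piece_differential C d F p n A =
     induced_map (ob C (n + 1) A) (F (p + 1) (n + 1) A) (d n A)"

definition graded_piece_cohomology ::
  "('o, 'm, 'k, 'z) linear_cat_scheme \<Rightarrow> (int, 'o, 'm, 'k, 'v, 'y) graded_functor_scheme \<Rightarrow>
   (int \<Rightarrow> 'o \<Rightarrow> 'v \<Rightarrow> 'v) \<Rightarrow> (int \<Rightarrow> int \<Rightarrow> 'o \<Rightarrow> 'v set) \<Rightarrow>
   (int \<times> int, 'o, 'm, 'k, 'v set set) graded_functor" where
  "graded_piece_cohomology M C d F =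
     (let H = (\<lambda>p. cohomology_functor M (graded_piece M C F p) (graded_piece_differential C d F p) 1)
      in \<lparr>ob = (\<lambda>(p, q). ob (H p) (p + q)), mor = (\<lambda>(p, q). mor (H p) (p + q))\<rparr>)"


section \<open>Functorial multiplicative spectral sequences\<close>

definition page_degree :: "nat \<Rightarrow> int \<times> int" where
  "page_degree r = (int r, - int r + 1)"

definition total_degree :: "int \<times> int \<Rightarrow> int" where
  "total_degree = (\<lambda>(p, q). p + q)"

text \<open>
  \<open>E r\<close> is the \<open>r\<close>-th page, \<open>d r\<close> its differential, and \<open>\<phi> r\<close> the isomorphism from its cohomology
  to \<open>E (r + 1)\<close>. Values at \<open>r < a\<close> are irrelevant.
\<close>

locale functorial_multiplicative_spectral_sequence = linear_monoidal_category K M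
  for K :: "'k ring" and M :: "('o, 'm, 'k, 'z) monoidal_cat_scheme" (structure)
    and a :: nat
    and E :: "nat \<Rightarrow> (int \<times> int, 'o, 'm, 'k, 'e) graded_lax_functor"
    and d :: "nat \<Rightarrow> int \<times> int \<Rightarrow> 'o \<Rightarrow> 'e \<Rightarrow> 'e"
    and \<phi> :: "nat \<Rightarrow> int \<times> int \<Rightarrow> 'o \<Rightarrow> 'e set \<Rightarrow> 'e" +
  assumes page:
      "a \<le> r \<Longrightarrow> differential_lax_monoidal_functor K M (E r) (d r) (page_degree r) total_degree"
    and next_page:
      "a \<le> r \<Longrightarrow> lax_monoidal_isomorphism K M
         (cohomology_lax_functor M (E r) (d r) (page_degree r)) (E (Suc r)) (\<phi> r)"

text \<open>
  With \<open>r = a + j\<close>, \<open>iterated_cycles j \<subseteq> E\<^sub>a\<close> is the subfunctor \<open>Z\<^bsub>r-1\<^esub>\<close>, where \<open>Z\<^bsub>a-1\<^esub> = E\<^sub>a\<close>;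
  \<open>page_projection j\<close> is the canonical surjection \<open>Z\<^bsub>r-1\<^esub> \<rightarrow> E\<^sub>r\<close> (meaningless outside \<open>Z\<^bsub>r-1\<^esub>\<close>);
  and \<open>iterated_boundaries j\<close> is its kernel \<open>B\<^bsub>r-1\<^esub>\<close>. Thus \<open>E\<^sub>r \<cong> Z\<^bsub>r-1\<^esub> / B\<^bsub>r-1\<^esub>\<close>.
\<close>

primrec page_projection ::
  "nat \<Rightarrow> (nat \<Rightarrow> (int \<times> int, 'o, 'm, 'k, 'e) graded_lax_functor) \<Rightarrow>
   (nat \<Rightarrow> int \<times> int \<Rightarrow> 'o \<Rightarrow> 'e \<Rightarrow> 'e) \<Rightarrow> (nat \<Rightarrow> int \<times> int \<Rightarrow> 'o \<Rightarrow> 'e set \<Rightarrow> 'e) \<Rightarrow>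
   nat \<Rightarrow> int \<times> int \<Rightarrow> 'o \<Rightarrow> 'e \<Rightarrow> 'e" where
  "page_projection a E d \<phi> 0 i A x = x"
| "page_projection a E d \<phi> (Suc j) i A x =
     \<phi> (a + j) i A
       (coboundaries (E (a + j)) (d (a + j)) (page_degree (a + j)) i A
          +>\<^bsub>ob (E (a + j)) i A\<^esub> page_projection a E d \<phi> j i A x)"

primrec iterated_cycles ::
  "nat \<Rightarrow> (nat \<Rightarrow> (int \<times> int, 'o, 'm, 'k, 'e) graded_lax_functor) \<Rightarrow>
   (nat \<Rightarrow> int \<times> int \<Rightarrow> 'o \<Rightarrow> 'e \<Rightarrow> 'e) \<Rightarrow> (nat \<Rightarrow> int \<times> int \<Rightarrow> 'o \<Rightarrow> 'e set \<Rightarrow> 'e) \<Rightarrow>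
   nat \<Rightarrow> int \<times> int \<Rightarrow> 'o \<Rightarrow> 'e set" where
  "iterated_cycles a E d \<phi> 0 i A = carrier (ob (E a) i A)"
| "iterated_cycles a E d \<phi> (Suc j) i A =
     {x \<in> iterated_cycles a E d \<phi> j i A.
        page_projection a E d \<phi> j i A x
          \<in> cocycles (E (a + j)) (d (a + j)) (page_degree (a + j)) i A}"

definition iterated_boundaries ::
  "nat \<Rightarrow> (nat \<Rightarrow> (int \<times> int, 'o, 'm, 'k, 'e) graded_lax_functor) \<Rightarrow>
   (nat \<Rightarrow> int \<times> int \<Rightarrow> 'o \<Rightarrow> 'e \<Rightarrow> 'e) \<Rightarrow> (nat \<Rightarrow> int \<times> int \<Rightarrow> 'o \<Rightarrow> 'e set \<Rightarrow> 'e) \<Rightarrow>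
   nat \<Rightarrow> int \<times> int \<Rightarrow> 'o \<Rightarrow> 'e set" where
  "iterated_boundaries a E d \<phi> j i A =
     {x \<in> iterated_cycles a E d \<phi> j i A.
        page_projection a E d \<phi> j i A x = \<zero>\<^bsub>ob (E (a + j)) i A\<^esub>}"

definition limit_page ::
  "('o, 'm, 'k, 'z) monoidal_cat_scheme \<Rightarrow> nat \<Rightarrow>
   (nat \<Rightarrow> (int \<times> int, 'o, 'm, 'k, 'e) graded_lax_functor) \<Rightarrow>
   (nat \<Rightarrow> int \<times> int \<Rightarrow> 'o \<Rightarrow> 'e \<Rightarrow> 'e) \<Rightarrow> (nat \<Rightarrow> int \<times> int \<Rightarrow> 'o \<Rightarrow> 'e set \<Rightarrow> 'e) \<Rightarrow>
   (int \<times> int, 'o, 'm, 'k, 'e set) graded_lax_functor" where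
  "limit_page M a E d \<phi> =
     subquotient_lax_functor M (E a)
       (\<lambda>i A. \<Inter>j. iterated_cycles a E d \<phi> j i A)
       (\<lambda>i A. \<Union>j. iterated_boundaries a E d \<phi> j i A)"

definition converges_multiplicatively ::
  "'k ring \<Rightarrow> ('o, 'm, 'k, 'z) monoidal_cat_scheme \<Rightarrow> nat \<Rightarrow>
   (nat \<Rightarrow> (int \<times> int, 'o, 'm, 'k, 'e) graded_lax_functor) \<Rightarrow>
   (nat \<Rightarrow> int \<times> int \<Rightarrow> 'o \<Rightarrow> 'e \<Rightarrow> 'e) \<Rightarrow> (nat \<Rightarrow> int \<times> int \<Rightarrow> 'o \<Rightarrow> 'e set \<Rightarrow> 'e) \<Rightarrow>
   (int, 'o, 'm, 'k, 'h) graded_lax_functor \<Rightarrow> (int \<Rightarrow> int \<Rightarrow> 'o \<Rightarrow> 'h set) \<Rightarrow> bool" where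
  "converges_multiplicatively K M a E d \<phi> H F \<longleftrightarrow>
     filtered_graded_lax_monoidal_functor K M H F \<and>
     (\<exists>\<psi>. lax_monoidal_isomorphism K M (limit_page M a E d \<phi>) (associated_graded M H F) \<psi>)"

end

theory Submission
  imports Defs
begin

text \<open>
  The pages are those of Cartan's description of the spectral sequence of a filtered complex. Write
  \<open>Z\<^sub>r\<close> for the elements \<open>x\<close> of \<open>F\<^sup>p C\<^sup>n\<close> with \<open>d x\<close> in \<open>F\<^sup>p\<^sup>+\<^sup>r C\<^sup>n\<^sup>+\<^sup>1\<close>, where \<open>n = p + q\<close>, and \<open>B\<^sub>r\<close> for
  those \<open>x\<close> in \<open>Z\<^sub>r\<close> that are the sum of some \<open>d y\<close>, \<open>y\<close> in \<open>F\<^sup>p\<^sup>-\<^sup>r\<^sup>+\<^sup>1\<close>, and an element of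
  \<open>F\<^sup>p\<^sup>+\<^sup>1\<close>; then \<open>E\<^sub>r = Z\<^sub>r / B\<^sub>r\<close>. All \<open>Z\<^sub>r\<close> and \<open>B\<^sub>r\<close> are
  subfunctors of one and the same functor, the complex regraded by \<open>(p, q) \<mapsto> p + q\<close>. By the
  Leibniz rule, \<open>Z\<^sub>r\<close> is closed under exterior products and \<open>B\<^sub>r\<close> is a two-sided ideal in it (\<open>page_ideal\<close>). So every page inherits its products from the complex, and
  it inherits its differential as well, since \<open>d\<close> maps \<open>Z\<^sub>r\<close> and \<open>B\<^sub>r\<close> at \<open>(p, q)\<close> into those at
  \<open>(p + r, q - r + 1)\<close>.

  Every isomorphism that is needed compares two quotients of one pair of a subfunctor and an ideal.
  The notion behind this is \<open>lax_quotient\<close>: a surjection from a subfunctor of a fixed lax monoidal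
  functor that respects all structure and has a given ideal as its kernel. Two such surjections with
  the same source and kernel have isomorphic targets, and the isomorphism respects products because
  the surjections do (\<open>quotient_comparison_isomorphism\<close>). What remains is to find kernels:

    \<^item> the cohomology of \<open>E\<^sub>r\<close> and the page \<open>E\<^sub>r\<^sub>+\<^sub>1\<close> are both quotients of
      \<open>Z\<^sub>r\<^sub>+\<^sub>1\<close> by \<open>B\<^sub>r\<^sub>+\<^sub>1\<close> (\<open>page_cohomology_quotient\<close>);

    \<^item> on the objects of the category, \<open>E\<^sub>0\<close> with its differential is the family of complexes
      \<open>F\<^sup>p / F\<^sup>p\<^sup>+\<^sup>1\<close>, which identifies \<open>E\<^sub>1\<close> (\<open>first_page\<close>);

    \<^item> the limit page and the associated graded of the cohomology are both quotients of the cocycles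
      in \<open>F\<^sup>p\<close>, by the sums of a coboundary and an element of \<open>F\<^sup>p\<^sup>+\<^sup>1\<close>
      (\<open>limit_page_quotient\<close>, \<open>associated_graded_quotient\<close>).

  The last point uses the boundedness of the filtration: an element of \<open>Z\<^sub>r\<close> for \<open>r\<close> large enough
  is a cocycle, because \<open>F\<^sup>p\<^sup>+\<^sup>r C\<^sup>n\<^sup>+\<^sup>1\<close> vanishes. It also makes the filtration on the
  cohomology Hausdorff. That every coboundary in \<open>F\<^sup>p\<close> becomes a boundary on some page follows from
  exhaustiveness.
\<close>

section \<open>Subspaces, cosets and linear maps\<close>

context module
begin

lemma submodule_mem: "submodule H R M \<Longrightarrow> x \<in> H \<Longrightarrow> x \<in> carrier M"
  using submoduleE(1) by blast

lemma submodule_zero: "submodule H R M \<Longrightarrow> \<zero>\<^bsub>M\<^esub> \<in> H"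
  by (metis submodule.axioms(1) subgroup.one_closed monoid.select_convs(2))

lemma submodule_diff: "submodule H R M \<Longrightarrow> x \<in> H \<Longrightarrow> y \<in> H \<Longrightarrow> x \<ominus>\<^bsub>M\<^esub> y \<in> H"
  by (simp add: M.minus_eq submoduleE(3,5))

lemma submodule_cancel:
  "\<lbrakk>submodule H R M; x \<in> H; y \<in> carrier M; x \<oplus>\<^bsub>M\<^esub> y \<in> H\<rbrakk> \<Longrightarrow> y \<in> H"
  by (metis submoduleE(3,5) submodule_mem M.r_neg2 M.a_inv_closed M.a_comm M.a_assoc M.r_neg1)

lemma submoduleI_smult:
  assumes "H \<subseteq> carrier M" and "\<zero>\<^bsub>M\<^esub> \<in> H"
    and "\<And>x y. \<lbrakk>x \<in> H; y \<in> H\<rbrakk> \<Longrightarrow> x \<oplus>\<^bsub>M\<^esub> y \<in> H"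
    and "\<And>a x. \<lbrakk>a \<in> carrier R; x \<in> H\<rbrakk> \<Longrightarrow> a \<odot>\<^bsub>M\<^esub> x \<in> H"
  shows "submodule H R M"
proof (rule submoduleI)
  fix x assume x: "x \<in> H"
  then have "(\<ominus> \<one>) \<odot>\<^bsub>M\<^esub> x = \<ominus>\<^bsub>M\<^esub> x"
    using assms(1) smult_l_minus[of \<one> x] by auto
  then show "\<ominus>\<^bsub>M\<^esub> x \<in> H"
    using assms(4)[of "\<ominus> \<one>" x] x by simp
qed (use assms in auto)

lemma add_minus_cancel: "\<lbrakk>x \<in> carrier M; y \<in> carrier M\<rbrakk> \<Longrightarrow> x = y \<oplus>\<^bsub>M\<^esub> (x \<ominus>\<^bsub>M\<^esub> y)"
  by (simp add: M.minus_eq M.a_lcomm M.r_neg)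

lemma add_diff_cancel:
  assumes "x \<in> carrier M" "y \<in> carrier M"
  shows "x \<oplus>\<^bsub>M\<^esub> y \<ominus>\<^bsub>M\<^esub> x = y"
proof -
  have "x \<oplus>\<^bsub>M\<^esub> y \<ominus>\<^bsub>M\<^esub> x = y \<oplus>\<^bsub>M\<^esub> (x \<oplus>\<^bsub>M\<^esub> \<ominus>\<^bsub>M\<^esub> x)"
    using assms by (simp add: M.minus_eq M.a_ac)
  then show ?thesis using assms by (simp add: M.r_neg)
qed

lemma diff_diff_cancel:
  "\<lbrakk>x \<in> carrier M; y \<in> carrier M\<rbrakk> \<Longrightarrow> x \<ominus>\<^bsub>M\<^esub> (x \<ominus>\<^bsub>M\<^esub> y) = y"
  by (metis add_diff_cancel add_minus_cancel M.minus_closed M.a_comm)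

lemma mem_coset_iff:
  assumes "submodule B R M" and x: "x \<in> carrier M"
  shows "y \<in> B +>\<^bsub>M\<^esub> x \<longleftrightarrow> y \<in> carrier M \<and> y \<ominus>\<^bsub>M\<^esub> x \<in> B"
proof
  assume "y \<in> B +>\<^bsub>M\<^esub> x"
  then obtain b where b: "b \<in> B" "y = b \<oplus>\<^bsub>M\<^esub> x"
    by (auto simp: a_r_coset_def')
  then have "b \<in> carrier M" using assms submodule_mem by blast
  moreover have "b \<oplus>\<^bsub>M\<^esub> x \<ominus>\<^bsub>M\<^esub> x = b"
    using x \<open>b \<in> carrier M\<close> by (simp add: M.minus_eq M.a_assoc M.r_neg)
  ultimately show "y \<in> carrier M \<and> y \<ominus>\<^bsub>M\<^esub> x \<in> B" using b x by simp
next
  assume y: "y \<in> carrier M \<and> y \<ominus>\<^bsub>M\<^esub> x \<in> B"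
  then have "y = (y \<ominus>\<^bsub>M\<^esub> x) \<oplus>\<^bsub>M\<^esub> x"
    using x by (simp add: M.minus_eq M.a_assoc M.l_neg)
  then show "y \<in> B +>\<^bsub>M\<^esub> x" using y by (auto simp: a_r_coset_def')
qed

lemma coset_self: "\<lbrakk>submodule B R M; x \<in> carrier M\<rbrakk> \<Longrightarrow> x \<in> B +>\<^bsub>M\<^esub> x"
  by (simp add: mem_coset_iff submodule_zero M.minus_eq M.r_neg)

lemma coset_eq_iff:
  assumes B: "submodule B R M" and x: "x \<in> carrier M" and y: "y \<in> carrier M"
  shows "B +>\<^bsub>M\<^esub> x = B +>\<^bsub>M\<^esub> y \<longleftrightarrow> x \<ominus>\<^bsub>M\<^esub> y \<in> B"
proof
  assume "B +>\<^bsub>M\<^esub> x = B +>\<^bsub>M\<^esub> y"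
  then show "x \<ominus>\<^bsub>M\<^esub> y \<in> B" using coset_self[OF B x] mem_coset_iff[OF B y] by simp
next
  assume "x \<ominus>\<^bsub>M\<^esub> y \<in> B"
  then show "B +>\<^bsub>M\<^esub> x = B +>\<^bsub>M\<^esub> y"
    using mem_coset_iff[OF B y] M.a_repr_independence[of x B y] x y B submodule.axioms(1) by metis
qed

lemma coset_zero: "submodule B R M \<Longrightarrow> B +>\<^bsub>M\<^esub> \<zero>\<^bsub>M\<^esub> = B"
  by (simp add: submoduleE(1))

lemma coset_add:
  assumes "submodule B R M" "x \<in> carrier M" "y \<in> carrier M"
  shows "(B +>\<^bsub>M\<^esub> x) <+>\<^bsub>M\<^esub> (B +>\<^bsub>M\<^esub> y) = B +>\<^bsub>M\<^esub> (x \<oplus>\<^bsub>M\<^esub> y)"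
proof -
  have "abelian_subgroup B M"
    using assms(1) M.abelian_group_axioms
    by (intro abelian_subgroupI3 additive_subgroupI) (auto dest: submodule.axioms(1))
  then show ?thesis using abelian_subgroup.a_rcos_sum assms(2,3) by metis
qed

text \<open>
  Maps on subquotients are defined by unions over all representatives of a coset; such a union
  collapses to the value at one representative as soon as its members agree.
\<close>

lemma coset_Union:
  assumes "submodule B R M" and "x \<in> carrier M" and "\<And>y. y \<in> B +>\<^bsub>M\<^esub> x \<Longrightarrow> h y = h x"
  shows "(\<Union>y \<in> B +>\<^bsub>M\<^esub> x. h y) = h x"
  using assms coset_self by blast

lemma smult_coset:
  assumes B: "submodule B R M" and a: "a \<in> carrier R" and x: "x \<in> carrier M"
  shows "(\<Union>y \<in> B +>\<^bsub>M\<^esub> x. B +>\<^bsub>M\<^esub> (a \<odot>\<^bsub>M\<^esub> y)) = B +>\<^bsub>M\<^esub> (a \<odot>\<^bsub>M\<^esub> x)"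
proof (rule coset_Union[OF B x])
  fix y assume "y \<in> B +>\<^bsub>M\<^esub> x"
  then have y: "y \<in> carrier M" "y \<ominus>\<^bsub>M\<^esub> x \<in> B" using mem_coset_iff[OF B x] by auto
  then have "a \<odot>\<^bsub>M\<^esub> y \<ominus>\<^bsub>M\<^esub> a \<odot>\<^bsub>M\<^esub> x = a \<odot>\<^bsub>M\<^esub> (y \<ominus>\<^bsub>M\<^esub> x)"
    using a x by (simp add: M.minus_eq smult_r_distr smult_r_minus)
  then show "B +>\<^bsub>M\<^esub> (a \<odot>\<^bsub>M\<^esub> y) = B +>\<^bsub>M\<^esub> (a \<odot>\<^bsub>M\<^esub> x)"
    using coset_eq_iff[OF B] submoduleE(4)[OF B a y(2)] a x y by simp
qed

end

lemma koszul_submodule: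
  "\<lbrakk>module K V; submodule H K V; x \<in> H\<rbrakk> \<Longrightarrow> koszul_sign V n x \<in> H"
  by (simp add: koszul_sign_def module.submoduleE(3))

lemma koszul_closed: "\<lbrakk>module K V; x \<in> carrier V\<rbrakk> \<Longrightarrow> koszul_sign V n x \<in> carrier V"
  by (simp add: koszul_submodule module.carrier_is_submodule)

lemma linear_mapD:
  assumes "linear_map K V W f"
  shows "x \<in> carrier V \<Longrightarrow> f x \<in> carrier W"
    and "\<lbrakk>x \<in> carrier V; y \<in> carrier V\<rbrakk> \<Longrightarrow> f (x \<oplus>\<^bsub>V\<^esub> y) = f x \<oplus>\<^bsub>W\<^esub> f y"
    and "\<lbrakk>a \<in> carrier K; x \<in> carrier V\<rbrakk> \<Longrightarrow> f (a \<odot>\<^bsub>V\<^esub> x) = a \<odot>\<^bsub>W\<^esub> f x"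
  using assms by (auto simp: linear_map_def)

context
  fixes K :: "'k ring" and V :: "('k, 'v) module" and W :: "('k, 'w) module" and f
  assumes V: "module K V" and W: "module K W" and f: "linear_map K V W f"
begin

interpretation V: module K V by (rule V)
interpretation W: module K W by (rule W)

lemma linear_map_zero: "f \<zero>\<^bsub>V\<^esub> = \<zero>\<^bsub>W\<^esub>"
proof -
  have "f (\<zero>\<^bsub>K\<^esub> \<odot>\<^bsub>V\<^esub> \<zero>\<^bsub>V\<^esub>) = \<zero>\<^bsub>K\<^esub> \<odot>\<^bsub>W\<^esub> f \<zero>\<^bsub>V\<^esub>" using linear_mapD(3)[OF f] by blast
  then show ?thesis using linear_mapD(1)[OF f] by simp
qed

lemma linear_map_neg: "x \<in> carrier V \<Longrightarrow> f (\<ominus>\<^bsub>V\<^esub> x) = \<ominus>\<^bsub>W\<^esub> f x"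
  by (metis linear_mapD(1,2)[OF f] linear_map_zero V.M.a_inv_closed V.M.l_neg W.M.minus_equality)

lemma linear_map_diff:
  "\<lbrakk>x \<in> carrier V; y \<in> carrier V\<rbrakk> \<Longrightarrow> f (x \<ominus>\<^bsub>V\<^esub> y) = f x \<ominus>\<^bsub>W\<^esub> f y"
  by (simp add: V.M.minus_eq W.M.minus_eq linear_mapD(2)[OF f] linear_map_neg)

lemma linear_map_koszul:
  "x \<in> carrier V \<Longrightarrow> f (koszul_sign V n x) = koszul_sign W n (f x)"
  by (simp add: koszul_sign_def linear_map_neg)

lemma induced_map_coset:
  assumes B: "submodule B K V" and B': "submodule B' K W" and im: "\<And>b. b \<in> B \<Longrightarrow> f b \<in> B'"
    and x: "x \<in> carrier V"
  shows "induced_map W B' f (B +>\<^bsub>V\<^esub> x) = B' +>\<^bsub>W\<^esub> f x"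
  unfolding induced_map_def
proof (rule V.coset_Union[OF B x])
  fix y assume "y \<in> B +>\<^bsub>V\<^esub> x"
  then have y: "y \<in> carrier V" "y \<ominus>\<^bsub>V\<^esub> x \<in> B" using V.mem_coset_iff[OF B x] by auto
  then show "B' +>\<^bsub>W\<^esub> f y = B' +>\<^bsub>W\<^esub> f x"
    using W.coset_eq_iff[OF B'] im[OF y(2)] linear_map_diff[OF y(1) x] linear_mapD(1)[OF f] x by simp
qed

end

lemma bilinear_mapD:
  assumes "bilinear_map K U V W b"
  shows "x \<in> carrier U \<Longrightarrow> linear_map K V W (b x)"
    and "y \<in> carrier V \<Longrightarrow> linear_map K U W (\<lambda>x. b x y)"
  using assms by (auto simp: bilinear_map_def)

section \<open>Quotients of lax monoidal functors by ideals\<close>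

locale lax_subfunctor = graded_lax_monoidal_functor K M G
  for K :: "'k ring" and M :: "('o, 'm, 'k, 'z) monoidal_cat_scheme" (structure)
    and G :: "('i::ab_group_add, 'o, 'm, 'k, 'v) graded_lax_functor"
    and S :: "'i \<Rightarrow> 'o \<Rightarrow> 'v set" +
  assumes sub_submodule: "A \<in> Obj M \<Longrightarrow> submodule (S i A) K (ob G i A)"
    and sub_mor:
      "\<lbrakk>A \<in> Obj M; B \<in> Obj M; f \<in> carrier (Hom M A B); x \<in> S i A\<rbrakk> \<Longrightarrow> mor G i f x \<in> S i B"
    and sub_prd:
      "\<lbrakk>A \<in> Obj M; B \<in> Obj M; x \<in> S i A; y \<in> S j B\<rbrakk> \<Longrightarrow>
        prd G i j A B x y \<in> S (i + j) (A \<otimes>\<^sub>o B)"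
    and sub_unt: "unt G \<in> S 0 (Unit_ob M)"
begin

lemma sub_mem: "A \<in> Obj M \<Longrightarrow> x \<in> S i A \<Longrightarrow> x \<in> carrier (ob G i A)"
  by (rule module.submodule_mem[OF ob_vectorspace sub_submodule])

lemma sub_closed:
  assumes "A \<in> Obj M"
  shows sub_zero: "\<zero>\<^bsub>ob G i A\<^esub> \<in> S i A"
    and sub_neg: "x \<in> S i A \<Longrightarrow> \<ominus>\<^bsub>ob G i A\<^esub> x \<in> S i A"
    and sub_smult: "a \<in> carrier K \<Longrightarrow> x \<in> S i A \<Longrightarrow> a \<odot>\<^bsub>ob G i A\<^esub> x \<in> S i A"
    and sub_add: "x \<in> S i A \<Longrightarrow> y \<in> S i A \<Longrightarrow> x \<oplus>\<^bsub>ob G i A\<^esub> y \<in> S i A"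
    and sub_diff: "x \<in> S i A \<Longrightarrow> y \<in> S i A \<Longrightarrow> x \<ominus>\<^bsub>ob G i A\<^esub> y \<in> S i A"
proof -
  note m = ob_vectorspace[OF assms, of i] sub_submodule[OF assms, of i]
  show "\<zero>\<^bsub>ob G i A\<^esub> \<in> S i A" using m by (rule module.submodule_zero)
  show "x \<in> S i A \<Longrightarrow> \<ominus>\<^bsub>ob G i A\<^esub> x \<in> S i A" using m by (rule module.submoduleE(3))
  show "a \<in> carrier K \<Longrightarrow> x \<in> S i A \<Longrightarrow> a \<odot>\<^bsub>ob G i A\<^esub> x \<in> S i A"
    using m by (rule module.submoduleE(4))
  show "x \<in> S i A \<Longrightarrow> y \<in> S i A \<Longrightarrow> x \<oplus>\<^bsub>ob G i A\<^esub> y \<in> S i A"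
    using m by (rule module.submoduleE(5))
  show "x \<in> S i A \<Longrightarrow> y \<in> S i A \<Longrightarrow> x \<ominus>\<^bsub>ob G i A\<^esub> y \<in> S i A"
    using m by (rule module.submodule_diff)
qed

end

locale lax_ideal = lax_subfunctor K M G S
  for K :: "'k ring" and M :: "('o, 'm, 'k, 'z) monoidal_cat_scheme" (structure)
    and G :: "('i::ab_group_add, 'o, 'm, 'k, 'v) graded_lax_functor"
    and S :: "'i \<Rightarrow> 'o \<Rightarrow> 'v set" and N :: "'i \<Rightarrow> 'o \<Rightarrow> 'v set" +
  assumes ideal_submodule: "A \<in> Obj M \<Longrightarrow> submodule (N i A) K (ob G i A)"
    and ideal_subset: "\<lbrakk>A \<in> Obj M; x \<in> N i A\<rbrakk> \<Longrightarrow> x \<in> S i A"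
    and ideal_mor:
      "\<lbrakk>A \<in> Obj M; B \<in> Obj M; f \<in> carrier (Hom M A B); x \<in> N i A\<rbrakk> \<Longrightarrow> mor G i f x \<in> N i B"
    and ideal_prd_right:
      "\<lbrakk>A \<in> Obj M; B \<in> Obj M; x \<in> S i A; y \<in> N j B\<rbrakk> \<Longrightarrow>
        prd G i j A B x y \<in> N (i + j) (A \<otimes>\<^sub>o B)"
    and ideal_prd_left:
      "\<lbrakk>A \<in> Obj M; B \<in> Obj M; x \<in> N i A; y \<in> S j B\<rbrakk> \<Longrightarrow>
        prd G i j A B x y \<in> N (i + j) (A \<otimes>\<^sub>o B)"

text \<open>
  A quotient of \<open>S\<close> by the ideal \<open>N\<close>, presented by its projection \<open>\<alpha>\<close> rather than built from cosets.
  In this way one functor \<open>E\<close> may be exhibited as a quotient of different subfunctors \<open>S\<close>, and an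
  iterated quotient as a quotient of the original functor.
\<close>

locale lax_quotient = lax_ideal K M G S N
  for K :: "'k ring" and M :: "('o, 'm, 'k, 'z) monoidal_cat_scheme" (structure)
    and G :: "('i::ab_group_add, 'o, 'm, 'k, 'v) graded_lax_functor"
    and S :: "'i \<Rightarrow> 'o \<Rightarrow> 'v set" and N :: "'i \<Rightarrow> 'o \<Rightarrow> 'v set"
    and E :: "('i, 'o, 'm, 'k, 'w) graded_lax_functor" and \<alpha> :: "'i \<Rightarrow> 'o \<Rightarrow> 'v \<Rightarrow> 'w" +
  assumes proj_image: "A \<in> Obj M \<Longrightarrow> \<alpha> i A ` S i A = carrier (ob E i A)"
    and proj_eq_iff:
      "\<lbrakk>A \<in> Obj M; x \<in> S i A; y \<in> S i A\<rbrakk> \<Longrightarrow> \<alpha> i A x = \<alpha> i A y \<longleftrightarrow> x \<ominus>\<^bsub>ob G i A\<^esub> y \<in> N i A"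
    and proj_zero: "A \<in> Obj M \<Longrightarrow> \<alpha> i A \<zero>\<^bsub>ob G i A\<^esub> = \<zero>\<^bsub>ob E i A\<^esub>"
    and proj_add:
      "\<lbrakk>A \<in> Obj M; x \<in> S i A; y \<in> S i A\<rbrakk> \<Longrightarrow>
        \<alpha> i A (x \<oplus>\<^bsub>ob G i A\<^esub> y) = \<alpha> i A x \<oplus>\<^bsub>ob E i A\<^esub> \<alpha> i A y"
    and proj_smult:
      "\<lbrakk>A \<in> Obj M; a \<in> carrier K; x \<in> S i A\<rbrakk> \<Longrightarrow>
        \<alpha> i A (a \<odot>\<^bsub>ob G i A\<^esub> x) = a \<odot>\<^bsub>ob E i A\<^esub> \<alpha> i A x"
    and proj_mor:
      "\<lbrakk>A \<in> Obj M; B \<in> Obj M; f \<in> carrier (Hom M A B); x \<in> S i A\<rbrakk> \<Longrightarrow>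
        mor E i f (\<alpha> i A x) = \<alpha> i B (mor G i f x)"
    and proj_prd:
      "\<lbrakk>A \<in> Obj M; B \<in> Obj M; x \<in> S i A; y \<in> S j B\<rbrakk> \<Longrightarrow>
        prd E i j A B (\<alpha> i A x) (\<alpha> j B y) = \<alpha> (i + j) (A \<otimes>\<^sub>o B) (prd G i j A B x y)"
    and proj_unt: "unt E = \<alpha> 0 (Unit_ob M) (unt G)"
begin

lemma proj_closed: "A \<in> Obj M \<Longrightarrow> x \<in> S i A \<Longrightarrow> \<alpha> i A x \<in> carrier (ob E i A)"
  using proj_image by blast

lemma quotient_cases:
  assumes "A \<in> Obj M" and "X \<in> carrier (ob E i A)"
  obtains x where "x \<in> S i A" and "X = \<alpha> i A x"
  using assms proj_image by blast

lemma linear_map_quotientI: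
  assumes A: "A \<in> Obj M"
    and closed: "\<And>x. x \<in> S i A \<Longrightarrow> h (\<alpha> i A x) \<in> carrier W"
    and add: "\<And>x y. \<lbrakk>x \<in> S i A; y \<in> S i A\<rbrakk> \<Longrightarrow>
      h (\<alpha> i A (x \<oplus>\<^bsub>ob G i A\<^esub> y)) = h (\<alpha> i A x) \<oplus>\<^bsub>W\<^esub> h (\<alpha> i A y)"
    and smult: "\<And>a x. \<lbrakk>a \<in> carrier K; x \<in> S i A\<rbrakk> \<Longrightarrow>
      h (\<alpha> i A (a \<odot>\<^bsub>ob G i A\<^esub> x)) = a \<odot>\<^bsub>W\<^esub> h (\<alpha> i A x)"
  shows "linear_map K (ob E i A) W h"
  using closed add smult
  by (simp add: linear_map_def proj_image[OF A, symmetric] proj_add[OF A] proj_smult[OF A])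

lemma proj_zero_iff:
  assumes "A \<in> Obj M" and "x \<in> S i A"
  shows "\<alpha> i A x = \<zero>\<^bsub>ob E i A\<^esub> \<longleftrightarrow> x \<in> N i A"
proof -
  interpret V: module K "ob G i A" using ob_vectorspace assms(1) .
  have "x \<in> carrier (ob G i A)" using assms sub_mem by blast
  then have "x \<ominus>\<^bsub>ob G i A\<^esub> \<zero>\<^bsub>ob G i A\<^esub> = x" by (simp add: V.M.minus_eq)
  then show ?thesis
    using proj_eq_iff[OF assms sub_zero[OF assms(1)]] proj_zero[OF assms(1)] by simp
qed

lemma quotient_module:
  assumes A: "A \<in> Obj M"
  shows "module K (ob E i A)"
proof -
  interpret V: module K "ob G i A" using ob_vectorspace A .
  note simps = proj_add[OF A, symmetric] proj_smult[OF A, symmetric] proj_zero[OF A, symmetric]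
    proj_closed[OF A] sub_add[OF A] sub_smult[OF A] sub_zero[OF A] sub_mem[OF A]
  show ?thesis
  proof (rule moduleI)
    show "cring K" by (rule module.axioms(1)[OF ob_vectorspace[OF A]])
    show "abelian_group (ob E i A)"
    proof (rule abelian_groupI)
      fix X assume "X \<in> carrier (ob E i A)"
      then obtain x where x: "x \<in> S i A" "X = \<alpha> i A x" using quotient_cases[OF A] by metis
      have "\<alpha> i A (\<ominus>\<^bsub>ob G i A\<^esub> x) \<oplus>\<^bsub>ob E i A\<^esub> X = \<zero>\<^bsub>ob E i A\<^esub>"
        using x sub_neg[OF A x(1)] by (simp add: simps V.M.l_neg)
      then show "\<exists>Y\<in>carrier (ob E i A). Y \<oplus>\<^bsub>ob E i A\<^esub> X = \<zero>\<^bsub>ob E i A\<^esub>"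
        using proj_closed[OF A sub_neg[OF A x(1)]] by blast
    qed (auto elim!: quotient_cases[OF A] simp: simps V.M.a_ac)
  qed (auto elim!: quotient_cases[OF A] simp: simps V.smult_l_distr V.smult_r_distr V.smult_assoc1)
qed

lemma proj_neg:
  assumes A: "A \<in> Obj M" and y: "y \<in> S i A"
  shows "\<alpha> i A (\<ominus>\<^bsub>ob G i A\<^esub> y) = \<ominus>\<^bsub>ob E i A\<^esub> \<alpha> i A y"
proof -
  interpret V: module K "ob G i A" using ob_vectorspace A .
  interpret W: module K "ob E i A" using quotient_module A .
  have "\<alpha> i A (\<ominus>\<^bsub>ob G i A\<^esub> y) \<oplus>\<^bsub>ob E i A\<^esub> \<alpha> i A y = \<alpha> i A (\<ominus>\<^bsub>ob G i A\<^esub> y \<oplus>\<^bsub>ob G i A\<^esub> y)"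
    using proj_add[OF A sub_neg[OF A y] y] ..
  also have "\<dots> = \<zero>\<^bsub>ob E i A\<^esub>"
    unfolding V.M.l_neg[OF sub_mem[OF A y]] by (rule proj_zero[OF A])
  finally show ?thesis
    using W.M.minus_equality proj_closed[OF A y] proj_closed[OF A sub_neg[OF A y]] by metis
qed

lemma proj_diff:
  assumes A: "A \<in> Obj M" and x: "x \<in> S i A" and y: "y \<in> S i A"
  shows "\<alpha> i A (x \<ominus>\<^bsub>ob G i A\<^esub> y) = \<alpha> i A x \<ominus>\<^bsub>ob E i A\<^esub> \<alpha> i A y"
  unfolding a_minus_def proj_add[OF A x sub_neg[OF A y]] proj_neg[OF A y] ..

lemma proj_koszul:
  "\<lbrakk>A \<in> Obj M; x \<in> S i A\<rbrakk> \<Longrightarrow>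
    \<alpha> i A (koszul_sign (ob G i A) n x) = koszul_sign (ob E i A) n (\<alpha> i A x)"
  unfolding koszul_sign_def using proj_neg by (cases "even n") auto

lemma quotient_additive: "additive_functors K M E"
proof (intro additive_functors.intro additive_functors_axioms.intro)
  show "linear_category K M" by (rule linear_category_axioms)
next
  fix A i assume "A \<in> Obj M"
  then show "module K (ob E i A)" by (rule quotient_module)
next
  fix A B f i assume AB: "A \<in> Obj M" "B \<in> Obj M" and f: "f \<in> carrier (Hom M A B)"
  note m = linear_mapD[OF mor_linear[OF AB f, of i]]
  show "linear_map K (ob E i A) (ob E i B) (mor E i f)"
    by (rule linear_map_quotientI[OF AB(1)])
      (simp_all add: AB proj_mor[OF AB f] proj_closed sub_mor[OF AB f] sub_mem sub_add sub_smult m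
        proj_add[symmetric] proj_smult[symmetric])
next
  fix A X i assume A: "A \<in> Obj M" and "X \<in> carrier (ob E i A)"
  then obtain x where x: "x \<in> S i A" "X = \<alpha> i A x" by (rule quotient_cases)
  show "mor E i (Ident M A) X = X"
    unfolding x(2) proj_mor[OF A A ident_closed[OF A] x(1)] mor_ident[OF A sub_mem[OF A x(1)]] ..
next
  fix A B C f g X i
  assume *: "A \<in> Obj M" "B \<in> Obj M" "C \<in> Obj M" "f \<in> carrier (Hom M A B)" "g \<in> carrier (Hom M B C)"
    "X \<in> carrier (ob E i A)"
  then have gf: "g \<cdot> f \<in> carrier (Hom M A C)"
    using linear_mapD(1)[OF bilinear_mapD(1)[OF comp_bilinear]] by blast
  obtain x where x: "x \<in> S i A" "X = \<alpha> i A x" using *(1,6) by (rule quotient_cases)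
  show "mor E i (g \<cdot> f) X = mor E i g (mor E i f X)"
    unfolding x(2) proj_mor[OF *(1,3) gf x(1)] proj_mor[OF *(1,2,4) x(1)]
      proj_mor[OF *(2,3,5) sub_mor[OF *(1,2,4) x(1)]] mor_comp[OF *(1-5) sub_mem[OF *(1) x(1)]] ..
next
  fix A B f g X i
  assume *: "A \<in> Obj M" "B \<in> Obj M" "f \<in> carrier (Hom M A B)" "g \<in> carrier (Hom M A B)"
    "X \<in> carrier (ob E i A)"
  then have fg: "f \<oplus>\<^bsub>Hom M A B\<^esub> g \<in> carrier (Hom M A B)"
    by (meson hom_vectorspace module.axioms(2) abelian_group.axioms(1) abelian_monoid.a_closed)
  obtain x where x: "x \<in> S i A" "X = \<alpha> i A x" using *(1,5) by (rule quotient_cases)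
  have "mor E i (f \<oplus>\<^bsub>Hom M A B\<^esub> g) X = \<alpha> i B (mor G i f x \<oplus>\<^bsub>ob G i B\<^esub> mor G i g x)"
    unfolding x(2) proj_mor[OF *(1,2) fg x(1)] mor_additive[OF *(1-4) sub_mem[OF *(1) x(1)]] ..
  also have "\<dots> = mor E i f X \<oplus>\<^bsub>ob E i B\<^esub> mor E i g X"
    unfolding x(2) proj_mor[OF *(1,2,3) x(1)] proj_mor[OF *(1,2,4) x(1)]
    by (rule proj_add[OF *(2) sub_mor[OF *(1,2,3) x(1)] sub_mor[OF *(1,2,4) x(1)]])
  finally show "mor E i (f \<oplus>\<^bsub>Hom M A B\<^esub> g) X = mor E i f X \<oplus>\<^bsub>ob E i B\<^esub> mor E i g X" .
qed

text \<open>
  The axioms are identities between natural operations, and the projection is onto and commutes with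
  all of them, so they descend from representatives.
\<close>

theorem quotient_graded_lax: "graded_lax_monoidal_functor K M E"
proof (intro graded_lax_monoidal_functor.intro graded_lax_monoidal_functor_axioms.intro)
  show "linear_monoidal_category K M" by (rule linear_monoidal_category_axioms)
  show "additive_functors K M E" by (rule quotient_additive)
next
  fix A B i j assume AB: "A \<in> Obj M" "B \<in> Obj M"
  note T = tensor_ob_closed[OF AB]
  have r: "linear_map K (ob E j B) (ob E (i + j) (A \<otimes>\<^sub>o B)) (prd E i j A B (\<alpha> i A x))"
    if x: "x \<in> S i A" for x
  proof (rule linear_map_quotientI[OF AB(2)])
    note m = linear_mapD[OF bilinear_mapD(1)[OF prd_bilinear[OF AB, of i j] sub_mem[OF AB(1) x]]]
    fix y assume y: "y \<in> S j B"
    show "prd E i j A B (\<alpha> i A x) (\<alpha> j B y) \<in> carrier (ob E (i + j) (A \<otimes>\<^sub>o B))"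
      by (simp add: AB T x y proj_prd proj_closed sub_prd)
    show "prd E i j A B (\<alpha> i A x) (\<alpha> j B (y \<oplus>\<^bsub>ob G j B\<^esub> z)) =
        prd E i j A B (\<alpha> i A x) (\<alpha> j B y) \<oplus>\<^bsub>ob E (i + j) (A \<otimes>\<^sub>o B)\<^esub> prd E i j A B (\<alpha> i A x) (\<alpha> j B z)"
      if "z \<in> S j B" for z
      by (simp add: AB T x y that proj_prd proj_add[symmetric] sub_prd sub_add sub_mem m)
    show "prd E i j A B (\<alpha> i A x) (\<alpha> j B (a \<odot>\<^bsub>ob G j B\<^esub> y)) =
        a \<odot>\<^bsub>ob E (i + j) (A \<otimes>\<^sub>o B)\<^esub> prd E i j A B (\<alpha> i A x) (\<alpha> j B y)"
      if "a \<in> carrier K" for a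
      by (simp add: AB T x y that proj_prd proj_smult[symmetric] sub_prd sub_smult sub_mem m)
  qed
  have l: "linear_map K (ob E i A) (ob E (i + j) (A \<otimes>\<^sub>o B)) (\<lambda>X. prd E i j A B X (\<alpha> j B y))"
    if y: "y \<in> S j B" for y
  proof (rule linear_map_quotientI[OF AB(1)])
    note m = linear_mapD[OF bilinear_mapD(2)[OF prd_bilinear[OF AB, of i j] sub_mem[OF AB(2) y]]]
    fix x assume x: "x \<in> S i A"
    show "prd E i j A B (\<alpha> i A x) (\<alpha> j B y) \<in> carrier (ob E (i + j) (A \<otimes>\<^sub>o B))"
      by (simp add: AB T x y proj_prd proj_closed sub_prd)
    show "prd E i j A B (\<alpha> i A (x \<oplus>\<^bsub>ob G i A\<^esub> z)) (\<alpha> j B y) =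
        prd E i j A B (\<alpha> i A x) (\<alpha> j B y) \<oplus>\<^bsub>ob E (i + j) (A \<otimes>\<^sub>o B)\<^esub> prd E i j A B (\<alpha> i A z) (\<alpha> j B y)"
      if "z \<in> S i A" for z
      by (simp add: AB T x y that proj_prd proj_add[symmetric] sub_prd sub_add sub_mem m)
    show "prd E i j A B (\<alpha> i A (a \<odot>\<^bsub>ob G i A\<^esub> x)) (\<alpha> j B y) =
        a \<odot>\<^bsub>ob E (i + j) (A \<otimes>\<^sub>o B)\<^esub> prd E i j A B (\<alpha> i A x) (\<alpha> j B y)"
      if "a \<in> carrier K" for a
      by (simp add: AB T x y that proj_prd proj_smult[symmetric] sub_prd sub_smult sub_mem m)
  qed
  show "bilinear_map K (ob E i A) (ob E j B) (ob E (i + j) (A \<otimes>\<^sub>o B)) (prd E i j A B)"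
    using l r unfolding bilinear_map_def by (simp add: proj_image[OF AB(1), symmetric] proj_image[OF AB(2), symmetric])
next
  fix A B A' B' f g X Y i j
  assume *: "A \<in> Obj M" "B \<in> Obj M" "A' \<in> Obj M" "B' \<in> Obj M" "f \<in> carrier (Hom M A A')"
    "g \<in> carrier (Hom M B B')" "X \<in> carrier (ob E i A)" "Y \<in> carrier (ob E j B)"
  then have "f \<otimes>\<^sub>m g \<in> carrier (Hom M (A \<otimes>\<^sub>o B) (A' \<otimes>\<^sub>o B'))"
    using linear_mapD(1)[OF bilinear_mapD(1)[OF tensor_mor_bilinear]] by blast
  moreover obtain x where "x \<in> S i A" "X = \<alpha> i A x" using *(1,7) by (rule quotient_cases)
  moreover obtain y where "y \<in> S j B" "Y = \<alpha> j B y" using *(2,8) by (rule quotient_cases)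
  ultimately show "mor E (i + j) (f \<otimes>\<^sub>m g) (prd E i j A B X Y) =
      prd E i j A' B' (mor E i f X) (mor E j g Y)"
    using * proj_mor[OF *(1,3,5)] proj_mor[OF *(2,4,6)] sub_mor[OF *(1,3,5)] sub_mor[OF *(2,4,6)]
      proj_mor[OF tensor_ob_closed[OF *(1,2)] tensor_ob_closed[OF *(3,4)]] prd_natural[OF *(1-6)]
    by (simp add: proj_prd sub_mem sub_prd)
next
  fix A B C X Y Z i j k assume A: "A \<in> Obj M" "B \<in> Obj M" "C \<in> Obj M"
    "X \<in> carrier (ob E i A)" "Y \<in> carrier (ob E j B)" "Z \<in> carrier (ob E k C)"
  have "is_isomorphism M (A \<otimes>\<^sub>o B \<otimes>\<^sub>o C) (A \<otimes>\<^sub>o (B \<otimes>\<^sub>o C)) (Assoc M A B C)" using assoc_iso A by auto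
  then have f: "Assoc M A B C \<in> carrier (Hom M (A \<otimes>\<^sub>o B \<otimes>\<^sub>o C) (A \<otimes>\<^sub>o (B \<otimes>\<^sub>o C)))"
    by (simp add: is_isomorphism_def)
  obtain x where x: "x \<in> S i A" "X = \<alpha> i A x" using A(1,4) by (rule quotient_cases)
  obtain y where y: "y \<in> S j B" "Y = \<alpha> j B y" using A(2,5) by (rule quotient_cases)
  obtain z where z: "z \<in> S k C" "Z = \<alpha> k C z" using A(3,6) by (rule quotient_cases)
  note T = tensor_ob_closed[OF A(1,2)] tensor_ob_closed[OF A(2,3)]
  note P = sub_prd[OF A(1,2) x(1) y(1)] sub_prd[OF A(2,3) y(1) z(1)]
  have "mor E (i + j + k) (Assoc M A B C) (prd E (i + j) k (A \<otimes>\<^sub>o B) C (prd E i j A B X Y) Z)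
     = \<alpha> (i + j + k) (A \<otimes>\<^sub>o (B \<otimes>\<^sub>o C)) (prd G i (j + k) A (B \<otimes>\<^sub>o C) x (prd G j k B C y z))"
    using prd_assoc[OF A(1-3) sub_mem[OF A(1) x(1)] sub_mem[OF A(2) y(1)] sub_mem[OF A(3) z(1)]]
      proj_mor[OF _ _ f] sub_prd[OF T(1) A(3) P(1) z(1)] T A(1-3) x y z P
    by (simp add: proj_prd tensor_ob_closed)
  also have "\<dots> = \<alpha> (i + (j + k)) (A \<otimes>\<^sub>o (B \<otimes>\<^sub>o C)) (prd G i (j + k) A (B \<otimes>\<^sub>o C) x (prd G j k B C y z))"
    by (simp only: add.assoc)
  also have "\<dots> = prd E i (j + k) A (B \<otimes>\<^sub>o C) X (prd E j k B C Y Z)"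
    using x y z P T A(1-3) by (simp add: proj_prd)
  finally show "mor E (i + j + k) (Assoc M A B C) (prd E (i + j) k (A \<otimes>\<^sub>o B) C (prd E i j A B X Y) Z)
     = prd E i (j + k) A (B \<otimes>\<^sub>o C) X (prd E j k B C Y Z)" .
next
  show "unt E \<in> carrier (ob E 0 (Unit_ob M))"
    by (simp add: proj_unt proj_closed sub_unt unit_ob_closed)
next
  fix A i X assume A: "A \<in> Obj M" "X \<in> carrier (ob E i A)"
  then obtain x where x: "x \<in> S i A" "X = \<alpha> i A x" by (rule quotient_cases)
  have f: "LUnit M A \<in> carrier (Hom M (Unit_ob M \<otimes>\<^sub>o A) A)"
    using lunit_iso[OF A(1)] by (simp add: is_isomorphism_def)
  note T = tensor_ob_closed[OF unit_ob_closed A(1)]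
  show "mor E i (LUnit M A) (prd E 0 i (Unit_ob M) A (unt E) X) = X"
    using proj_mor[OF T A(1) f, of _ i] sub_prd[OF unit_ob_closed A(1) sub_unt x(1)] x
      proj_prd[OF unit_ob_closed A(1) sub_unt x(1)] unt_left[OF A(1) sub_mem[OF A(1) x(1)]]
    by (simp add: proj_unt)
next
  fix A i X assume A: "A \<in> Obj M" "X \<in> carrier (ob E i A)"
  then obtain x where x: "x \<in> S i A" "X = \<alpha> i A x" by (rule quotient_cases)
  have f: "RUnit M A \<in> carrier (Hom M (A \<otimes>\<^sub>o Unit_ob M) A)"
    using runit_iso[OF A(1)] by (simp add: is_isomorphism_def)
  note T = tensor_ob_closed[OF A(1) unit_ob_closed]
  show "mor E i (RUnit M A) (prd E i 0 A (Unit_ob M) X (unt E)) = X"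
    using proj_mor[OF T A(1) f, of _ i] sub_prd[OF A(1) unit_ob_closed x(1) sub_unt] x
      proj_prd[OF A(1) unit_ob_closed x(1) sub_unt] unt_right[OF A(1) sub_mem[OF A(1) x(1)]]
    by (simp add: proj_unt)
qed

end

lemma subquotient_lax_functor_sel:
  "ob (subquotient_lax_functor M G Z B) i A = subquotient (ob G i A) (Z i A) (B i A)"
  "mor (subquotient_lax_functor M G Z B) i f =
     induced_map (ob G i (Cod M f)) (B i (Cod M f)) (mor G i f)"
  "prd (subquotient_lax_functor M G Z B) i j A A' X Y = (\<Union>x\<in>X. \<Union>y\<in>Y.
     B (i + j) (A \<otimes>\<^sub>o\<^bsub>M\<^esub> A') +>\<^bsub>ob G (i + j) (A \<otimes>\<^sub>o\<^bsub>M\<^esub> A')\<^esub> prd G i j A A' x y)"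
  "unt (subquotient_lax_functor M G Z B) = B 0 (Unit_ob M) +>\<^bsub>ob G 0 (Unit_ob M)\<^esub> unt G"
  by (simp_all add: subquotient_lax_functor_def subquotient_functor_def)

lemma subquotient_sel:
  "carrier (subquotient V Z B) = (\<lambda>x. B +>\<^bsub>V\<^esub> x) ` Z"
  "\<zero>\<^bsub>subquotient V Z B\<^esub> = B"
  "X \<oplus>\<^bsub>subquotient V Z B\<^esub> Y = X <+>\<^bsub>V\<^esub> Y"
  "a \<odot>\<^bsub>subquotient V Z B\<^esub> X = (\<Union>x\<in>X. B +>\<^bsub>V\<^esub> (a \<odot>\<^bsub>V\<^esub> x))"
  by (simp_all add: subquotient_def)

context lax_ideal
begin

lemma ideal_coset_sub:
  assumes A: "A \<in> Obj M" and x: "x \<in> S i A" and y: "y \<in> N i A +>\<^bsub>ob G i A\<^esub> x"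
  shows "y \<in> S i A"
proof -
  obtain n where "n \<in> N i A" "y = n \<oplus>\<^bsub>ob G i A\<^esub> x"
    using y by (auto simp: a_r_coset_def')
  then show ?thesis using sub_add[OF A ideal_subset[OF A] x] by simp
qed

text \<open>
  Here the two-sided ideal property enters: changing either factor by an element of \<open>N\<close> changes the
  product by one, so that the union defining the product of cosets is a single coset.
\<close>

lemma prd_coset:
  assumes AB: "A \<in> Obj M" "B \<in> Obj M" and x: "x \<in> S i A" and y: "y \<in> S j B"
  shows "(\<Union>x'\<in>N i A +>\<^bsub>ob G i A\<^esub> x. \<Union>y'\<in>N j B +>\<^bsub>ob G j B\<^esub> y.
      N (i + j) (A \<otimes>\<^sub>o B) +>\<^bsub>ob G (i + j) (A \<otimes>\<^sub>o B)\<^esub> prd G i j A B x' y') =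
    N (i + j) (A \<otimes>\<^sub>o B) +>\<^bsub>ob G (i + j) (A \<otimes>\<^sub>o B)\<^esub> prd G i j A B x y"
proof -
  note T = tensor_ob_closed[OF AB]
  interpret V: module K "ob G i A" by (rule ob_vectorspace[OF AB(1)])
  interpret W: module K "ob G j B" by (rule ob_vectorspace[OF AB(2)])
  interpret U: module K "ob G (i + j) (A \<otimes>\<^sub>o B)" by (rule ob_vectorspace[OF T])
  note b = prd_bilinear[OF AB, of i j]
  note NV = ideal_submodule[OF AB(1), of i] and NW = ideal_submodule[OF AB(2), of j]
    and NU = ideal_submodule[OF T, of "i + j"]
  have P: "prd G i j A B x' y' \<in> carrier (ob G (i + j) (A \<otimes>\<^sub>o B))"
    if "x' \<in> S i A" "y' \<in> S j B" for x' y'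
    using sub_mem[OF T sub_prd[OF AB that]] .
  have inner: "(\<Union>y'\<in>N j B +>\<^bsub>ob G j B\<^esub> y.
      N (i + j) (A \<otimes>\<^sub>o B) +>\<^bsub>ob G (i + j) (A \<otimes>\<^sub>o B)\<^esub> prd G i j A B x' y') =
    N (i + j) (A \<otimes>\<^sub>o B) +>\<^bsub>ob G (i + j) (A \<otimes>\<^sub>o B)\<^esub> prd G i j A B x y"
    if x': "x' \<in> N i A +>\<^bsub>ob G i A\<^esub> x" for x'
  proof -
    have x'S: "x' \<in> S i A" by (rule ideal_coset_sub[OF AB(1) x x'])
    have dx: "x' \<ominus>\<^bsub>ob G i A\<^esub> x \<in> N i A"
      using V.mem_coset_iff[OF NV sub_mem[OF AB(1) x]] x' by simp
    have "(\<Union>y'\<in>N j B +>\<^bsub>ob G j B\<^esub> y.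
        N (i + j) (A \<otimes>\<^sub>o B) +>\<^bsub>ob G (i + j) (A \<otimes>\<^sub>o B)\<^esub> prd G i j A B x' y') =
      N (i + j) (A \<otimes>\<^sub>o B) +>\<^bsub>ob G (i + j) (A \<otimes>\<^sub>o B)\<^esub> prd G i j A B x' y"
    proof (rule W.coset_Union[OF NW sub_mem[OF AB(2) y]])
      fix y' assume y': "y' \<in> N j B +>\<^bsub>ob G j B\<^esub> y"
      have y'S: "y' \<in> S j B" by (rule ideal_coset_sub[OF AB(2) y y'])
      have dy: "y' \<ominus>\<^bsub>ob G j B\<^esub> y \<in> N j B"
        using W.mem_coset_iff[OF NW sub_mem[OF AB(2) y]] y' by simp
      have "prd G i j A B x' y' \<ominus>\<^bsub>ob G (i + j) (A \<otimes>\<^sub>o B)\<^esub> prd G i j A B x' y \<in> N (i + j) (A \<otimes>\<^sub>o B)"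
        using linear_map_diff[OF W.module_axioms U.module_axioms
            bilinear_mapD(1)[OF b sub_mem[OF AB(1) x'S]] sub_mem[OF AB(2) y'S] sub_mem[OF AB(2) y]]
          ideal_prd_right[OF AB x'S dy] by simp
      then show "N (i + j) (A \<otimes>\<^sub>o B) +>\<^bsub>ob G (i + j) (A \<otimes>\<^sub>o B)\<^esub> prd G i j A B x' y' =
          N (i + j) (A \<otimes>\<^sub>o B) +>\<^bsub>ob G (i + j) (A \<otimes>\<^sub>o B)\<^esub> prd G i j A B x' y"
        using U.coset_eq_iff[OF NU P[OF x'S y'S] P[OF x'S y]] by simp
    qed
    moreover have "prd G i j A B x' y \<ominus>\<^bsub>ob G (i + j) (A \<otimes>\<^sub>o B)\<^esub> prd G i j A B x y \<in> N (i + j) (A \<otimes>\<^sub>o B)"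
      using linear_map_diff[OF V.module_axioms U.module_axioms
          bilinear_mapD(2)[OF b sub_mem[OF AB(2) y]] sub_mem[OF AB(1) x'S] sub_mem[OF AB(1) x]]
        ideal_prd_left[OF AB dx y] by simp
    ultimately show ?thesis
      using U.coset_eq_iff[OF NU P[OF x'S y] P[OF x y]] by simp
  qed
  show ?thesis
    using inner V.coset_self[OF NV sub_mem[OF AB(1) x]] by blast
qed

theorem subquotient_lax_quotient:
  "lax_quotient K M G S N (subquotient_lax_functor M G S N) (\<lambda>i A x. N i A +>\<^bsub>ob G i A\<^esub> x)"
proof (intro lax_quotient.intro lax_quotient_axioms.intro)
  show "lax_ideal K M G S N" by (rule lax_ideal_axioms)
next
  fix A i assume A: "A \<in> Obj M"
  show "(\<lambda>x. N i A +>\<^bsub>ob G i A\<^esub> x) ` S i A = carrier (ob (subquotient_lax_functor M G S N) i A)"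
    by (simp add: subquotient_lax_functor_sel subquotient_sel)
  show "N i A +>\<^bsub>ob G i A\<^esub> \<zero>\<^bsub>ob G i A\<^esub> = \<zero>\<^bsub>ob (subquotient_lax_functor M G S N) i A\<^esub>"
    using module.coset_zero[OF ob_vectorspace[OF A] ideal_submodule[OF A]]
    by (simp add: subquotient_lax_functor_sel subquotient_sel)
  fix x assume x: "x \<in> S i A"
  show "N i A +>\<^bsub>ob G i A\<^esub> (a \<odot>\<^bsub>ob G i A\<^esub> x) =
      a \<odot>\<^bsub>ob (subquotient_lax_functor M G S N) i A\<^esub> (N i A +>\<^bsub>ob G i A\<^esub> x)"
    if "a \<in> carrier K" for a
    using module.smult_coset[OF ob_vectorspace[OF A] ideal_submodule[OF A] that sub_mem[OF A x]]
    by (simp add: subquotient_lax_functor_sel subquotient_sel)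
  fix y assume y: "y \<in> S i A"
  show "N i A +>\<^bsub>ob G i A\<^esub> x = N i A +>\<^bsub>ob G i A\<^esub> y \<longleftrightarrow> x \<ominus>\<^bsub>ob G i A\<^esub> y \<in> N i A"
    by (rule module.coset_eq_iff[OF ob_vectorspace[OF A] ideal_submodule[OF A] sub_mem[OF A x]
          sub_mem[OF A y]])
  show "N i A +>\<^bsub>ob G i A\<^esub> (x \<oplus>\<^bsub>ob G i A\<^esub> y) = (N i A +>\<^bsub>ob G i A\<^esub> x)
      \<oplus>\<^bsub>ob (subquotient_lax_functor M G S N) i A\<^esub> (N i A +>\<^bsub>ob G i A\<^esub> y)"
    using module.coset_add[OF ob_vectorspace[OF A] ideal_submodule[OF A] sub_mem[OF A x]
          sub_mem[OF A y]]
    by (simp add: subquotient_lax_functor_sel subquotient_sel)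
next
  fix A B f x i assume AB: "A \<in> Obj M" "B \<in> Obj M" and f: "f \<in> carrier (Hom M A B)"
    and x: "x \<in> S i A"
  have "Cod M f = B" using hom_dom_cod[OF AB f] by simp
  then show "mor (subquotient_lax_functor M G S N) i f (N i A +>\<^bsub>ob G i A\<^esub> x) =
      N i B +>\<^bsub>ob G i B\<^esub> mor G i f x"
    using induced_map_coset[OF ob_vectorspace[OF AB(1)] ob_vectorspace[OF AB(2)] mor_linear[OF AB f]
        ideal_submodule[OF AB(1)] ideal_submodule[OF AB(2)] ideal_mor[OF AB f] sub_mem[OF AB(1) x]]
    by (simp add: subquotient_lax_functor_sel)
next
  fix A B x y i j
  assume "A \<in> Obj M" "B \<in> Obj M" "x \<in> S i A" "y \<in> S j B"
  then show "prd (subquotient_lax_functor M G S N) i j A B (N i A +>\<^bsub>ob G i A\<^esub> x) (N j B +>\<^bsub>ob G j B\<^esub> y) =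
      N (i + j) (A \<otimes>\<^sub>o B) +>\<^bsub>ob G (i + j) (A \<otimes>\<^sub>o B)\<^esub> prd G i j A B x y"
    by (simp only: subquotient_lax_functor_sel prd_coset)
next
  show "unt (subquotient_lax_functor M G S N) = N 0 (Unit_ob M) +>\<^bsub>ob G 0 (Unit_ob M)\<^esub> unt G"
    by (simp add: subquotient_lax_functor_sel)
qed

end

text \<open>
  Values outside the objects of \<open>M\<close> are arbitrary, so families of subspaces can only be expected to
  agree on objects.
\<close>

lemma lax_ideal_cong:
  assumes ideal: "lax_ideal K M G S N"
    and S: "\<And>i A. A \<in> Obj M \<Longrightarrow> S' i A = S i A" and N: "\<And>i A. A \<in> Obj M \<Longrightarrow> N' i A = N i A"
  shows "lax_ideal K M G S' N'"
proof -
  interpret lax_ideal K M G S N by (rule ideal)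
  show ?thesis
    by (intro lax_ideal.intro lax_ideal_axioms.intro lax_subfunctor.intro lax_subfunctor_axioms.intro
        graded_lax_monoidal_functor_axioms)
      (simp_all add: S N sub_submodule sub_mor sub_prd sub_unt ideal_submodule ideal_subset ideal_mor
        ideal_prd_right ideal_prd_left tensor_ob_closed unit_ob_closed)
qed

text \<open>
  The map \<open>\<alpha> x \<mapsto> \<beta> x\<close>, evaluated at a chosen lift; it depends on no choice once \<open>\<alpha>\<close> and \<open>\<beta>\<close> have the
  same kernel.
\<close>

definition quotient_comparison ::
  "('i \<Rightarrow> 'o \<Rightarrow> 'v set) \<Rightarrow> ('i \<Rightarrow> 'o \<Rightarrow> 'v \<Rightarrow> 'e) \<Rightarrow> ('i \<Rightarrow> 'o \<Rightarrow> 'v \<Rightarrow> 'f) \<Rightarrow> 'i \<Rightarrow> 'o \<Rightarrow> 'e \<Rightarrow> 'f" where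
  "quotient_comparison S \<alpha> \<beta> i A X = \<beta> i A (SOME x. x \<in> S i A \<and> \<alpha> i A x = X)"

lemma quotient_comparison_proj:
  assumes \<alpha>: "lax_quotient K M G S N E \<alpha>" and \<beta>: "lax_quotient K M G S N E' \<beta>"
    and A: "A \<in> Obj M" and x: "x \<in> S i A"
  shows "quotient_comparison S \<alpha> \<beta> i A (\<alpha> i A x) = \<beta> i A x"
proof -
  define y where "y = (SOME y. y \<in> S i A \<and> \<alpha> i A y = \<alpha> i A x)"
  have y: "y \<in> S i A \<and> \<alpha> i A y = \<alpha> i A x"
    unfolding y_def by (rule someI[of _ x]) (simp add: x)
  then have "\<beta> i A y = \<beta> i A x"
    using lax_quotient.proj_eq_iff[OF \<alpha> A, of y i x] lax_quotient.proj_eq_iff[OF \<beta> A, of y i x] x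
    by simp
  then show ?thesis by (simp add: quotient_comparison_def y_def)
qed

text \<open>
  A natural bijection \<open>\<alpha> x \<mapsto> \<beta> x\<close> between two quotients by the same ideal is compatible with every
  operation with which \<open>\<alpha>\<close> and \<open>\<beta>\<close> are.
\<close>

theorem quotient_comparison_isomorphism:
  assumes \<alpha>: "lax_quotient K M G S N E \<alpha>" and \<beta>: "lax_quotient K M G S N E' \<beta>"
  shows "lax_monoidal_isomorphism K M E E' (quotient_comparison S \<alpha> \<beta>)"
proof -
  interpret E: lax_quotient K M G S N E \<alpha> by (rule \<alpha>)
  interpret E': lax_quotient K M G S N E' \<beta> by (rule \<beta>)
  note c = quotient_comparison_proj[OF \<alpha> \<beta>]
  have lin: "linear_map K (ob E i A) (ob E' i A) (quotient_comparison S \<alpha> \<beta> i A)"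
    if A: "A \<in> Obj M" for i A
    by (rule E.linear_map_quotientI[OF A])
      (simp_all add: c[OF A] E'.proj_closed[OF A] E'.proj_add[OF A] E'.proj_smult[OF A]
        E.sub_add[OF A] E.sub_smult[OF A])
  have bij: "bij_betw (quotient_comparison S \<alpha> \<beta> i A) (carrier (ob E i A)) (carrier (ob E' i A))"
    if A: "A \<in> Obj M" for i A
    unfolding bij_betw_def E.proj_image[OF A, symmetric] E'.proj_image[OF A, symmetric]
    using c[OF A] E.proj_eq_iff[OF A] E'.proj_eq_iff[OF A]
    by (auto simp: inj_on_def image_image)
  have nat: "quotient_comparison S \<alpha> \<beta> i B (mor E i f X) = mor E' i f (quotient_comparison S \<alpha> \<beta> i A X)"
    if AB: "A \<in> Obj M" "B \<in> Obj M" and f: "f \<in> carrier (Hom M A B)" and X: "X \<in> carrier (ob E i A)"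
    for i A B f X
  proof -
    obtain x where x: "x \<in> S i A" "X = \<alpha> i A x" using AB(1) X by (rule E.quotient_cases)
    show ?thesis
      unfolding x(2) E.proj_mor[OF AB f x(1)] c[OF AB(1) x(1)] E'.proj_mor[OF AB f x(1)]
      by (rule c[OF AB(2) E.sub_mor[OF AB f x(1)]])
  qed
  have prd: "quotient_comparison S \<alpha> \<beta> (i + j) (A \<otimes>\<^sub>o\<^bsub>M\<^esub> B) (prd E i j A B X Y) =
      prd E' i j A B (quotient_comparison S \<alpha> \<beta> i A X) (quotient_comparison S \<alpha> \<beta> j B Y)"
    if AB: "A \<in> Obj M" "B \<in> Obj M" and X: "X \<in> carrier (ob E i A)" and Y: "Y \<in> carrier (ob E j B)"
    for i j A B X Y
  proof -
    obtain x where x: "x \<in> S i A" "X = \<alpha> i A x" using AB(1) X by (rule E.quotient_cases)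
    obtain y where y: "y \<in> S j B" "Y = \<alpha> j B y" using AB(2) Y by (rule E.quotient_cases)
    show ?thesis
      unfolding x(2) y(2) E.proj_prd[OF AB x(1) y(1)] c[OF AB(1) x(1)] c[OF AB(2) y(1)]
        E'.proj_prd[OF AB x(1) y(1)]
      by (rule c[OF E.tensor_ob_closed[OF AB] E.sub_prd[OF AB x(1) y(1)]])
  qed
  have unt: "quotient_comparison S \<alpha> \<beta> 0 (Unit_ob M) (unt E) = unt E'"
    unfolding E.proj_unt E'.proj_unt by (rule c[OF E.unit_ob_closed E.sub_unt])
  show ?thesis
    using lin bij nat prd unt
    by (simp add: lax_monoidal_isomorphism_def natural_isomorphism_def linear_iso_def)
qed

context lax_quotient
begin

lemma image_submodule:
  assumes A: "A \<in> Obj M" and H: "submodule H K (ob G i A)" and sub: "H \<subseteq> S i A"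
  shows "submodule (\<alpha> i A ` H) K (ob E i A)"
proof -
  interpret V: module K "ob G i A" by (rule ob_vectorspace[OF A])
  interpret W: module K "ob E i A" by (rule quotient_module[OF A])
  show ?thesis
  proof (rule W.submoduleI_smult)
    show "\<alpha> i A ` H \<subseteq> carrier (ob E i A)" using sub proj_closed[OF A] by blast
    show "\<zero>\<^bsub>ob E i A\<^esub> \<in> \<alpha> i A ` H" using V.submodule_zero[OF H] proj_zero[OF A] by (metis imageI)
    show "X \<oplus>\<^bsub>ob E i A\<^esub> Y \<in> \<alpha> i A ` H" if XY: "X \<in> \<alpha> i A ` H" "Y \<in> \<alpha> i A ` H" for X Y
    proof -
      obtain x y where xy: "x \<in> H" "X = \<alpha> i A x" "y \<in> H" "Y = \<alpha> i A y" using XY by blast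
      then have "x \<in> S i A" "y \<in> S i A" using sub by blast+
      then have "X \<oplus>\<^bsub>ob E i A\<^esub> Y = \<alpha> i A (x \<oplus>\<^bsub>ob G i A\<^esub> y)"
        using proj_add[OF A, of x i y] xy by simp
      then show ?thesis using V.submoduleE(5)[OF H xy(1,3)] by simp
    qed
    show "a \<odot>\<^bsub>ob E i A\<^esub> X \<in> \<alpha> i A ` H" if a: "a \<in> carrier K" and X: "X \<in> \<alpha> i A ` H" for a X
    proof -
      obtain x where x: "x \<in> H" "X = \<alpha> i A x" using X by blast
      then have "a \<odot>\<^bsub>ob E i A\<^esub> X = \<alpha> i A (a \<odot>\<^bsub>ob G i A\<^esub> x)" using sub a proj_smult[OF A] by auto
      then show ?thesis using V.submoduleE(4)[OF H a x(1)] by simp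
    qed
  qed
qed

lemma image_mor:
  assumes "A \<in> Obj M" "B \<in> Obj M" "f \<in> carrier (Hom M A B)"
    and "H \<subseteq> S i A" and "\<And>x. x \<in> H \<Longrightarrow> mor G i f x \<in> H'" and "X \<in> \<alpha> i A ` H"
  shows "mor E i f X \<in> \<alpha> i B ` H'"
  using assms(4-6) proj_mor[OF assms(1-3)] by auto

lemma image_prd:
  assumes "A \<in> Obj M" "B \<in> Obj M" and "H \<subseteq> S i A" "H' \<subseteq> S j B"
    and "\<And>x y. \<lbrakk>x \<in> H; y \<in> H'\<rbrakk> \<Longrightarrow> prd G i j A B x y \<in> H''"
    and "X \<in> \<alpha> i A ` H" "Y \<in> \<alpha> j B ` H'"
  shows "prd E i j A B X Y \<in> \<alpha> (i + j) (A \<otimes>\<^sub>o B) ` H''"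
proof -
  obtain x y where xy: "x \<in> H" "y \<in> H'" and XY: "X = \<alpha> i A x" "Y = \<alpha> j B y"
    using assms(6,7) by blast
  have "x \<in> S i A" "y \<in> S j B" using xy assms(3,4) by blast+
  from proj_prd[OF assms(1,2) this] show ?thesis using assms(5)[OF xy] unfolding XY by simp
qed

lemma image_ideal:
  assumes ideal: "lax_ideal K M G S' N'" and sub: "\<And>i A. A \<in> Obj M \<Longrightarrow> S' i A \<subseteq> S i A"
  shows "lax_ideal K M E (\<lambda>i A. \<alpha> i A ` S' i A) (\<lambda>i A. \<alpha> i A ` N' i A)"
proof -
  interpret I: lax_ideal K M G S' N' by (rule ideal)
  have sub': "N' i A \<subseteq> S i A" if "A \<in> Obj M" for i A using sub[OF that] I.ideal_subset[OF that] by blast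
  show ?thesis
  proof (intro lax_ideal.intro lax_ideal_axioms.intro lax_subfunctor.intro lax_subfunctor_axioms.intro)
    show "graded_lax_monoidal_functor K M E" by (rule quotient_graded_lax)
    show "unt E \<in> \<alpha> 0 (Unit_ob M) ` S' 0 (Unit_ob M)" using proj_unt I.sub_unt by blast
  next
    fix A B x y i j assume AB: "A \<in> Obj M" "B \<in> Obj M"
    show "prd E i j A B x y \<in> \<alpha> (i + j) (A \<otimes>\<^sub>o B) ` S' (i + j) (A \<otimes>\<^sub>o B)"
      if "x \<in> \<alpha> i A ` S' i A" "y \<in> \<alpha> j B ` S' j B"
      using image_prd[OF AB sub[OF AB(1)] sub[OF AB(2)] I.sub_prd[OF AB]] that by blast
    show "prd E i j A B x y \<in> \<alpha> (i + j) (A \<otimes>\<^sub>o B) ` N' (i + j) (A \<otimes>\<^sub>o B)"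
      if "x \<in> \<alpha> i A ` S' i A" "y \<in> \<alpha> j B ` N' j B"
      using image_prd[OF AB sub[OF AB(1)] sub'[OF AB(2)] I.ideal_prd_right[OF AB]] that by blast
    show "prd E i j A B x y \<in> \<alpha> (i + j) (A \<otimes>\<^sub>o B) ` N' (i + j) (A \<otimes>\<^sub>o B)"
      if "x \<in> \<alpha> i A ` N' i A" "y \<in> \<alpha> j B ` S' j B"
      using image_prd[OF AB sub'[OF AB(1)] sub[OF AB(2)] I.ideal_prd_left[OF AB]] that by blast
  next
    fix A B f x i assume AB: "A \<in> Obj M" "B \<in> Obj M" "f \<in> carrier (Hom M A B)"
    show "mor E i f x \<in> \<alpha> i B ` S' i B" if "x \<in> \<alpha> i A ` S' i A"
      using image_mor[OF AB sub[OF AB(1)] I.sub_mor[OF AB]] that by blast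
    show "mor E i f x \<in> \<alpha> i B ` N' i B" if "x \<in> \<alpha> i A ` N' i A"
      using image_mor[OF AB sub'[OF AB(1)] I.ideal_mor[OF AB]] that by blast
  next
    fix A i assume A: "A \<in> Obj M"
    show "submodule (\<alpha> i A ` S' i A) K (ob E i A)"
      by (rule image_submodule[OF A I.sub_submodule[OF A] sub[OF A]])
    show "submodule (\<alpha> i A ` N' i A) K (ob E i A)"
      by (rule image_submodule[OF A I.ideal_submodule[OF A] sub'[OF A]])
    show "x \<in> \<alpha> i A ` S' i A" if "x \<in> \<alpha> i A ` N' i A" for x
      using that I.ideal_subset[OF A] by blast
  qed
qed

text \<open>
  A form of the isomorphism theorems: a subquotient \<open>Z / B\<close> of a quotient \<open>E\<close> of \<open>S\<close> is a quotient of any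
  subfunctor \<open>S'\<close> of \<open>S\<close> that maps onto \<open>Z\<close>. The subfunctor \<open>S'\<close> may be smaller than the preimage of
  \<open>Z\<close>, which makes it possible to pass from one page to the next without enlarging \<open>Z\<^sub>r\<^sub>+\<^sub>1\<close> by the
  kernel of \<open>Z\<^sub>r \<rightarrow> E\<^sub>r\<close>.
\<close>

theorem quotient_subquotient:
  assumes ideal: "lax_ideal K M E Z B" and lifts: "lax_subfunctor K M G S'"
    and sub: "\<And>i A. A \<in> Obj M \<Longrightarrow> S' i A \<subseteq> S i A"
    and onto: "\<And>i A. A \<in> Obj M \<Longrightarrow> \<alpha> i A ` S' i A = Z i A"
    and ker: "\<And>i A. A \<in> Obj M \<Longrightarrow> N' i A = {x \<in> S' i A. \<alpha> i A x \<in> B i A}"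
  shows "lax_quotient K M G S' N' (subquotient_lax_functor M E Z B)
    (\<lambda>i A x. B i A +>\<^bsub>ob E i A\<^esub> \<alpha> i A x)"
proof -
  interpret I: lax_ideal K M E Z B by (rule ideal)
  interpret L: lax_subfunctor K M G S' by (rule lifts)
  interpret Q: lax_quotient K M E Z B "subquotient_lax_functor M E Z B"
    "\<lambda>i A x. B i A +>\<^bsub>ob E i A\<^esub> x" by (rule I.subquotient_lax_quotient)
  have S: "x \<in> S i A" and Z: "\<alpha> i A x \<in> Z i A" if "A \<in> Obj M" "x \<in> S' i A" for i A x
    using that sub onto by blast+
  have N'I: "x \<in> N' i A" if "A \<in> Obj M" "x \<in> S' i A" "\<alpha> i A x \<in> B i A" for i A x
    using that ker by blast
  have N'D: "x \<in> S' i A" "\<alpha> i A x \<in> B i A" if "A \<in> Obj M" "x \<in> N' i A" for i A x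
    using that ker by blast+
  show ?thesis
  proof (intro lax_quotient.intro lax_quotient_axioms.intro lax_ideal.intro lax_ideal_axioms.intro)
    show "lax_subfunctor K M G S'" by (rule lifts)
  next
    fix A i assume A: "A \<in> Obj M"
    interpret V: module K "ob G i A" by (rule ob_vectorspace[OF A])
    interpret W: module K "ob E i A" by (rule quotient_module[OF A])
    note sB = I.ideal_submodule[OF A, of i]
    show "submodule (N' i A) K (ob G i A)"
    proof (rule V.submoduleI_smult)
      show "N' i A \<subseteq> carrier (ob G i A)" using N'D(1)[OF A] L.sub_mem[OF A] by blast
      show "\<zero>\<^bsub>ob G i A\<^esub> \<in> N' i A"
        by (rule N'I[OF A L.sub_zero[OF A]]) (simp add: proj_zero[OF A] W.submodule_zero[OF sB])
      show "x \<oplus>\<^bsub>ob G i A\<^esub> y \<in> N' i A" if x: "x \<in> N' i A" and y: "y \<in> N' i A" for x y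
        by (rule N'I[OF A L.sub_add[OF A N'D(1)[OF A x] N'D(1)[OF A y]]])
          (simp add: proj_add[OF A S[OF A N'D(1)[OF A x]] S[OF A N'D(1)[OF A y]]]
            W.submoduleE(5)[OF sB N'D(2)[OF A x] N'D(2)[OF A y]])
      show "a \<odot>\<^bsub>ob G i A\<^esub> x \<in> N' i A" if a: "a \<in> carrier K" and x: "x \<in> N' i A" for a x
        by (rule N'I[OF A L.sub_smult[OF A a N'D(1)[OF A x]]])
          (simp add: proj_smult[OF A a S[OF A N'D(1)[OF A x]]] W.submoduleE(4)[OF sB a N'D(2)[OF A x]])
    qed
    show "x \<in> S' i A" if "x \<in> N' i A" for x by (rule N'D(1)[OF A that])
    show "(\<lambda>x. B i A +>\<^bsub>ob E i A\<^esub> \<alpha> i A x) ` S' i A = carrier (ob (subquotient_lax_functor M E Z B) i A)"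
      unfolding Q.proj_image[OF A, symmetric] onto[OF A, symmetric] by (simp add: image_image)
    show "B i A +>\<^bsub>ob E i A\<^esub> \<alpha> i A \<zero>\<^bsub>ob G i A\<^esub> = \<zero>\<^bsub>ob (subquotient_lax_functor M E Z B) i A\<^esub>"
      unfolding proj_zero[OF A] by (rule Q.proj_zero[OF A])
    fix x assume x: "x \<in> S' i A"
    show "B i A +>\<^bsub>ob E i A\<^esub> \<alpha> i A (a \<odot>\<^bsub>ob G i A\<^esub> x) =
        a \<odot>\<^bsub>ob (subquotient_lax_functor M E Z B) i A\<^esub> (B i A +>\<^bsub>ob E i A\<^esub> \<alpha> i A x)"
      if a: "a \<in> carrier K" for a
      unfolding proj_smult[OF A a S[OF A x]] by (rule Q.proj_smult[OF A a Z[OF A x]])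
    fix y assume y: "y \<in> S' i A"
    show "B i A +>\<^bsub>ob E i A\<^esub> \<alpha> i A (x \<oplus>\<^bsub>ob G i A\<^esub> y) = (B i A +>\<^bsub>ob E i A\<^esub> \<alpha> i A x)
        \<oplus>\<^bsub>ob (subquotient_lax_functor M E Z B) i A\<^esub> (B i A +>\<^bsub>ob E i A\<^esub> \<alpha> i A y)"
      unfolding proj_add[OF A S[OF A x] S[OF A y]] by (rule Q.proj_add[OF A Z[OF A x] Z[OF A y]])
    have "x \<ominus>\<^bsub>ob G i A\<^esub> y \<in> S' i A" by (rule L.sub_diff[OF A x y])
    then show "B i A +>\<^bsub>ob E i A\<^esub> \<alpha> i A x = B i A +>\<^bsub>ob E i A\<^esub> \<alpha> i A y \<longleftrightarrow> x \<ominus>\<^bsub>ob G i A\<^esub> y \<in> N' i A"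
      unfolding Q.proj_eq_iff[OF A Z[OF A x] Z[OF A y]] ker[OF A]
        proj_diff[OF A S[OF A x] S[OF A y], symmetric] by simp
  next
    fix A B' f x i assume AB: "A \<in> Obj M" "B' \<in> Obj M" "f \<in> carrier (Hom M A B')"
    show "mor G i f x \<in> N' i B'" if x: "x \<in> N' i A"
    proof (rule N'I[OF AB(2) L.sub_mor[OF AB N'D(1)[OF AB(1) x]]])
      show "\<alpha> i B' (mor G i f x) \<in> B i B'"
        unfolding proj_mor[OF AB S[OF AB(1) N'D(1)[OF AB(1) x]], symmetric]
        by (rule I.ideal_mor[OF AB N'D(2)[OF AB(1) x]])
    qed
    show "mor (subquotient_lax_functor M E Z B) i f (B i A +>\<^bsub>ob E i A\<^esub> \<alpha> i A x) =
        B i B' +>\<^bsub>ob E i B'\<^esub> \<alpha> i B' (mor G i f x)" if x: "x \<in> S' i A"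
      unfolding Q.proj_mor[OF AB Z[OF AB(1) x]] proj_mor[OF AB S[OF AB(1) x]] ..
  next
    fix A B' x y i j assume AB: "A \<in> Obj M" "B' \<in> Obj M"
    note T = tensor_ob_closed[OF AB]
    show "prd G i j A B' x y \<in> N' (i + j) (A \<otimes>\<^sub>o B')" if x: "x \<in> S' i A" and y: "y \<in> N' j B'"
    proof (rule N'I[OF T L.sub_prd[OF AB x N'D(1)[OF AB(2) y]]])
      show "\<alpha> (i + j) (A \<otimes>\<^sub>o B') (prd G i j A B' x y) \<in> B (i + j) (A \<otimes>\<^sub>o B')"
        unfolding proj_prd[OF AB S[OF AB(1) x] S[OF AB(2) N'D(1)[OF AB(2) y]], symmetric]
        by (rule I.ideal_prd_right[OF AB Z[OF AB(1) x] N'D(2)[OF AB(2) y]])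
    qed
    show "prd G i j A B' x y \<in> N' (i + j) (A \<otimes>\<^sub>o B')" if x: "x \<in> N' i A" and y: "y \<in> S' j B'"
    proof (rule N'I[OF T L.sub_prd[OF AB N'D(1)[OF AB(1) x] y]])
      show "\<alpha> (i + j) (A \<otimes>\<^sub>o B') (prd G i j A B' x y) \<in> B (i + j) (A \<otimes>\<^sub>o B')"
        unfolding proj_prd[OF AB S[OF AB(1) N'D(1)[OF AB(1) x]] S[OF AB(2) y], symmetric]
        by (rule I.ideal_prd_left[OF AB N'D(2)[OF AB(1) x] Z[OF AB(2) y]])
    qed
    show "prd (subquotient_lax_functor M E Z B) i j A B' (B i A +>\<^bsub>ob E i A\<^esub> \<alpha> i A x)
          (B j B' +>\<^bsub>ob E j B'\<^esub> \<alpha> j B' y) =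
        B (i + j) (A \<otimes>\<^sub>o B') +>\<^bsub>ob E (i + j) (A \<otimes>\<^sub>o B')\<^esub> \<alpha> (i + j) (A \<otimes>\<^sub>o B') (prd G i j A B' x y)"
      if x: "x \<in> S' i A" and y: "y \<in> S' j B'"
      unfolding Q.proj_prd[OF AB Z[OF AB(1) x] Z[OF AB(2) y]]
        proj_prd[OF AB S[OF AB(1) x] S[OF AB(2) y]] ..
  next
    show "unt (subquotient_lax_functor M E Z B) =
        B 0 (Unit_ob M) +>\<^bsub>ob E 0 (Unit_ob M)\<^esub> \<alpha> 0 (Unit_ob M) (unt G)"
      unfolding Q.proj_unt proj_unt ..
  qed
qed

end

section \<open>Differentials and cohomology\<close>

context differential_lax_monoidal_functor
begin

lemma d_closed: "A \<in> Obj M \<Longrightarrow> x \<in> carrier (ob G i A) \<Longrightarrow> d i A x \<in> carrier (ob G (i + \<delta>) A)"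
  by (rule linear_mapD(1)[OF d_linear])

lemma prd_closed:
  "\<lbrakk>A \<in> Obj M; B \<in> Obj M; x \<in> carrier (ob G i A); y \<in> carrier (ob G j B)\<rbrakk> \<Longrightarrow>
    prd G i j A B x y \<in> carrier (ob G (i + j) (A \<otimes>\<^sub>o B))"
  by (rule linear_mapD(1)[OF bilinear_mapD(1)[OF prd_bilinear]])

lemmas d_zero = linear_map_zero[OF ob_vectorspace ob_vectorspace d_linear]
  and d_diff = linear_map_diff[OF ob_vectorspace ob_vectorspace d_linear]
  and d_add = linear_mapD(2)[OF d_linear]
  and d_smult = linear_mapD(3)[OF d_linear]
  and d_koszul = linear_map_koszul[OF ob_vectorspace ob_vectorspace d_linear]

text \<open>
  The Leibniz rule solved for each of its two product terms: a product with a coboundary is a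
  coboundary up to a product involving the differential of the other factor.
\<close>

lemma prd_d_right:
  assumes AB: "A \<in> Obj M" "B \<in> Obj M" and x: "x \<in> carrier (ob G i A)" and y: "y \<in> carrier (ob G j B)"
  shows "prd G i (j + \<delta>) A B x (d j B y) =
    d (i + j) (A \<otimes>\<^sub>o B) (koszul_sign (ob G (i + j) (A \<otimes>\<^sub>o B)) (tot i) (prd G i j A B x y))
    \<oplus>\<^bsub>ob G (i + j + \<delta>) (A \<otimes>\<^sub>o B)\<^esub>
    koszul_sign (ob G (i + j + \<delta>) (A \<otimes>\<^sub>o B)) (tot i + 1) (prd G (i + \<delta>) j A B (d i A x) y)"
proof -
  note T = tensor_ob_closed[OF AB]
  define U where "U = ob G (i + j + \<delta>) (A \<otimes>\<^sub>o B)"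
  interpret U: module K U unfolding U_def by (rule ob_vectorspace[OF T])
  define a where "a = prd G (i + \<delta>) j A B (d i A x) y"
  define b where "b = prd G i (j + \<delta>) A B x (d j B y)"
  have a: "a \<in> carrier U"
    using prd_closed[OF AB d_closed[OF AB(1) x] y] by (simp add: a_def U_def ac_simps)
  have b: "b \<in> carrier U"
    using prd_closed[OF AB x d_closed[OF AB(2) y]] by (simp add: b_def U_def ac_simps)
  have "d (i + j) (A \<otimes>\<^sub>o B) (koszul_sign (ob G (i + j) (A \<otimes>\<^sub>o B)) (tot i) (prd G i j A B x y)) =
      koszul_sign U (tot i) (a \<oplus>\<^bsub>U\<^esub> koszul_sign U (tot i) b)"
    using d_koszul[OF T T T prd_closed[OF AB x y]] d_leibniz[OF AB x y] by (simp add: a_def b_def U_def)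
  moreover have "b = koszul_sign U (tot i) (a \<oplus>\<^bsub>U\<^esub> koszul_sign U (tot i) b) \<oplus>\<^bsub>U\<^esub> koszul_sign U (tot i + 1) a"
    using a b U.add_minus_cancel[OF b a, symmetric]
    by (simp add: koszul_sign_def U.M.minus_add U.M.minus_eq U.M.a_ac U.M.r_neg1 U.M.r_neg2)
  ultimately show ?thesis by (simp add: a_def b_def U_def)
qed

lemma prd_d_left:
  assumes AB: "A \<in> Obj M" "B \<in> Obj M" and x: "x \<in> carrier (ob G i A)" and y: "y \<in> carrier (ob G j B)"
  shows "prd G (i + \<delta>) j A B (d i A x) y =
    d (i + j) (A \<otimes>\<^sub>o B) (prd G i j A B x y)
    \<oplus>\<^bsub>ob G (i + j + \<delta>) (A \<otimes>\<^sub>o B)\<^esub>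
    koszul_sign (ob G (i + j + \<delta>) (A \<otimes>\<^sub>o B)) (tot i + 1) (prd G i (j + \<delta>) A B x (d j B y))"
proof -
  note T = tensor_ob_closed[OF AB]
  define U where "U = ob G (i + j + \<delta>) (A \<otimes>\<^sub>o B)"
  interpret U: module K U unfolding U_def by (rule ob_vectorspace[OF T])
  define a where "a = prd G (i + \<delta>) j A B (d i A x) y"
  define b where "b = prd G i (j + \<delta>) A B x (d j B y)"
  have a: "a \<in> carrier U"
    using prd_closed[OF AB d_closed[OF AB(1) x] y] by (simp add: a_def U_def ac_simps)
  have b: "b \<in> carrier U"
    using prd_closed[OF AB x d_closed[OF AB(2) y]] by (simp add: b_def U_def ac_simps)
  have "a = (a \<oplus>\<^bsub>U\<^esub> koszul_sign U (tot i) b) \<oplus>\<^bsub>U\<^esub> koszul_sign U (tot i + 1) b"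
    using a b by (simp add: koszul_sign_def U.M.a_ac U.M.r_neg U.M.l_neg)
  then show ?thesis using d_leibniz[OF AB x y] by (simp add: a_def b_def U_def)
qed

lemma coboundariesI:
  assumes "y \<in> carrier (ob G j A)" and "i = j + \<delta>" shows "d j A y \<in> coboundaries G d \<delta> i A"
  using assms by (auto simp: coboundaries_def)

lemma coboundaries_cases:
  assumes "x \<in> coboundaries G d \<delta> i A"
  obtains j y where "i = j + \<delta>" "y \<in> carrier (ob G j A)" "x = d j A y"
proof -
  have i: "i = (i - \<delta>) + \<delta>" by simp
  from assms obtain y where "y \<in> carrier (ob G (i - \<delta>) A)" "x = d (i - \<delta>) A y"
    by (auto simp: coboundaries_def)
  then show thesis using that i by blast
qed

lemma coboundaries_cocycles:
  assumes A: "A \<in> Obj M" and x: "x \<in> coboundaries G d \<delta> i A" shows "x \<in> cocycles G d \<delta> i A"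
proof -
  obtain j y where y: "i = j + \<delta>" "y \<in> carrier (ob G j A)" "x = d j A y"
    using x by (rule coboundaries_cases)
  then show ?thesis using d_closed[OF A y(2)] d_square[OF A y(2)] by (simp add: cocycles_def)
qed

text \<open>
  The Leibniz rule makes the product of two cocycles a cocycle, and the product of a cocycle with some
  \<open>d y\<close> the coboundary of \<open>\<plusminus> x \<times> y\<close> or \<open>y \<times> x\<close>.
\<close>

theorem cohomology_ideal:
  assumes unt: "d 0 (Unit_ob M) (unt G) = \<zero>\<^bsub>ob G \<delta> (Unit_ob M)\<^esub>"
  shows "lax_ideal K M G (cocycles G d \<delta>) (coboundaries G d \<delta>)"
proof (intro lax_ideal.intro lax_ideal_axioms.intro lax_subfunctor.intro lax_subfunctor_axioms.intro)
  show "graded_lax_monoidal_functor K M G" by (rule graded_lax_monoidal_functor_axioms)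
  show "unt G \<in> cocycles G d \<delta> 0 (Unit_ob M)" using unt unt_closed by (simp add: cocycles_def)
next
  fix A i assume A: "A \<in> Obj M"
  interpret V: module K "ob G i A" by (rule ob_vectorspace[OF A])
  interpret W: module K "ob G (i + \<delta>) A" by (rule ob_vectorspace[OF A])
  interpret U: module K "ob G (i - \<delta>) A" by (rule ob_vectorspace[OF A])
  have lin: "linear_map K (ob G (i - \<delta>) A) (ob G i A) (d (i - \<delta>) A)"
    using d_linear[OF A, of "i - \<delta>"] by simp
  show "submodule (cocycles G d \<delta> i A) K (ob G i A)"
    by (rule V.submoduleI_smult)
      (auto simp: cocycles_def d_zero[OF A A A] d_add[OF A] d_smult[OF A])
  show "submodule (coboundaries G d \<delta> i A) K (ob G i A)"
  proof (rule V.submoduleI_smult)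
    show "coboundaries G d \<delta> i A \<subseteq> carrier (ob G i A)"
      using linear_mapD(1)[OF lin] by (auto simp: coboundaries_def)
    show "\<zero>\<^bsub>ob G i A\<^esub> \<in> coboundaries G d \<delta> i A"
      using linear_map_zero[OF U.module_axioms V.module_axioms lin] U.M.zero_closed
      unfolding coboundaries_def by (metis imageI)
    show "x \<oplus>\<^bsub>ob G i A\<^esub> y \<in> coboundaries G d \<delta> i A"
      if "x \<in> coboundaries G d \<delta> i A" "y \<in> coboundaries G d \<delta> i A" for x y
      using that linear_mapD(2)[OF lin, symmetric] U.M.a_closed unfolding coboundaries_def by force
    show "a \<odot>\<^bsub>ob G i A\<^esub> x \<in> coboundaries G d \<delta> i A"
      if "a \<in> carrier K" "x \<in> coboundaries G d \<delta> i A" for a x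
      using that linear_mapD(3)[OF lin, symmetric] U.smult_closed unfolding coboundaries_def by force
  qed
  show "x \<in> cocycles G d \<delta> i A" if "x \<in> coboundaries G d \<delta> i A" for x
    by (rule coboundaries_cocycles[OF A that])
next
  fix A B f x i assume AB: "A \<in> Obj M" "B \<in> Obj M" and f: "f \<in> carrier (Hom M A B)"
  note m = mor_linear[OF AB f]
  show "mor G i f x \<in> cocycles G d \<delta> i B" if "x \<in> cocycles G d \<delta> i A"
    using that d_natural[OF AB f, of x i] linear_mapD(1)[OF m]
      linear_map_zero[OF ob_vectorspace[OF AB(1)] ob_vectorspace[OF AB(2)] m]
    by (simp add: cocycles_def)
  show "mor G i f x \<in> coboundaries G d \<delta> i B" if x: "x \<in> coboundaries G d \<delta> i A"
  proof -
    obtain j y where y: "i = j + \<delta>" "y \<in> carrier (ob G j A)" "x = d j A y"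
      using x by (rule coboundaries_cases)
    show ?thesis
      using coboundariesI[OF linear_mapD(1)[OF m y(2)] y(1)] d_natural[OF AB f y(2)] y by simp
  qed
next
  fix A B x y i j assume AB: "A \<in> Obj M" "B \<in> Obj M"
  note T = tensor_ob_closed[OF AB]
  note V = ob_vectorspace[OF AB(1)] and W = ob_vectorspace[OF AB(2)] and U = ob_vectorspace[OF T]
  have kz: "koszul_sign (ob G k (A \<otimes>\<^sub>o B)) n \<zero>\<^bsub>ob G k (A \<otimes>\<^sub>o B)\<^esub> = \<zero>\<^bsub>ob G k (A \<otimes>\<^sub>o B)\<^esub>" for k n
  proof -
    interpret U: module K "ob G k (A \<otimes>\<^sub>o B)" by (rule U)
    show ?thesis by (simp add: koszul_sign_def)
  qed
  have z: "prd G k l A B \<zero>\<^bsub>ob G k A\<^esub> v = \<zero>\<^bsub>ob G (k + l) (A \<otimes>\<^sub>o B)\<^esub>"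
    if "v \<in> carrier (ob G l B)" for k l v
    using linear_map_zero[OF V U bilinear_mapD(2)[OF prd_bilinear[OF AB] that]] .
  have z': "prd G k l A B v \<zero>\<^bsub>ob G l B\<^esub> = \<zero>\<^bsub>ob G (k + l) (A \<otimes>\<^sub>o B)\<^esub>"
    if "v \<in> carrier (ob G k A)" for k l v
    using linear_map_zero[OF W U bilinear_mapD(1)[OF prd_bilinear[OF AB] that]] .
  have r_zero: "v \<oplus>\<^bsub>ob G k (A \<otimes>\<^sub>o B)\<^esub> \<zero>\<^bsub>ob G k (A \<otimes>\<^sub>o B)\<^esub> = v"
    if "v \<in> carrier (ob G k (A \<otimes>\<^sub>o B))" for v k
    using U by (meson abelian_group.axioms(1) abelian_monoid.r_zero module.axioms(2) that)
  have zc: "\<zero>\<^bsub>ob G k (A \<otimes>\<^sub>o B)\<^esub> \<in> carrier (ob G k (A \<otimes>\<^sub>o B))" for k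
    using module.submodule_zero[OF U module.carrier_is_submodule[OF U]] .
  have kc: "koszul_sign (ob G k (A \<otimes>\<^sub>o B)) n v \<in> carrier (ob G k (A \<otimes>\<^sub>o B))"
    if "v \<in> carrier (ob G k (A \<otimes>\<^sub>o B))" for k n v using koszul_closed[OF U that] .
  show "prd G i j A B x y \<in> cocycles G d \<delta> (i + j) (A \<otimes>\<^sub>o B)"
    if "x \<in> cocycles G d \<delta> i A" "y \<in> cocycles G d \<delta> j B"
  proof -
    have x: "x \<in> carrier (ob G i A)" "d i A x = \<zero>\<^bsub>ob G (i + \<delta>) A\<^esub>"
      and y: "y \<in> carrier (ob G j B)" "d j B y = \<zero>\<^bsub>ob G (j + \<delta>) B\<^esub>"
      using that by (auto simp: cocycles_def)
    have "prd G (i + \<delta>) j A B (d i A x) y = \<zero>\<^bsub>ob G (i + j + \<delta>) (A \<otimes>\<^sub>o B)\<^esub>"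
      using z[OF y(1), of "i + \<delta>"] x(2) by (simp add: ac_simps)
    moreover have "prd G i (j + \<delta>) A B x (d j B y) = \<zero>\<^bsub>ob G (i + j + \<delta>) (A \<otimes>\<^sub>o B)\<^esub>"
      using z'[OF x(1), of "j + \<delta>"] y(2) by (simp add: ac_simps)
    ultimately have "d (i + j) (A \<otimes>\<^sub>o B) (prd G i j A B x y) = \<zero>\<^bsub>ob G (i + j + \<delta>) (A \<otimes>\<^sub>o B)\<^esub>"
      using d_leibniz[OF AB x(1) y(1)] kz r_zero[OF zc] by simp
    then show ?thesis using prd_closed[OF AB x(1) y(1)] by (simp add: cocycles_def)
  qed
  show "prd G i j A B x y \<in> coboundaries G d \<delta> (i + j) (A \<otimes>\<^sub>o B)"
    if xx: "x \<in> cocycles G d \<delta> i A" and yy: "y \<in> coboundaries G d \<delta> j B"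
  proof -
    have x: "x \<in> carrier (ob G i A)" "d i A x = \<zero>\<^bsub>ob G (i + \<delta>) A\<^esub>"
      using xx by (auto simp: cocycles_def)
    obtain k v where v: "j = k + \<delta>" "v \<in> carrier (ob G k B)" "y = d k B v"
      using yy by (rule coboundaries_cases)
    have "prd G (i + \<delta>) k A B (d i A x) v = \<zero>\<^bsub>ob G (i + k + \<delta>) (A \<otimes>\<^sub>o B)\<^esub>"
      using z[OF v(2), of "i + \<delta>"] x(2) by (simp add: ac_simps)
    moreover define w where "w = koszul_sign (ob G (i + k) (A \<otimes>\<^sub>o B)) (tot i) (prd G i k A B x v)"
    moreover have w: "w \<in> carrier (ob G (i + k) (A \<otimes>\<^sub>o B))"
      unfolding w_def by (rule kc[OF prd_closed[OF AB x(1) v(2)]])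
    ultimately have "prd G i (k + \<delta>) A B x (d k B v) = d (i + k) (A \<otimes>\<^sub>o B) w"
      using prd_d_right[OF AB x(1) v(2)] kz r_zero[OF d_closed[OF T w]] by simp
    then show ?thesis
      using coboundariesI[OF w, of "i + j"] v(1,3) by (simp add: add.assoc)
  qed
  show "prd G i j A B x y \<in> coboundaries G d \<delta> (i + j) (A \<otimes>\<^sub>o B)"
    if xx: "x \<in> coboundaries G d \<delta> i A" and yy: "y \<in> cocycles G d \<delta> j B"
  proof -
    have y: "y \<in> carrier (ob G j B)" "d j B y = \<zero>\<^bsub>ob G (j + \<delta>) B\<^esub>"
      using yy by (auto simp: cocycles_def)
    obtain k v where v: "i = k + \<delta>" "v \<in> carrier (ob G k A)" "x = d k A v"
      using xx by (rule coboundaries_cases)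
    have "prd G k (j + \<delta>) A B v (d j B y) = \<zero>\<^bsub>ob G (k + j + \<delta>) (A \<otimes>\<^sub>o B)\<^esub>"
      using z'[OF v(2), of "j + \<delta>"] y(2) by (simp add: ac_simps)
    moreover have w: "prd G k j A B v y \<in> carrier (ob G (k + j) (A \<otimes>\<^sub>o B))"
      by (rule prd_closed[OF AB v(2) y(1)])
    ultimately have "prd G (k + \<delta>) j A B (d k A v) y = d (k + j) (A \<otimes>\<^sub>o B) (prd G k j A B v y)"
      using prd_d_left[OF AB v(2) y(1)] kz r_zero[OF d_closed[OF T w]] by simp
    then show ?thesis
      using coboundariesI[OF w, of "i + j"] v(1,3) by (simp add: ac_simps)
  qed
qed

end

context lax_quotient
begin

theorem quotient_differential:
  assumes dg: "differential_lax_monoidal_functor K M G d \<delta> tot"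
    and dS: "\<And>A i x. A \<in> Obj M \<Longrightarrow> x \<in> S i A \<Longrightarrow> d i A x \<in> S (i + \<delta>) A"
    and D: "\<And>A i x. A \<in> Obj M \<Longrightarrow> x \<in> S i A \<Longrightarrow> D i A (\<alpha> i A x) = \<alpha> (i + \<delta>) A (d i A x)"
  shows "differential_lax_monoidal_functor K M E D \<delta> tot"
proof -
  interpret d: differential_lax_monoidal_functor K M G d \<delta> tot by (rule dg)
  show ?thesis
  proof (intro differential_lax_monoidal_functor.intro differential_lax_monoidal_functor_axioms.intro)
    show "graded_lax_monoidal_functor K M E" by (rule quotient_graded_lax)
  next
    fix A i assume A: "A \<in> Obj M"
    show "linear_map K (ob E i A) (ob E (i + \<delta>) A) (D i A)"
      by (rule linear_map_quotientI[OF A])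
        (simp_all add: D[OF A] proj_closed[OF A] dS[OF A] sub_add[OF A] sub_smult[OF A] sub_mem[OF A]
          d.d_add[OF A] d.d_smult[OF A] proj_add[OF A, symmetric] proj_smult[OF A, symmetric])
  next
    fix A B f X i assume AB: "A \<in> Obj M" "B \<in> Obj M" "f \<in> carrier (Hom M A B)"
      and X: "X \<in> carrier (ob E i A)"
    obtain x where x: "x \<in> S i A" "X = \<alpha> i A x" using AB(1) X by (rule quotient_cases)
    show "D i B (mor E i f X) = mor E (i + \<delta>) f (D i A X)"
      unfolding x(2) proj_mor[OF AB x(1)] D[OF AB(2) sub_mor[OF AB x(1)]] D[OF AB(1) x(1)]
        proj_mor[OF AB dS[OF AB(1) x(1)]] d.d_natural[OF AB sub_mem[OF AB(1) x(1)]] ..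
  next
    fix A X i assume A: "A \<in> Obj M" and X: "X \<in> carrier (ob E i A)"
    obtain x where x: "x \<in> S i A" "X = \<alpha> i A x" using A X by (rule quotient_cases)
    show "D (i + \<delta>) A (D i A X) = \<zero>\<^bsub>ob E (i + \<delta> + \<delta>) A\<^esub>"
      unfolding x(2) D[OF A x(1)] D[OF A dS[OF A x(1)]] d.d_square[OF A sub_mem[OF A x(1)]]
      by (rule proj_zero[OF A])
  next
    fix A B X Y i j assume AB: "A \<in> Obj M" "B \<in> Obj M"
      and X: "X \<in> carrier (ob E i A)" and Y: "Y \<in> carrier (ob E j B)"
    note T = tensor_ob_closed[OF AB]
    obtain x where x: "x \<in> S i A" "X = \<alpha> i A x" using AB(1) X by (rule quotient_cases)
    obtain y where y: "y \<in> S j B" "Y = \<alpha> j B y" using AB(2) Y by (rule quotient_cases)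
    have idx: "i + \<delta> + j = i + j + \<delta>" "i + (j + \<delta>) = i + j + \<delta>" by (simp_all add: ac_simps)
    note l = sub_prd[OF AB dS[OF AB(1) x(1)] y(1), unfolded idx]
      and r = sub_prd[OF AB x(1) dS[OF AB(2) y(1)], unfolded idx]
    have kr: "koszul_sign (ob G (i + j + \<delta>) (A \<otimes>\<^sub>o B)) n (prd G i (j + \<delta>) A B x (d j B y))
        \<in> S (i + j + \<delta>) (A \<otimes>\<^sub>o B)" for n
      by (rule koszul_submodule[OF ob_vectorspace[OF T] sub_submodule[OF T] r])
    show "D (i + j) (A \<otimes>\<^sub>o B) (prd E i j A B X Y) =
        prd E (i + \<delta>) j A B (D i A X) Y \<oplus>\<^bsub>ob E (i + j + \<delta>) (A \<otimes>\<^sub>o B)\<^esub>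
        koszul_sign (ob E (i + j + \<delta>) (A \<otimes>\<^sub>o B)) (tot i) (prd E i (j + \<delta>) A B X (D j B Y))"
      unfolding x(2) y(2) proj_prd[OF AB x(1) y(1)] D[OF T sub_prd[OF AB x(1) y(1)]]
        d.d_leibniz[OF AB sub_mem[OF AB(1) x(1)] sub_mem[OF AB(2) y(1)]] proj_add[OF T l kr]
        proj_koszul[OF T r] D[OF AB(1) x(1)] D[OF AB(2) y(1)]
        proj_prd[OF AB dS[OF AB(1) x(1)] y(1)] proj_prd[OF AB x(1) dS[OF AB(2) y(1)]] idx ..
  qed
qed

end

section \<open>Regrading by total degree\<close>

lemma total_degree_simps [simp]:
  "total_degree (i + j) = total_degree i + total_degree j"
  "total_degree 0 = 0"
  "total_degree (page_degree r) = 1"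
  by (simp_all add: total_degree_def page_degree_def zero_prod_def split: prod.splits)

lemma total_degree_diff [simp]: "total_degree (i - j) = total_degree i - total_degree j"
  by (simp add: total_degree_def split: prod.splits)

lemma fst_page_degree [simp]: "fst (page_degree r) = int r"
  by (simp add: page_degree_def)

lemma bigrade_sel [simp]:
  "ob (bigrade H) i = ob H (total_degree i)"
  "mor (bigrade H) i = mor H (total_degree i)"
  "prd (bigrade H) i j = prd H (total_degree i) (total_degree j)"
  "unt (bigrade H) = unt H"
  by (simp_all add: bigrade_def total_degree_def split: prod.splits)

lemma bigrade_graded_lax:
  assumes "graded_lax_monoidal_functor K M G"
  shows "graded_lax_monoidal_functor K M (bigrade G)"
proof -
  interpret graded_lax_monoidal_functor K M G by (rule assms)
  show ?thesis
  proof (intro graded_lax_monoidal_functor.intro graded_lax_monoidal_functor_axioms.intro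
      additive_functors.intro additive_functors_axioms.intro)
    show "linear_monoidal_category K M" by (rule linear_monoidal_category_axioms)
    show "linear_category K M" by (rule linear_category_axioms)
  qed (simp_all add: ob_vectorspace mor_linear mor_ident mor_comp mor_additive prd_bilinear
      prd_natural prd_assoc unt_closed unt_left unt_right)
qed

text \<open>
  The bidegree \<open>(r, - r + 1)\<close> has total degree \<open>1\<close> for every \<open>r\<close>. Hence the differential of the complex
  serves as a differential of each of these bidegrees, and that of the \<open>r\<close>-th page is induced by it.
\<close>

lemma bigrade_differential:
  assumes "differential_lax_monoidal_functor K M G d 1 (\<lambda>n. n)"
  shows "differential_lax_monoidal_functor K M (bigrade G) (\<lambda>i. d (total_degree i)) (page_degree r)
    total_degree"
proof -
  interpret differential_lax_monoidal_functor K M G d 1 "\<lambda>n. n" by (rule assms)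
  show ?thesis
    by (intro differential_lax_monoidal_functor.intro differential_lax_monoidal_functor_axioms.intro
        bigrade_graded_lax[OF graded_lax_monoidal_functor_axioms])
      (simp_all add: d_linear d_natural d_square d_leibniz)
qed

lemma bigrade_quotient:
  assumes "lax_quotient K M G S N E \<alpha>"
  shows "lax_quotient K M (bigrade G) (\<lambda>i. S (total_degree i)) (\<lambda>i. N (total_degree i)) (bigrade E)
    (\<lambda>i. \<alpha> (total_degree i))"
proof -
  interpret lax_quotient K M G S N E \<alpha> by (rule assms)
  show ?thesis
    by (intro lax_quotient.intro lax_quotient_axioms.intro lax_ideal.intro lax_ideal_axioms.intro
        lax_subfunctor.intro lax_subfunctor_axioms.intro
        bigrade_graded_lax[OF graded_lax_monoidal_functor_axioms])
      (simp_all add: sub_submodule sub_mor sub_prd sub_unt ideal_submodule ideal_subset ideal_mor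
        ideal_prd_right ideal_prd_left proj_image proj_eq_iff proj_zero proj_add proj_smult
        proj_mor proj_prd proj_unt)
qed

section \<open>The pages of a filtered complex\<close>

text \<open>
  The families \<open>Z\<^sub>r\<close> and \<open>B\<^sub>r\<close>. In the second, the decomposition \<open>x = d y + z\<close> of an element of \<open>Z\<^sub>r\<close>
  forces \<open>d y\<close> into \<open>F\<^sup>p\<close> and \<open>d z = d x\<close> into \<open>F\<^sup>p\<^sup>+\<^sup>r\<close>, so that \<open>B\<^sub>r\<close> is the familiar
  sum of \<open>d Z\<^sub>r\<^sub>-\<^sub>1\<close>, with \<open>Z\<^sub>r\<^sub>-\<^sub>1\<close> taken at filtration \<open>p - r + 1\<close>, and of \<open>Z\<^sub>r\<^sub>-\<^sub>1\<close> at filtration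
  \<open>p + 1\<close>. Stated in this way it makes sense for \<open>r = 0\<close>, where it is \<open>F\<^sup>p\<^sup>+\<^sup>1\<close>.
\<close>

definition approx_cycles ::
  "(int \<Rightarrow> 'o \<Rightarrow> 'v \<Rightarrow> 'v) \<Rightarrow> (int \<Rightarrow> int \<Rightarrow> 'o \<Rightarrow> 'v set) \<Rightarrow> nat \<Rightarrow> int \<times> int \<Rightarrow> 'o \<Rightarrow> 'v set" where
  "approx_cycles d F r i A =
     {x \<in> F (fst i) (total_degree i) A.
        d (total_degree i) A x \<in> F (fst i + int r) (total_degree i + 1) A}"

definition approx_boundaries ::
  "(int, 'o, 'm, 'k, 'v) graded_lax_functor \<Rightarrow> (int \<Rightarrow> 'o \<Rightarrow> 'v \<Rightarrow> 'v) \<Rightarrow>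
   (int \<Rightarrow> int \<Rightarrow> 'o \<Rightarrow> 'v set) \<Rightarrow> nat \<Rightarrow> int \<times> int \<Rightarrow> 'o \<Rightarrow> 'v set" where
  "approx_boundaries C d F r i A =
     {x \<in> approx_cycles d F r i A.
        \<exists>y\<in>F (fst i - int r + 1) (total_degree i - 1) A. \<exists>z\<in>F (fst i + 1) (total_degree i) A.
          x = d (total_degree i - 1) A y \<oplus>\<^bsub>ob C (total_degree i) A\<^esub> z}"

context filtered_dg_lax_monoidal_functor
begin

abbreviation "Z \<equiv> approx_cycles d F"
abbreviation "B \<equiv> approx_boundaries C d F"

lemma filt_mem: "A \<in> Obj M \<Longrightarrow> x \<in> F p n A \<Longrightarrow> x \<in> carrier (ob C n A)"
  by (rule module.submodule_mem[OF ob_vectorspace filtration_subspace])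

lemma filt_closed:
  assumes A: "A \<in> Obj M"
  shows filt_zero: "\<zero>\<^bsub>ob C n A\<^esub> \<in> F p n A"
    and filt_smult: "a \<in> carrier K \<Longrightarrow> x \<in> F p n A \<Longrightarrow> a \<odot>\<^bsub>ob C n A\<^esub> x \<in> F p n A"
    and filt_add: "x \<in> F p n A \<Longrightarrow> y \<in> F p n A \<Longrightarrow> x \<oplus>\<^bsub>ob C n A\<^esub> y \<in> F p n A"
    and filt_diff: "x \<in> F p n A \<Longrightarrow> y \<in> F p n A \<Longrightarrow> x \<ominus>\<^bsub>ob C n A\<^esub> y \<in> F p n A"
    and filt_koszul: "x \<in> F p n A \<Longrightarrow> koszul_sign (ob C n A) m x \<in> F p n A"
proof -
  note m = ob_vectorspace[OF A, of n] filtration_subspace[OF A, of p n]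
  show "\<zero>\<^bsub>ob C n A\<^esub> \<in> F p n A" using m by (rule module.submodule_zero)
  show "a \<in> carrier K \<Longrightarrow> x \<in> F p n A \<Longrightarrow> a \<odot>\<^bsub>ob C n A\<^esub> x \<in> F p n A"
    using m by (rule module.submoduleE(4))
  show "x \<in> F p n A \<Longrightarrow> y \<in> F p n A \<Longrightarrow> x \<oplus>\<^bsub>ob C n A\<^esub> y \<in> F p n A"
    using m by (rule module.submoduleE(5))
  show "x \<in> F p n A \<Longrightarrow> y \<in> F p n A \<Longrightarrow> x \<ominus>\<^bsub>ob C n A\<^esub> y \<in> F p n A"
    using m by (rule module.submodule_diff)
  show "x \<in> F p n A \<Longrightarrow> koszul_sign (ob C n A) m x \<in> F p n A"
    using m by (rule koszul_submodule)
qed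

lemma filt_le: "A \<in> Obj M \<Longrightarrow> q \<le> p \<Longrightarrow> x \<in> F p n A \<Longrightarrow> x \<in> F q n A"
  using filtration_decreasing by blast

lemma filt_cancel:
  "\<lbrakk>A \<in> Obj M; x \<in> F p n A; y \<in> carrier (ob C n A); x \<oplus>\<^bsub>ob C n A\<^esub> y \<in> F p n A\<rbrakk> \<Longrightarrow> y \<in> F p n A"
  by (rule module.submodule_cancel[OF ob_vectorspace filtration_subspace])

lemma cyclesI:
  "\<lbrakk>x \<in> F p n A; d n A x \<in> F (p + int r) (n + 1) A; fst i = p; total_degree i = n\<rbrakk> \<Longrightarrow> x \<in> Z r i A"
  by (simp add: approx_cycles_def)

lemma cyclesD:
  assumes "x \<in> Z r i A"
  shows "x \<in> F (fst i) (total_degree i) A"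
    and "d (total_degree i) A x \<in> F (fst i + int r) (total_degree i + 1) A"
  using assms by (auto simp: approx_cycles_def)

lemma boundariesI:
  assumes "x \<in> Z r i A" and "y \<in> F (fst i - int r + 1) k A" and "z \<in> F (fst i + 1) (total_degree i) A"
    and "x = d k A y \<oplus>\<^bsub>ob C (total_degree i) A\<^esub> z" and "total_degree i = k + 1"
  shows "x \<in> B r i A"
proof -
  have "k = total_degree i - 1" using assms(5) by simp
  then show ?thesis using assms(1-4) unfolding approx_boundaries_def by blast
qed

lemma boundaries_cases:
  assumes "x \<in> B r i A"
  obtains k y z where "x \<in> Z r i A" "y \<in> F (fst i - int r + 1) k A" "z \<in> F (fst i + 1) (total_degree i) A"
    "x = d k A y \<oplus>\<^bsub>ob C (total_degree i) A\<^esub> z" "total_degree i = k + 1"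
proof -
  have "total_degree i = (total_degree i - 1) + 1" by simp
  then show thesis using assms that unfolding approx_boundaries_def by blast
qed

lemma boundariesI_filt:
  assumes A: "A \<in> Obj M" and x: "x \<in> Z r i A" and up: "x \<in> F (fst i + 1) (total_degree i) A"
  shows "x \<in> B r i A"
proof -
  define k where "k = total_degree i - 1"
  have k: "total_degree i = k + 1" by (simp add: k_def)
  interpret V: module K "ob C (k + 1) A" by (rule ob_vectorspace[OF A])
  have "x = d k A \<zero>\<^bsub>ob C k A\<^esub> \<oplus>\<^bsub>ob C (k + 1) A\<^esub> x"
    using d_zero[OF A A A, of k] filt_mem[OF A up] k by simp
  then show ?thesis using boundariesI[OF x filt_zero[OF A] up _ k] by (simp add: k)
qed

lemma cycles_subfunctor: "lax_subfunctor K M (bigrade C) (Z r)"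
proof (intro lax_subfunctor.intro lax_subfunctor_axioms.intro)
  show "graded_lax_monoidal_functor K M (bigrade C)"
    by (rule bigrade_graded_lax[OF graded_lax_monoidal_functor_axioms])
next
  fix A and i :: "int \<times> int" assume A: "A \<in> Obj M"
  interpret V: module K "ob (bigrade C) i A" using ob_vectorspace[OF A] by simp
  show "submodule (Z r i A) K (ob (bigrade C) i A)"
  proof (rule V.submoduleI_smult)
    show "Z r i A \<subseteq> carrier (ob (bigrade C) i A)" using filt_mem[OF A cyclesD(1)] by (simp add: subset_iff)
    show "\<zero>\<^bsub>ob (bigrade C) i A\<^esub> \<in> Z r i A"
      by (rule cyclesI[OF _ _ refl refl]) (simp_all add: filt_zero[OF A] d_zero[OF A A A])
    show "x \<oplus>\<^bsub>ob (bigrade C) i A\<^esub> y \<in> Z r i A" if x: "x \<in> Z r i A" and y: "y \<in> Z r i A" for x y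
      using filt_add[OF A cyclesD(1)[OF x] cyclesD(1)[OF y]]
        filt_add[OF A cyclesD(2)[OF x] cyclesD(2)[OF y]]
        d_add[OF A filt_mem[OF A cyclesD(1)[OF x]] filt_mem[OF A cyclesD(1)[OF y]]]
      by (intro cyclesI[OF _ _ refl refl]) simp_all
    show "a \<odot>\<^bsub>ob (bigrade C) i A\<^esub> x \<in> Z r i A" if a: "a \<in> carrier K" and x: "x \<in> Z r i A" for a x
      using filt_smult[OF A a cyclesD(1)[OF x]] filt_smult[OF A a cyclesD(2)[OF x]]
        d_smult[OF A a filt_mem[OF A cyclesD(1)[OF x]]]
      by (intro cyclesI[OF _ _ refl refl]) simp_all
  qed
next
  fix A B f x and i :: "int \<times> int"
  assume AB: "A \<in> Obj M" "B \<in> Obj M" "f \<in> carrier (Hom M A B)" and x: "x \<in> Z r i A"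
  show "mor (bigrade C) i f x \<in> Z r i B"
    using filtration_natural[OF AB cyclesD(1)[OF x]] filtration_natural[OF AB cyclesD(2)[OF x]]
      d_natural[OF AB filt_mem[OF AB(1) cyclesD(1)[OF x]]]
    by (intro cyclesI[OF _ _ refl refl]) simp_all
next
  fix A B x y and i j :: "int \<times> int"
  assume AB: "A \<in> Obj M" "B \<in> Obj M" and x: "x \<in> Z r i A" and y: "y \<in> Z r j B"
  note T = tensor_ob_closed[OF AB]
  show "prd (bigrade C) i j A B x y \<in> Z r (i + j) (A \<otimes>\<^sub>o B)"
  proof (rule cyclesI[OF _ _ refl refl])
    show "prd (bigrade C) i j A B x y \<in> F (fst (i + j)) (total_degree (i + j)) (A \<otimes>\<^sub>o B)"
      using filtration_prd[OF AB cyclesD(1)[OF x] cyclesD(1)[OF y]] by simp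
    show "d (total_degree (i + j)) (A \<otimes>\<^sub>o B) (prd (bigrade C) i j A B x y)
        \<in> F (fst (i + j) + int r) (total_degree (i + j) + 1) (A \<otimes>\<^sub>o B)"
      using filtration_prd[OF AB cyclesD(2)[OF x] cyclesD(1)[OF y]]
        filtration_prd[OF AB cyclesD(1)[OF x] cyclesD(2)[OF y]]
        d_leibniz[OF AB filt_mem[OF AB(1) cyclesD(1)[OF x]] filt_mem[OF AB(2) cyclesD(1)[OF y]]]
      by (simp add: ac_simps filt_add[OF T] filt_koszul[OF T])
  qed
next
  show "unt (bigrade C) \<in> Z r 0 (Unit_ob M)"
    by (rule cyclesI) (simp_all add: filtration_unt d_unt filt_zero[OF unit_ob_closed])
qed

text \<open>
  For \<open>y = d u + z\<close> the Leibniz rule gives \<open>x \<times> y = d (\<plusminus> x \<times> u) \<plusminus> d x \<times> u + x \<times> z\<close>. The filtrations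
  \<open>p + r\<close> of \<open>d x\<close> and \<open>p' - r + 1\<close> of \<open>u\<close> add up to \<open>p + p' + 1\<close>, so the last two terms together
  are an admissible remainder.
\<close>

lemma boundaries_prd_right:
  assumes AB: "A \<in> Obj M" "B' \<in> Obj M" and x: "x \<in> Z r i A" and y: "y \<in> B r j B'"
  shows "prd C (total_degree i) (total_degree j) A B' x y \<in> B r (i + j) (A \<otimes>\<^sub>o B')"
proof -
  note T = tensor_ob_closed[OF AB]
  define n where "n = total_degree i"
  obtain k u z where yZ: "y \<in> Z r j B'" and u: "u \<in> F (fst j - int r + 1) k B'"
    and z: "z \<in> F (fst j + 1) (total_degree j) B'"
    and y_eq: "y = d k B' u \<oplus>\<^bsub>ob C (total_degree j) B'\<^esub> z" and k: "total_degree j = k + 1"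
    using y by (rule boundaries_cases)
  note xF = cyclesD[OF x, folded n_def]
  note xc = filt_mem[OF AB(1) xF(1)] and uc = filt_mem[OF AB(2) u]
    and zc = filt_mem[OF AB(2) z[unfolded k]]
  define V where "V = ob C (n + k + 1) (A \<otimes>\<^sub>o B')"
  interpret V: module K V unfolding V_def by (rule ob_vectorspace[OF T])
  define w where "w = koszul_sign (ob C (n + k) (A \<otimes>\<^sub>o B')) n (prd C n k A B' x u)"
  define v where "v = koszul_sign V (n + 1) (prd C (n + 1) k A B' (d n A x) u)"
  define t where "t = prd C n (k + 1) A B' x z"
  have w: "w \<in> F (fst (i + j) - int r + 1) (n + k) (A \<otimes>\<^sub>o B')"
    using filt_koszul[OF T filtration_prd[OF AB xF(1) u]] by (simp add: w_def algebra_simps)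
  have v: "v \<in> F (fst (i + j) + 1) (n + k + 1) (A \<otimes>\<^sub>o B')"
    using filt_koszul[OF T filtration_prd[OF AB xF(2) u]] by (simp add: v_def V_def algebra_simps)
  have t: "t \<in> F (fst (i + j) + 1) (n + k + 1) (A \<otimes>\<^sub>o B')"
    using filtration_prd[OF AB xF(1) z[unfolded k]] by (simp add: t_def algebra_simps)
  note dw = d_closed[OF T filt_mem[OF T w], folded V_def]
  have "prd C n (k + 1) A B' x y = prd C n (k + 1) A B' x (d k B' u) \<oplus>\<^bsub>V\<^esub> t"
    using linear_mapD(2)[OF bilinear_mapD(1)[OF prd_bilinear[OF AB] xc] d_closed[OF AB(2) uc] zc]
    by (simp add: y_eq k t_def V_def add.assoc)
  also have "prd C n (k + 1) A B' x (d k B' u) = d (n + k) (A \<otimes>\<^sub>o B') w \<oplus>\<^bsub>V\<^esub> v"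
    using prd_d_right[OF AB xc uc] by (simp add: w_def v_def V_def)
  also have "(d (n + k) (A \<otimes>\<^sub>o B') w \<oplus>\<^bsub>V\<^esub> v) \<oplus>\<^bsub>V\<^esub> t = d (n + k) (A \<otimes>\<^sub>o B') w \<oplus>\<^bsub>V\<^esub> (v \<oplus>\<^bsub>V\<^esub> t)"
    using dw filt_mem[OF T v, folded V_def] filt_mem[OF T t, folded V_def] by (rule V.M.a_assoc)
  finally have "prd C n (k + 1) A B' x y = d (n + k) (A \<otimes>\<^sub>o B') w \<oplus>\<^bsub>V\<^esub> (v \<oplus>\<^bsub>V\<^esub> t)" .
  moreover have "prd C n (k + 1) A B' x y \<in> Z r (i + j) (A \<otimes>\<^sub>o B')"
    using lax_subfunctor.sub_prd[OF cycles_subfunctor AB x yZ] by (simp add: n_def k)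
  moreover have "v \<oplus>\<^bsub>V\<^esub> t \<in> F (fst (i + j) + 1) (n + k + 1) (A \<otimes>\<^sub>o B')"
    unfolding V_def by (rule filt_add[OF T v t])
  ultimately show ?thesis
    using boundariesI[of "prd C n (k + 1) A B' x y" r "i + j" "A \<otimes>\<^sub>o B'" w "n + k" "v \<oplus>\<^bsub>V\<^esub> t"] w
    by (simp add: n_def k V_def add.assoc)
qed

lemma boundaries_prd_left:
  assumes AB: "A \<in> Obj M" "B' \<in> Obj M" and x: "x \<in> B r i A" and y: "y \<in> Z r j B'"
  shows "prd C (total_degree i) (total_degree j) A B' x y \<in> B r (i + j) (A \<otimes>\<^sub>o B')"
proof -
  note T = tensor_ob_closed[OF AB]
  define n where "n = total_degree j"
  obtain k u z where xZ: "x \<in> Z r i A" and u: "u \<in> F (fst i - int r + 1) k A"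
    and z: "z \<in> F (fst i + 1) (total_degree i) A"
    and x_eq: "x = d k A u \<oplus>\<^bsub>ob C (total_degree i) A\<^esub> z" and k: "total_degree i = k + 1"
    using x by (rule boundaries_cases)
  note yF = cyclesD[OF y, folded n_def]
  note yc = filt_mem[OF AB(2) yF(1)] and uc = filt_mem[OF AB(1) u]
    and zc = filt_mem[OF AB(1) z[unfolded k]]
  define V where "V = ob C (k + n + 1) (A \<otimes>\<^sub>o B')"
  interpret V: module K V unfolding V_def by (rule ob_vectorspace[OF T])
  define w where "w = prd C k n A B' u y"
  define v where "v = koszul_sign V (k + 1) (prd C k (n + 1) A B' u (d n B' y))"
  define t where "t = prd C (k + 1) n A B' z y"
  have w: "w \<in> F (fst (i + j) - int r + 1) (k + n) (A \<otimes>\<^sub>o B')"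
    using filtration_prd[OF AB u yF(1)] by (simp add: w_def algebra_simps)
  have v: "v \<in> F (fst (i + j) + 1) (k + n + 1) (A \<otimes>\<^sub>o B')"
    using filt_koszul[OF T filtration_prd[OF AB u yF(2)]] by (simp add: v_def V_def algebra_simps)
  have t: "t \<in> F (fst (i + j) + 1) (k + n + 1) (A \<otimes>\<^sub>o B')"
    using filtration_prd[OF AB z[unfolded k] yF(1)] by (simp add: t_def algebra_simps)
  note dw = d_closed[OF T filt_mem[OF T w], folded V_def]
  have idx: "k + 1 + n = k + n + 1" by simp
  have "prd C (k + 1) n A B' x y = prd C (k + 1) n A B' (d k A u) y \<oplus>\<^bsub>V\<^esub> t"
    using linear_mapD(2)[OF bilinear_mapD(2)[OF prd_bilinear[OF AB] yc] d_closed[OF AB(1) uc] zc]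
    by (simp add: x_eq k t_def V_def idx)
  also have "prd C (k + 1) n A B' (d k A u) y = d (k + n) (A \<otimes>\<^sub>o B') w \<oplus>\<^bsub>V\<^esub> v"
    using prd_d_left[OF AB uc yc] by (simp add: w_def v_def V_def)
  also have "(d (k + n) (A \<otimes>\<^sub>o B') w \<oplus>\<^bsub>V\<^esub> v) \<oplus>\<^bsub>V\<^esub> t = d (k + n) (A \<otimes>\<^sub>o B') w \<oplus>\<^bsub>V\<^esub> (v \<oplus>\<^bsub>V\<^esub> t)"
    using dw filt_mem[OF T v, folded V_def] filt_mem[OF T t, folded V_def] by (rule V.M.a_assoc)
  finally have "prd C (k + 1) n A B' x y = d (k + n) (A \<otimes>\<^sub>o B') w \<oplus>\<^bsub>V\<^esub> (v \<oplus>\<^bsub>V\<^esub> t)" .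
  moreover have "prd C (k + 1) n A B' x y \<in> Z r (i + j) (A \<otimes>\<^sub>o B')"
    using lax_subfunctor.sub_prd[OF cycles_subfunctor AB xZ y] by (simp add: n_def k)
  moreover have "v \<oplus>\<^bsub>V\<^esub> t \<in> F (fst (i + j) + 1) (k + n + 1) (A \<otimes>\<^sub>o B')"
    unfolding V_def by (rule filt_add[OF T v t])
  ultimately show ?thesis
    using boundariesI[of "prd C (k + 1) n A B' x y" r "i + j" "A \<otimes>\<^sub>o B'" w "k + n" "v \<oplus>\<^bsub>V\<^esub> t"] w
    by (simp add: n_def k V_def idx[unfolded n_def])
qed

theorem page_ideal: "lax_ideal K M (bigrade C) (Z r) (B r)"
proof (intro lax_ideal.intro lax_ideal_axioms.intro)
  show "lax_subfunctor K M (bigrade C) (Z r)" by (rule cycles_subfunctor)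
next
  fix A and i :: "int \<times> int" assume A: "A \<in> Obj M"
  interpret V: module K "ob C (total_degree i) A" by (rule ob_vectorspace[OF A])
  interpret S: lax_subfunctor K M "bigrade C" "Z r" by (rule cycles_subfunctor)
  show BZ: "x \<in> Z r i A" if "x \<in> B r i A" for x using that by (simp add: approx_boundaries_def)
  have "submodule (B r i A) K (ob C (total_degree i) A)"
  proof (rule V.submoduleI_smult)
    show "B r i A \<subseteq> carrier (ob C (total_degree i) A)" using BZ S.sub_mem[OF A, of _ i] by auto
    show "\<zero>\<^bsub>ob C (total_degree i) A\<^esub> \<in> B r i A"
      using boundariesI_filt[OF A S.sub_zero[OF A]] filt_zero[OF A] by simp
  next
    fix x x' assume x: "x \<in> B r i A" and x': "x' \<in> B r i A"
    obtain k u z where u: "u \<in> F (fst i - int r + 1) k A"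
      and z: "z \<in> F (fst i + 1) (total_degree i) A"
      and x_eq: "x = d k A u \<oplus>\<^bsub>ob C (total_degree i) A\<^esub> z" and k: "total_degree i = k + 1"
      using x by (rule boundaries_cases)
    obtain k' u' z' where u': "u' \<in> F (fst i - int r + 1) k' A"
      and z': "z' \<in> F (fst i + 1) (total_degree i) A"
      and x'_eq: "x' = d k' A u' \<oplus>\<^bsub>ob C (total_degree i) A\<^esub> z'" and k': "total_degree i = k' + 1"
      using x' by (rule boundaries_cases)
    have kk: "k' = k" using k k' by simp
    note c = filt_mem[OF A u] filt_mem[OF A u'[unfolded kk]] filt_mem[OF A z] filt_mem[OF A z']
    note dc = d_closed[OF A c(1), folded k] d_closed[OF A c(2), folded k]
    have "x \<oplus>\<^bsub>ob C (total_degree i) A\<^esub> x' =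
        d k A (u \<oplus>\<^bsub>ob C k A\<^esub> u') \<oplus>\<^bsub>ob C (total_degree i) A\<^esub> (z \<oplus>\<^bsub>ob C (total_degree i) A\<^esub> z')"
      using d_add[OF A c(1,2)] c(3,4) dc by (simp add: x_eq x'_eq kk k[symmetric] V.M.a_ac)
    moreover have "x \<oplus>\<^bsub>ob C (total_degree i) A\<^esub> x' \<in> Z r i A"
      using S.sub_add[OF A BZ[OF x] BZ[OF x']] by simp
    ultimately show "x \<oplus>\<^bsub>ob C (total_degree i) A\<^esub> x' \<in> B r i A"
      using boundariesI[OF _ filt_add[OF A u u'[unfolded kk]] filt_add[OF A z z'] _ k] by blast
  next
    fix a x assume a: "a \<in> carrier K" and x: "x \<in> B r i A"
    obtain k u z where u: "u \<in> F (fst i - int r + 1) k A"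
      and z: "z \<in> F (fst i + 1) (total_degree i) A"
      and x_eq: "x = d k A u \<oplus>\<^bsub>ob C (total_degree i) A\<^esub> z" and k: "total_degree i = k + 1"
      using x by (rule boundaries_cases)
    note c = filt_mem[OF A u] filt_mem[OF A z]
    have "a \<odot>\<^bsub>ob C (total_degree i) A\<^esub> x =
        d k A (a \<odot>\<^bsub>ob C k A\<^esub> u) \<oplus>\<^bsub>ob C (total_degree i) A\<^esub> (a \<odot>\<^bsub>ob C (total_degree i) A\<^esub> z)"
      using d_smult[OF A a c(1)] V.smult_r_distr[OF a d_closed[OF A c(1), folded k] c(2)]
      by (simp add: x_eq k[symmetric])
    moreover have "a \<odot>\<^bsub>ob C (total_degree i) A\<^esub> x \<in> Z r i A"
      using S.sub_smult[OF A a BZ[OF x]] by simp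
    ultimately show "a \<odot>\<^bsub>ob C (total_degree i) A\<^esub> x \<in> B r i A"
      using boundariesI[OF _ filt_smult[OF A a u] filt_smult[OF A a z] _ k] by blast
  qed
  then show "submodule (B r i A) K (ob (bigrade C) i A)" by simp
next
  fix A B' f x and i :: "int \<times> int"
  assume AB: "A \<in> Obj M" "B' \<in> Obj M" "f \<in> carrier (Hom M A B')" and x: "x \<in> B r i A"
  obtain k u z where xZ: "x \<in> Z r i A" and u: "u \<in> F (fst i - int r + 1) k A"
    and z: "z \<in> F (fst i + 1) (total_degree i) A"
    and x_eq: "x = d k A u \<oplus>\<^bsub>ob C (total_degree i) A\<^esub> z" and k: "total_degree i = k + 1"
    using x by (rule boundaries_cases)
  note c = filt_mem[OF AB(1) u] filt_mem[OF AB(1) z]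
  have "mor C (total_degree i) f x = d k B' (mor C k f u) \<oplus>\<^bsub>ob C (total_degree i) B'\<^esub> mor C (total_degree i) f z"
    using linear_mapD(2)[OF mor_linear[OF AB] d_closed[OF AB(1) c(1), folded k] c(2)]
      d_natural[OF AB c(1)] by (simp add: x_eq k[symmetric])
  moreover have "mor C (total_degree i) f x \<in> Z r i B'"
    using lax_subfunctor.sub_mor[OF cycles_subfunctor AB xZ] by simp
  ultimately show "mor (bigrade C) i f x \<in> B r i B'"
    using boundariesI[OF _ filtration_natural[OF AB u] filtration_natural[OF AB z] _ k] by simp
qed (simp_all add: boundaries_prd_right boundaries_prd_left)

abbreviation "page r \<equiv> subquotient_lax_functor M (bigrade C) (Z r) (B r)"
abbreviation "page_class r i A x \<equiv> B r i A +>\<^bsub>ob (bigrade C) i A\<^esub> x"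

definition page_d :: "nat \<Rightarrow> int \<times> int \<Rightarrow> 'o \<Rightarrow> 'v set \<Rightarrow> 'v set" where
  "page_d r i A =
     induced_map (ob C (total_degree i + 1) A) (B r (i + page_degree r) A) (d (total_degree i) A)"

abbreviation "page_cohomology r \<equiv> cohomology_lax_functor M (page r) (page_d r) (page_degree r)"
abbreviation "page_coboundaries r \<equiv> coboundaries (page r) (page_d r) (page_degree r)"
abbreviation "page_cocycles r \<equiv> cocycles (page r) (page_d r) (page_degree r)"

lemma page_quotient: "lax_quotient K M (bigrade C) (Z r) (B r) (page r) (page_class r)"
  by (rule lax_ideal.subquotient_lax_quotient[OF page_ideal])

lemmas page_class_eq_iff = lax_quotient.proj_eq_iff[OF page_quotient, unfolded bigrade_sel]
lemmas page_class_zero_iff = lax_quotient.proj_zero_iff[OF page_quotient]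

lemma boundaries_sub: "x \<in> B r i A \<Longrightarrow> x \<in> Z r i A"
  by (simp add: approx_boundaries_def)

lemma d_square_filt: "A \<in> Obj M \<Longrightarrow> x \<in> F p n A \<Longrightarrow> d (n + 1) A (d n A x) = \<zero>\<^bsub>ob C (n + 1 + 1) A\<^esub>"
  using d_square filt_mem by blast

lemma d_cycles:
  assumes A: "A \<in> Obj M" and x: "x \<in> Z r i A"
  shows "d (total_degree i) A x \<in> Z r (i + page_degree r) A"
  using cyclesD(2)[OF x] d_square_filt[OF A cyclesD(1)[OF x]] filt_zero[OF A]
  by (intro cyclesI[OF _ _ refl refl]) simp_all

text \<open>
  Only \<open>d z\<close> survives in \<open>d (d u + z)\<close>, and \<open>z\<close> lies in \<open>F\<^sup>p\<^sup>+\<^sup>1\<close>, which is the filtration required of a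
  primitive at filtration \<open>p + r\<close>.
\<close>

lemma d_boundaries:
  assumes A: "A \<in> Obj M" and x: "x \<in> B r i A"
  shows "d (total_degree i) A x \<in> B r (i + page_degree r) A"
proof -
  obtain k u z where xZ: "x \<in> Z r i A" and u: "u \<in> F (fst i - int r + 1) k A"
    and z: "z \<in> F (fst i + 1) (total_degree i) A"
    and x_eq: "x = d k A u \<oplus>\<^bsub>ob C (total_degree i) A\<^esub> z" and k: "total_degree i = k + 1"
    using x by (rule boundaries_cases)
  note uc = filt_mem[OF A u] and zc = filt_mem[OF A z, unfolded k]
  interpret V: module K "ob C (k + 1 + 1) A" by (rule ob_vectorspace[OF A])
  have "d (k + 1) A x = d (k + 1) A z"
    unfolding x_eq k d_add[OF A d_closed[OF A uc] zc] d_square[OF A uc]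
    by (rule V.M.l_zero[OF d_closed[OF A zc]])
  then have "d (total_degree i) A x =
      d (total_degree i) A z \<oplus>\<^bsub>ob C (total_degree i + 1) A\<^esub> \<zero>\<^bsub>ob C (total_degree i + 1) A\<^esub>"
    using V.M.r_zero[OF d_closed[OF A zc]] by (simp add: k)
  then show ?thesis
    using boundariesI[OF d_cycles[OF A xZ], of z "total_degree i" "\<zero>\<^bsub>ob C (total_degree i + 1) A\<^esub>"]
      z filt_zero[OF A] by simp
qed

lemma page_d_class:
  assumes A: "A \<in> Obj M" and x: "x \<in> Z r i A"
  shows "page_d r i A (page_class r i A x) = page_class r (i + page_degree r) A (d (total_degree i) A x)"
  unfolding page_d_def
  using induced_map_coset[OF ob_vectorspace[OF A] ob_vectorspace[OF A] d_linear[OF A]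
      lax_ideal.ideal_submodule[OF page_ideal A, of r i, unfolded bigrade_sel]
      lax_ideal.ideal_submodule[OF page_ideal A, of r "i + page_degree r", unfolded bigrade_sel
        total_degree_simps]
      d_boundaries[OF A] filt_mem[OF A cyclesD(1)[OF x]]]
  by simp

lemma page_differential:
  "differential_lax_monoidal_functor K M (page r) (page_d r) (page_degree r) total_degree"
proof (rule lax_quotient.quotient_differential[where d = "\<lambda>i. d (total_degree i)",
      OF page_quotient bigrade_differential[OF differential_lax_monoidal_functor_axioms]])
  fix A i x assume "A \<in> Obj M" "x \<in> Z r i A"
  then show "d (total_degree i) A x \<in> Z r (i + page_degree r) A"
    and "page_d r i A (page_class r i A x) = page_class r (i + page_degree r) A (d (total_degree i) A x)"
    by (rule d_cycles, rule page_d_class)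
qed

lemma cycles_Suc: "\<lbrakk>A \<in> Obj M; x \<in> Z (Suc r) i A\<rbrakk> \<Longrightarrow> x \<in> Z r i A"
  using filt_le[of A "fst i + int r" "fst i + int (Suc r)"] by (auto simp: approx_cycles_def)

lemma page_cocycles_iff:
  assumes A: "A \<in> Obj M" and x: "x \<in> Z r i A"
  shows "page_class r i A x \<in> page_cocycles r i A \<longleftrightarrow>
    d (total_degree i) A x \<in> B r (i + page_degree r) A"
  using page_class_zero_iff[OF A d_cycles[OF A x]] page_d_class[OF A x]
    lax_quotient.proj_closed[OF page_quotient A x]
  by (simp add: cocycles_def)

text \<open>
  If \<open>d x\<close> is zero on the \<open>r\<close>-th page, say \<open>d x = d z + v\<close>, then \<open>x - z\<close> survives to the next page. The
  correction \<open>z\<close> vanishes on the \<open>r\<close>-th page, and also on the zeroth page because its filtration is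
  higher; the first is needed for the cohomology of \<open>E\<^sub>r\<close>, the second for the cycles of the limit page.
\<close>

lemma cycle_correction:
  assumes A: "A \<in> Obj M" and x: "x \<in> Z r i A"
    and dx: "d (total_degree i) A x \<in> B r (i + page_degree r) A"
  obtains z where "z \<in> F (fst i + 1) (total_degree i) A" "z \<in> B r i A"
    "x \<ominus>\<^bsub>ob C (total_degree i) A\<^esub> z \<in> Z (Suc r) i A"
proof -
  define n where "n = total_degree i"
  interpret V: module K "ob C n A" by (rule ob_vectorspace[OF A])
  interpret W: module K "ob C (n + 1) A" by (rule ob_vectorspace[OF A])
  obtain k y v where "d (total_degree i) A x \<in> Z r (i + page_degree r) A"
    and y: "y \<in> F (fst (i + page_degree r) - int r + 1) k A"
    and v: "v \<in> F (fst (i + page_degree r) + 1) (total_degree (i + page_degree r)) A"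
    and eq: "d (total_degree i) A x = d k A y \<oplus>\<^bsub>ob C (total_degree (i + page_degree r)) A\<^esub> v"
    and k: "total_degree (i + page_degree r) = k + 1"
    using dx by (rule boundaries_cases)
  have kn: "k = n" using k by (simp add: n_def)
  have y': "y \<in> F (fst i + 1) n A" using y by (simp add: kn)
  have v': "v \<in> F (fst i + int r + 1) (n + 1) A" using v by (simp add: n_def algebra_simps)
  have eq': "d n A x = d n A y \<oplus>\<^bsub>ob C (n + 1) A\<^esub> v" using eq by (simp add: kn n_def)
  note xF = cyclesD[OF x, folded n_def]
  note xc = filt_mem[OF A xF(1)] and yc = filt_mem[OF A y'] and vc = filt_mem[OF A v']
  have dv: "d n A x \<ominus>\<^bsub>ob C (n + 1) A\<^esub> d n A y = v"
    unfolding eq' by (rule W.add_diff_cancel[OF d_closed[OF A yc] vc])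
  have v'': "v \<in> F (fst i + int r) (n + 1) A" by (rule filt_le[OF A _ v']) simp
  have "v \<oplus>\<^bsub>ob C (n + 1) A\<^esub> d n A y \<in> F (fst i + int r) (n + 1) A"
    using xF(2) eq' d_closed[OF A yc] vc by (simp add: W.M.a_comm)
  then have dy: "d n A y \<in> F (fst i + int r) (n + 1) A"
    by (rule filt_cancel[OF A v'' d_closed[OF A yc]])
  have yF: "y \<in> F (fst i) n A" by (rule filt_le[OF A _ y']) simp
  have yZ: "y \<in> Z r i A" using yF dy by (rule cyclesI) (simp_all add: n_def)
  have "x \<ominus>\<^bsub>ob C n A\<^esub> y \<in> Z (Suc r) i A"
  proof (rule cyclesI)
    show "x \<ominus>\<^bsub>ob C n A\<^esub> y \<in> F (fst i) n A" by (rule filt_diff[OF A xF(1) yF])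
    show "d n A (x \<ominus>\<^bsub>ob C n A\<^esub> y) \<in> F (fst i + int (Suc r)) (n + 1) A"
      unfolding d_diff[OF A A A xc yc] dv using v' by (simp add: algebra_simps)
  qed (simp_all add: n_def)
  then show thesis
    using that[of y] y' boundariesI_filt[OF A yZ] by (simp add: n_def)
qed

lemma page_cocycles:
  assumes A: "A \<in> Obj M"
  shows "page_cocycles r i A = page_class r i A ` Z (Suc r) i A"
proof
  show "page_class r i A ` Z (Suc r) i A \<subseteq> page_cocycles r i A"
  proof clarify
    fix x assume x: "x \<in> Z (Suc r) i A"
    note xr = cycles_Suc[OF A x]
    have "d (total_degree i) A x \<in> F (fst (i + page_degree r) + 1) (total_degree (i + page_degree r)) A"
      using cyclesD(2)[OF x] by (simp add: algebra_simps)
    then have "d (total_degree i) A x \<in> B r (i + page_degree r) A"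
      by (rule boundariesI_filt[OF A d_cycles[OF A xr]])
    then show "page_class r i A x \<in> page_cocycles r i A"
      using page_cocycles_iff[OF A xr] by simp
  qed
next
  show "page_cocycles r i A \<subseteq> page_class r i A ` Z (Suc r) i A"
  proof
    fix X assume X: "X \<in> page_cocycles r i A"
    then have "X \<in> carrier (ob (page r) i A)" by (simp add: cocycles_def)
    with A obtain x where x: "x \<in> Z r i A" "X = page_class r i A x"
      by (rule lax_quotient.quotient_cases[OF page_quotient])
    then have "d (total_degree i) A x \<in> B r (i + page_degree r) A"
      using X page_cocycles_iff[OF A x(1)] by simp
    with A x(1) obtain z where z: "z \<in> B r i A" "x \<ominus>\<^bsub>ob C (total_degree i) A\<^esub> z \<in> Z (Suc r) i A"
      by (rule cycle_correction)
    have xz: "x \<ominus>\<^bsub>ob C (total_degree i) A\<^esub> z \<in> Z r i A" by (rule cycles_Suc[OF A z(2)])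
    interpret V: module K "ob C (total_degree i) A" by (rule ob_vectorspace[OF A])
    note c = filt_mem[OF A cyclesD(1)[OF x(1)]] filt_mem[OF A cyclesD(1)[OF boundaries_sub[OF z(1)]]]
    have "x \<ominus>\<^bsub>ob C (total_degree i) A\<^esub> (x \<ominus>\<^bsub>ob C (total_degree i) A\<^esub> z) = z"
      by (rule V.diff_diff_cancel[OF c])
    then have "X = page_class r i A (x \<ominus>\<^bsub>ob C (total_degree i) A\<^esub> z)"
      using page_class_eq_iff[OF A x(1) xz] z(1) x(2) by simp
    then show "X \<in> page_class r i A ` Z (Suc r) i A" using z(2) by blast
  qed
qed

text \<open>
  The image of the differential consists of the classes of \<open>d b\<close> for \<open>b\<close> in \<open>Z\<^sub>r\<close> at filtration \<open>p - r\<close>.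
  Adding them to \<open>B\<^sub>r\<close> allows primitives of filtration \<open>p - r\<close> instead of \<open>p - r + 1\<close>, and this is what
  distinguishes \<open>B\<^sub>r\<^sub>+\<^sub>1\<close> from \<open>B\<^sub>r\<close>.
\<close>

lemma page_coboundaries_iff:
  assumes A: "A \<in> Obj M" and x: "x \<in> Z (Suc r) i A"
  shows "page_class r i A x \<in> page_coboundaries r i A \<longleftrightarrow> x \<in> B (Suc r) i A"
proof -
  interpret P: differential_lax_monoidal_functor K M "page r" "page_d r" "page_degree r" total_degree
    by (rule page_differential)
  define n where "n = total_degree i"
  interpret V: module K "ob C n A" by (rule ob_vectorspace[OF A])
  note xr = cycles_Suc[OF A x]
  note xF = cyclesD[OF x, folded n_def] and xc = filt_mem[OF A cyclesD(1)[OF x], folded n_def]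
  show ?thesis
  proof
    assume "page_class r i A x \<in> page_coboundaries r i A"
    then obtain j Y where j: "i = j + page_degree r" and Y: "Y \<in> carrier (ob (page r) j A)"
      "page_class r i A x = page_d r j A Y" by (rule P.coboundaries_cases)
    obtain b where b: "b \<in> Z r j A" "Y = page_class r j A b"
      using A Y(1) by (rule lax_quotient.quotient_cases[OF page_quotient])
    define m where "m = total_degree j"
    have nm: "n = m + 1" by (simp add: n_def m_def j)
    have bF: "b \<in> F (fst i - int r) m A" using cyclesD(1)[OF b(1)] by (simp add: j m_def)
    have db: "d m A b \<in> Z r i A" using d_cycles[OF A b(1)] by (simp add: j m_def)
    have "page_class r i A x = page_class r i A (d m A b)"
      using Y(2) b(2) page_d_class[OF A b(1)] by (simp add: j m_def)
    then have "x \<ominus>\<^bsub>ob C n A\<^esub> d m A b \<in> B r i A" using page_class_eq_iff[OF A xr db] by (simp add: n_def)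
    then obtain k u z where u: "u \<in> F (fst i - int r + 1) k A"
      and z: "z \<in> F (fst i + 1) (total_degree i) A"
      and eq: "x \<ominus>\<^bsub>ob C n A\<^esub> d m A b = d k A u \<oplus>\<^bsub>ob C (total_degree i) A\<^esub> z"
      and k: "total_degree i = k + 1"
      by (rule boundaries_cases)
    have km: "k = m" using k nm by (simp add: n_def)
    have u': "u \<in> F (fst i - int r) m A" by (rule filt_le[OF A _ u[unfolded km]]) simp
    note bc = filt_mem[OF A bF] and uc = filt_mem[OF A u'] and zc = filt_mem[OF A z, folded n_def]
    note dc = d_closed[OF A bc, folded nm] d_closed[OF A uc, folded nm]
    have "x = d m A b \<oplus>\<^bsub>ob C n A\<^esub> (d m A u \<oplus>\<^bsub>ob C n A\<^esub> z)"
      using V.add_minus_cancel[OF xc dc(1)] eq by (simp add: n_def km)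
    also have "\<dots> = d m A (b \<oplus>\<^bsub>ob C m A\<^esub> u) \<oplus>\<^bsub>ob C n A\<^esub> z"
      using d_add[OF A bc uc] dc zc by (simp add: nm[symmetric] V.M.a_assoc)
    finally show "x \<in> B (Suc r) i A"
      using boundariesI[OF x, of "b \<oplus>\<^bsub>ob C m A\<^esub> u" m z] filt_add[OF A bF u'] z nm by (simp add: n_def)
  next
    assume "x \<in> B (Suc r) i A"
    then obtain k u z where u: "u \<in> F (fst i - int (Suc r) + 1) k A"
      and z: "z \<in> F (fst i + 1) (total_degree i) A"
      and eq: "x = d k A u \<oplus>\<^bsub>ob C (total_degree i) A\<^esub> z"
      and k: "total_degree i = k + 1"
      by (rule boundaries_cases)
    have kn: "n = k + 1" using k by (simp add: n_def)
    define j where "j = i - page_degree r"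
    have j: "i = j + page_degree r" by (simp add: j_def)
    have kj: "total_degree j = k" by (simp add: j_def k)
    have fj: "fst j = fst i - int r" by (simp add: j_def)
    have uF: "u \<in> F (fst j) k A" using u by (simp add: fj)
    note uc = filt_mem[OF A u] and zc = filt_mem[OF A z, folded n_def]
    note dc = d_closed[OF A uc, folded kn]
    have zp: "z \<in> F (fst i) n A" by (rule filt_le[OF A _ z[folded n_def]]) simp
    have eq': "x = z \<oplus>\<^bsub>ob C n A\<^esub> d k A u" using eq dc zc by (simp add: n_def[symmetric] V.M.a_comm)
    have du: "d k A u \<in> F (fst i) n A"
      by (rule filt_cancel[OF A zp dc]) (use xF(1) eq' in simp)
    have uZ: "u \<in> Z r j A" using uF du by (intro cyclesI) (simp_all add: kj fj kn)
    have "x \<ominus>\<^bsub>ob C n A\<^esub> d k A u = z" using dc zc by (simp add: eq' V.M.minus_eq V.M.a_assoc V.M.r_neg)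
    moreover have duZ: "d k A u \<in> Z r i A" using d_cycles[OF A uZ] by (simp add: kj j[symmetric])
    moreover have "x \<ominus>\<^bsub>ob C n A\<^esub> d k A u \<in> Z r i A"
      using lax_subfunctor.sub_diff[OF cycles_subfunctor A xr duZ] by (simp add: n_def)
    ultimately have "x \<ominus>\<^bsub>ob C n A\<^esub> d k A u \<in> B r i A"
      using boundariesI_filt[OF A _ z] by simp
    then have "page_class r i A x = page_d r j A (page_class r j A u)"
      using page_class_eq_iff[OF A xr duZ] page_d_class[OF A uZ] by (simp add: kj j[symmetric] n_def)
    then show "page_class r i A x \<in> page_coboundaries r i A"
      using P.coboundariesI[OF lax_quotient.proj_closed[OF page_quotient A uZ] j] by simp
  qed
qed

lemma page_cohomology_ideal: "lax_ideal K M (page r) (page_cocycles r) (page_coboundaries r)"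
proof (rule differential_lax_monoidal_functor.cohomology_ideal[OF page_differential])
  interpret Q: lax_quotient K M "bigrade C" "Z r" "B r" "page r" "page_class r" by (rule page_quotient)
  show "page_d r 0 (Unit_ob M) (unt (page r)) = \<zero>\<^bsub>ob (page r) (page_degree r) (Unit_ob M)\<^esub>"
    using page_d_class[OF unit_ob_closed Q.sub_unt] Q.proj_zero[OF unit_ob_closed, of "page_degree r"] d_unt
    by (simp add: Q.proj_unt)
qed

lemma page_cohomology_quotient:
  "lax_quotient K M (bigrade C) (Z (Suc r)) (B (Suc r)) (page_cohomology r)
    (\<lambda>i A x. page_coboundaries r i A +>\<^bsub>ob (page r) i A\<^esub> page_class r i A x)"
  unfolding cohomology_lax_functor_def
proof (rule lax_quotient.quotient_subquotient[OF page_quotient page_cohomology_ideal cycles_subfunctor])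
  fix i A assume A: "A \<in> Obj M"
  show "Z (Suc r) i A \<subseteq> Z r i A" using cycles_Suc[OF A] by blast
  show "page_class r i A ` Z (Suc r) i A = page_cocycles r i A" using page_cocycles[OF A] ..
  show "B (Suc r) i A = {x \<in> Z (Suc r) i A. page_class r i A x \<in> page_coboundaries r i A}"
    using page_coboundaries_iff[OF A] boundaries_sub by blast
qed

definition next_page_iso :: "nat \<Rightarrow> int \<times> int \<Rightarrow> 'o \<Rightarrow> 'v set set \<Rightarrow> 'v set" where
  "next_page_iso r = quotient_comparison (Z (Suc r))
     (\<lambda>i A x. page_coboundaries r i A +>\<^bsub>ob (page r) i A\<^esub> page_class r i A x) (page_class (Suc r))"

theorem spectral_sequence:
  "functorial_multiplicative_spectral_sequence K M 0 page page_d next_page_iso"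
  by (intro functorial_multiplicative_spectral_sequence.intro
      functorial_multiplicative_spectral_sequence_axioms.intro linear_monoidal_category_axioms
      page_differential)
    (simp only: next_page_iso_def quotient_comparison_isomorphism[OF page_cohomology_quotient page_quotient]
      add_0)

lemma next_page_iso_class:
  "\<lbrakk>A \<in> Obj M; x \<in> Z (Suc r) i A\<rbrakk> \<Longrightarrow>
    next_page_iso r i A (page_coboundaries r i A +>\<^bsub>ob (page r) i A\<^esub> page_class r i A x) =
      page_class (Suc r) i A x"
  unfolding next_page_iso_def
  by (rule quotient_comparison_proj[OF page_cohomology_quotient page_quotient])

section \<open>The first page\<close>

lemma cycles_0: "A \<in> Obj M \<Longrightarrow> Z 0 i A = F (fst i) (total_degree i) A"
  using filtration_d by (auto simp: approx_cycles_def)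

lemma boundaries_0: 
  assumes A: "A \<in> Obj M"
  shows "B 0 i A = F (fst i + 1) (total_degree i) A"
proof
  show "F (fst i + 1) (total_degree i) A \<subseteq> B 0 i A"
  proof
    fix x assume x: "x \<in> F (fst i + 1) (total_degree i) A"
    then have "x \<in> Z 0 i A" using filt_le[OF A _ x, of "fst i"] by (simp add: cycles_0[OF A])
    then show "x \<in> B 0 i A" using x by (rule boundariesI_filt[OF A])
  qed
  show "B 0 i A \<subseteq> F (fst i + 1) (total_degree i) A"
  proof
    fix x assume "x \<in> B 0 i A"
    then obtain k u z where u: "u \<in> F (fst i - int 0 + 1) k A" and z: "z \<in> F (fst i + 1) (total_degree i) A"
      and eq: "x = d k A u \<oplus>\<^bsub>ob C (total_degree i) A\<^esub> z" and k: "total_degree i = k + 1"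
      by (rule boundaries_cases)
    have "d k A u \<in> F (fst i + 1) (total_degree i) A" using filtration_d[OF A u] by (simp add: k)
    then show "x \<in> F (fst i + 1) (total_degree i) A" unfolding eq using z by (rule filt_add[OF A])
  qed
qed

text \<open>
  The zeroth page agrees with the family of graded pieces as a differential functor, on objects of
  \<open>M\<close> only. The identification is therefore made component by component.
\<close>

lemma page_0_ob:
  "A \<in> Obj M \<Longrightarrow> ob (page 0) i A = ob (graded_piece M C F (fst i)) (total_degree i) A"
  by (simp add: subquotient_lax_functor_sel graded_piece_def subquotient_functor_def cycles_0 boundaries_0)

lemma page_0_differential:
  "A \<in> Obj M \<Longrightarrow> page_d 0 i A = graded_piece_differential C d F (fst i) (total_degree i) A"
  by (simp add: page_d_def graded_piece_differential_def boundaries_0 fun_eq_iff)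

lemma page_0_cocycles:
  assumes A: "A \<in> Obj M"
  shows "page_cocycles 0 i A =
    cocycles (graded_piece M C F (fst i)) (graded_piece_differential C d F (fst i)) 1 (total_degree i) A"
  unfolding cocycles_def page_0_ob[OF A] page_0_differential[OF A] by simp

lemma page_0_coboundaries:
  assumes A: "A \<in> Obj M"
  shows "page_coboundaries 0 i A =
    coboundaries (graded_piece M C F (fst i)) (graded_piece_differential C d F (fst i)) 1 (total_degree i) A"
  unfolding coboundaries_def page_0_ob[OF A] page_0_differential[OF A] by simp

lemma graded_piece_cohomology_sel:
  "ob (graded_piece_cohomology M C d F) i A =
     ob (cohomology_functor M (graded_piece M C F (fst i)) (graded_piece_differential C d F (fst i)) 1)
       (total_degree i) A"
  "mor (graded_piece_cohomology M C d F) i f =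
     mor (cohomology_functor M (graded_piece M C F (fst i)) (graded_piece_differential C d F (fst i)) 1)
       (total_degree i) f"
  by (simp_all add: graded_piece_cohomology_def total_degree_def split: prod.splits)

lemma page_0_cohomology_ob:
  "A \<in> Obj M \<Longrightarrow> ob (page_cohomology 0) i A = ob (graded_piece_cohomology M C d F) i A"
  by (simp add: graded_piece_cohomology_sel cohomology_lax_functor_def cohomology_functor_def
      subquotient_lax_functor_sel(1)[of M "page 0"] subquotient_functor_def page_0_ob page_0_cocycles
      page_0_coboundaries del: bigrade_sel)

lemma page_0_cohomology_mor:
  assumes "A \<in> Obj M" "A' \<in> Obj M" "f \<in> carrier (Hom M A A')"
  shows "mor (page_cohomology 0) i f = mor (graded_piece_cohomology M C d F) i f"
proof -
  have c: "Cod M f = A'" using hom_dom_cod[OF assms] by simp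
  have "mor (page 0) i f = mor (graded_piece M C F (fst i)) (total_degree i) f"
    by (simp add: subquotient_lax_functor_sel graded_piece_def subquotient_functor_def c boundaries_0[OF assms(2)])
  then show ?thesis
    by (simp add: graded_piece_cohomology_sel cohomology_lax_functor_def cohomology_functor_def
        subquotient_lax_functor_sel(2)[of M "page 0"] subquotient_functor_def c page_0_ob[OF assms(2)]
        page_0_coboundaries[OF assms(2)] del: bigrade_sel)
qed

theorem first_page:
  "\<exists>\<theta>. natural_isomorphism K M (page 1) (graded_piece_cohomology M C d F) \<theta>"
proof -
  have "lax_quotient K M (bigrade C) (Z 1) (B 1) (page 1) (page_class 1)"
    by (rule page_quotient)
  moreover have "lax_quotient K M (bigrade C) (Z 1) (B 1) (page_cohomology 0)
      (\<lambda>i A x. page_coboundaries 0 i A +>\<^bsub>ob (page 0) i A\<^esub> page_class 0 i A x)"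
    using page_cohomology_quotient[of 0] by (simp only: One_nat_def)
  ultimately obtain \<theta> where "natural_isomorphism K M (page 1) (page_cohomology 0) \<theta>"
    using quotient_comparison_isomorphism unfolding lax_monoidal_isomorphism_def by blast
  then show ?thesis
    unfolding natural_isomorphism_def using page_0_cohomology_ob page_0_cohomology_mor by metis
qed

section \<open>The limit page\<close>

definition perm_cycles :: "int \<times> int \<Rightarrow> 'o \<Rightarrow> 'v set" where
  "perm_cycles i A = F (fst i) (total_degree i) A \<inter> cocycles C d 1 (total_degree i) A"

definition perm_boundaries :: "int \<times> int \<Rightarrow> 'o \<Rightarrow> 'v set" where
  "perm_boundaries i A = F (fst i) (total_degree i) A \<inter> coboundaries C d 1 (total_degree i) A"

lemma complex_cohomology_ideal: "lax_ideal K M C (cocycles C d 1) (coboundaries C d 1)"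
  by (rule cohomology_ideal[OF d_unt])

lemma filtered_ideal:
  assumes ideal: "lax_ideal K M C S N"
  shows "lax_ideal K M (bigrade C) (\<lambda>i A. F (fst i) (total_degree i) A \<inter> S (total_degree i) A)
    (\<lambda>i A. F (fst i) (total_degree i) A \<inter> N (total_degree i) A)"
    and "lax_ideal K M (bigrade C) (\<lambda>i A. F (fst i) (total_degree i) A \<inter> S (total_degree i) A)
    (\<lambda>i A. F (fst i + 1) (total_degree i) A \<inter> S (total_degree i) A)"
proof -
  interpret I: lax_ideal K M C S N by (rule ideal)
  have inter: "submodule (F p n A \<inter> H) K (ob C n A)"
    if A: "A \<in> Obj M" and H: "submodule H K (ob C n A)" for p n A H
  proof -
    interpret V: module K "ob C n A" by (rule ob_vectorspace[OF A])
    show ?thesis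
      by (rule V.submoduleI_smult)
        (auto simp: filt_zero[OF A] filt_add[OF A] filt_smult[OF A] filt_mem[OF A]
          V.submodule_zero[OF H] V.submoduleE(4,5)[OF H])
  qed
  have sub: "lax_subfunctor K M (bigrade C) (\<lambda>i A. F (fst i) (total_degree i) A \<inter> S (total_degree i) A)"
    by (intro lax_subfunctor.intro lax_subfunctor_axioms.intro bigrade_graded_lax
        graded_lax_monoidal_functor_axioms)
      (auto simp: inter I.sub_submodule filtration_natural I.sub_mor filtration_prd I.sub_prd
        filtration_unt I.sub_unt)
  have up: "prd C m n A B' x y \<in> F (p + q + 1) (m + n) (A \<otimes>\<^sub>o B')"
    if "A \<in> Obj M" "B' \<in> Obj M"
      "x \<in> F p m A \<and> y \<in> F (q + 1) n B' \<or> x \<in> F (p + 1) m A \<and> y \<in> F q n B'" for A B' x y p q m n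
  proof -
    have "p + (q + 1) = p + q + 1" "p + 1 + q = p + q + 1" by simp_all
    then show ?thesis using filtration_prd[OF that(1,2)] that(3) by metis
  qed
  have filt_Suc: "x \<in> F p n A" if "A \<in> Obj M" "x \<in> F (p + 1) n A" for A x p n
    using filt_le[OF that(1) _ that(2), of p] by simp
  show "lax_ideal K M (bigrade C) (\<lambda>i A. F (fst i) (total_degree i) A \<inter> S (total_degree i) A)
    (\<lambda>i A. F (fst i) (total_degree i) A \<inter> N (total_degree i) A)"
    by (intro lax_ideal.intro lax_ideal_axioms.intro sub)
      (auto simp: inter I.ideal_submodule filtration_natural I.ideal_mor filtration_prd
        I.ideal_subset I.ideal_prd_left I.ideal_prd_right)
  show "lax_ideal K M (bigrade C) (\<lambda>i A. F (fst i) (total_degree i) A \<inter> S (total_degree i) A)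
    (\<lambda>i A. F (fst i + 1) (total_degree i) A \<inter> S (total_degree i) A)"
    by (intro lax_ideal.intro lax_ideal_axioms.intro sub)
      (auto simp: inter I.sub_submodule filtration_natural I.sub_mor up I.sub_prd
        intro: filt_Suc)
qed

lemma perm_ideal: "lax_ideal K M (bigrade C) perm_cycles perm_boundaries"
  unfolding perm_cycles_def perm_boundaries_def by (rule filtered_ideal(1)[OF complex_cohomology_ideal])

lemma perm_next_ideal:
  "lax_ideal K M (bigrade C) perm_cycles
    (\<lambda>i A. F (fst i + 1) (total_degree i) A \<inter> cocycles C d 1 (total_degree i) A)"
  unfolding perm_cycles_def by (rule filtered_ideal(2)[OF complex_cohomology_ideal])

lemma perm_cycles_sub: "A \<in> Obj M \<Longrightarrow> x \<in> perm_cycles i A \<Longrightarrow> x \<in> Z r i A"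
  by (rule cyclesI) (simp_all add: perm_cycles_def cocycles_def filt_zero)

lemma cycles_le_0: "\<lbrakk>A \<in> Obj M; x \<in> Z r i A\<rbrakk> \<Longrightarrow> x \<in> Z 0 i A"
  using cyclesD(1) by (simp add: cycles_0)

abbreviation "projection \<equiv> page_projection 0 page page_d next_page_iso"
abbreviation "limit_cycles \<equiv> iterated_cycles 0 page page_d next_page_iso"
abbreviation "limit_boundaries \<equiv> iterated_boundaries 0 page page_d next_page_iso"

lemma projection_class:
  assumes A: "A \<in> Obj M"
  shows "x \<in> Z j i A \<Longrightarrow> projection j i A (page_class 0 i A x) = page_class j i A x"
proof (induction j)
  case 0
  show ?case by simp
next
  case (Suc j)
  then show ?case
    using cycles_Suc[OF A Suc.prems] next_page_iso_class[OF A Suc.prems] by simp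
qed

text \<open>
  A class on the zeroth page survives to the \<open>j\<close>-th page iff it has a representative in \<open>Z\<^sub>j\<close>. A given
  representative need not survive with its class: it may have to be corrected by an element of higher
  filtration, which \<open>E\<^sub>0\<close> does not see.
\<close>

lemma limit_cycles_eq:
  assumes A: "A \<in> Obj M"
  shows "limit_cycles j i A = page_class 0 i A ` Z j i A"
proof (induction j)
  case 0
  show ?case using lax_quotient.proj_image[OF page_quotient A, of i 0] by simp
next
  case (Suc j)
  have "limit_cycles (Suc j) i A =
      {X \<in> page_class 0 i A ` Z j i A. projection j i A X \<in> page_cocycles j i A}"
    using Suc by simp
  also have "\<dots> = page_class 0 i A ` Z (Suc j) i A"
  proof
    show "page_class 0 i A ` Z (Suc j) i A \<subseteq>
        {X \<in> page_class 0 i A ` Z j i A. projection j i A X \<in> page_cocycles j i A}"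
    proof (rule image_subsetI)
      fix x assume x: "x \<in> Z (Suc j) i A"
      note xj = cycles_Suc[OF A x]
      have "projection j i A (page_class 0 i A x) \<in> page_cocycles j i A"
        unfolding projection_class[OF A xj] page_cocycles[OF A] using x by (rule imageI)
      then show "page_class 0 i A x \<in> {X \<in> page_class 0 i A ` Z j i A. projection j i A X \<in> page_cocycles j i A}"
        using xj by blast
    qed
    show "{X \<in> page_class 0 i A ` Z j i A. projection j i A X \<in> page_cocycles j i A}
        \<subseteq> page_class 0 i A ` Z (Suc j) i A"
    proof clarify
      fix x assume x: "x \<in> Z j i A" and p: "projection j i A (page_class 0 i A x) \<in> page_cocycles j i A"
      have "d (total_degree i) A x \<in> B j (i + page_degree j) A"
        using p page_cocycles_iff[OF A x] projection_class[OF A x] by simp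
      with A x obtain z where z: "z \<in> F (fst i + 1) (total_degree i) A"
        "x \<ominus>\<^bsub>ob C (total_degree i) A\<^esub> z \<in> Z (Suc j) i A"
        by (rule cycle_correction)
      note c = filt_mem[OF A cyclesD(1)[OF x]] filt_mem[OF A z(1)]
      have "x \<ominus>\<^bsub>ob C (total_degree i) A\<^esub> (x \<ominus>\<^bsub>ob C (total_degree i) A\<^esub> z) \<in> B 0 i A"
        unfolding module.diff_diff_cancel[OF ob_vectorspace[OF A] c] boundaries_0[OF A] by (rule z(1))
      then have "page_class 0 i A x = page_class 0 i A (x \<ominus>\<^bsub>ob C (total_degree i) A\<^esub> z)"
        using page_class_eq_iff[OF A cycles_le_0[OF A x] cycles_le_0[OF A z(2)]] by simp
      then show "page_class 0 i A x \<in> page_class 0 i A ` Z (Suc j) i A" using z(2) by (rule image_eqI)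
    qed
  qed
  finally show ?case .
qed

lemma limit_boundaries_eq:
  assumes A: "A \<in> Obj M"
  shows "limit_boundaries j i A = page_class 0 i A ` B j i A"
proof -
  have "limit_boundaries j i A =
      {X \<in> page_class 0 i A ` Z j i A. projection j i A X = \<zero>\<^bsub>ob (page j) i A\<^esub>}"
    by (simp add: iterated_boundaries_def limit_cycles_eq[OF A])
  also have "\<dots> = page_class 0 i A ` B j i A"
    using projection_class[OF A, of _ j i] page_class_zero_iff[OF A, of _ j i] boundaries_sub[of _ j i A]
    by auto
  finally show ?thesis .
qed

text \<open>
  An element \<open>d u + z\<close> of \<open>B\<^sub>j\<close> has the same class on the zeroth page as the coboundary \<open>d u\<close>, since
  \<open>z\<close> has higher filtration.
\<close>

lemma limit_boundaries_union:
  assumes A: "A \<in> Obj M"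
  shows "(\<Union>j. limit_boundaries j i A) = page_class 0 i A ` perm_boundaries i A"
proof
  show "(\<Union>j. limit_boundaries j i A) \<subseteq> page_class 0 i A ` perm_boundaries i A"
  proof clarify
    fix j X assume "X \<in> limit_boundaries j i A"
    then obtain x where x: "x \<in> B j i A" "X = page_class 0 i A x" by (auto simp: limit_boundaries_eq[OF A])
    from x(1) obtain k u z where u: "u \<in> F (fst i - int j + 1) k A"
      and z: "z \<in> F (fst i + 1) (total_degree i) A"
      and eq: "x = d k A u \<oplus>\<^bsub>ob C (total_degree i) A\<^esub> z" and k: "total_degree i = k + 1"
      by (rule boundaries_cases)
    interpret V: module K "ob C (total_degree i) A" by (rule ob_vectorspace[OF A])
    note xF = cyclesD(1)[OF boundaries_sub[OF x(1)]]
    note uc = filt_mem[OF A u] and zc = filt_mem[OF A z]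
    note dc = d_closed[OF A uc, folded k]
    have zF: "z \<in> F (fst i) (total_degree i) A" by (rule filt_le[OF A _ z]) simp
    have eq': "x = z \<oplus>\<^bsub>ob C (total_degree i) A\<^esub> d k A u" unfolding eq using dc zc by (rule V.M.a_comm)
    have du: "d k A u \<in> F (fst i) (total_degree i) A"
      by (rule filt_cancel[OF A zF dc]) (use xF eq' in simp)
    then have "d k A u \<in> perm_boundaries i A"
      using coboundariesI[OF uc k] by (simp add: perm_boundaries_def)
    moreover have "x \<ominus>\<^bsub>ob C (total_degree i) A\<^esub> d k A u \<in> B 0 i A"
      unfolding boundaries_0[OF A] eq V.add_diff_cancel[OF dc zc] by (rule z)
    then have "X = page_class 0 i A (d k A u)"
      using page_class_eq_iff[of A x 0 i "d k A u"] A xF du x(2) by (simp add: cycles_0[OF A])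
    ultimately show "X \<in> page_class 0 i A ` perm_boundaries i A" by blast
  qed
  show "page_class 0 i A ` perm_boundaries i A \<subseteq> (\<Union>j. limit_boundaries j i A)"
  proof clarify
    fix x assume "x \<in> perm_boundaries i A"
    then have xF: "x \<in> F (fst i) (total_degree i) A" and xb: "x \<in> coboundaries C d 1 (total_degree i) A"
      by (auto simp: perm_boundaries_def)
    from xb obtain k y where k: "total_degree i = k + 1" and y: "y \<in> carrier (ob C k A)" "x = d k A y"
      by (rule coboundaries_cases)
    obtain p where p: "y \<in> F p k A" using y(1) filtration_exhaustive[OF A] by blast
    \<comment> \<open>A boundary in \<open>B\<^sub>j\<close> may have a primitive of filtration \<open>fst i - j + 1\<close>; this is at most \<open>p\<close> for the
      following \<open>j\<close>.\<close>
    define j where "j = nat (fst i + 1 - p)"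
    have yF: "y \<in> F (fst i - int j + 1) k A" by (rule filt_le[OF A _ p]) (simp add: j_def)
    interpret V: module K "ob C (k + 1) A" by (rule ob_vectorspace[OF A])
    have "x \<in> Z j i A" using xF d_square[OF A y(1)] filt_zero[OF A]
      by (intro cyclesI[OF _ _ refl refl]) (simp_all add: y(2) k)
    moreover have "x = d k A y \<oplus>\<^bsub>ob C (total_degree i) A\<^esub> \<zero>\<^bsub>ob C (total_degree i) A\<^esub>"
      unfolding y(2) k using V.M.r_zero[OF d_closed[OF A y(1)]] by simp
    ultimately have "x \<in> B j i A" using yF filt_zero[OF A] k by (blast intro: boundariesI)
    then show "page_class 0 i A x \<in> (\<Union>j. limit_boundaries j i A)"
      by (auto simp: limit_boundaries_eq[OF A])
  qed
qed

section \<open>The filtration on cohomology\<close>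

abbreviation "cohom \<equiv> cohomology_lax_functor M C d 1"
abbreviation "cohom_class n A x \<equiv> coboundaries C d 1 n A +>\<^bsub>ob C n A\<^esub> x"

lemma cohom_quotient:
  "lax_quotient K M C (cocycles C d 1) (coboundaries C d 1) cohom cohom_class"
  unfolding cohomology_lax_functor_def by (rule lax_ideal.subquotient_lax_quotient[OF complex_cohomology_ideal])

lemma bigrade_cohom_quotient:
  "lax_quotient K M (bigrade C) (\<lambda>i. cocycles C d 1 (total_degree i)) (\<lambda>i. coboundaries C d 1 (total_degree i))
    (bigrade cohom) (\<lambda>i. cohom_class (total_degree i))"
  by (rule bigrade_quotient[OF cohom_quotient])

text \<open>
  The classes of \<open>H\<^sup>n(F\<^sup>p C)\<close> are cosets of the smaller space of coboundaries of elements of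
  \<open>F\<^sup>p\<close>; mapping them to \<open>H\<^sup>n(C)\<close> enlarges the coset.
\<close>

lemma cohomology_filtration_eq:
  assumes A: "A \<in> Obj M"
  shows "cohomology_filtration M C d F p n A = cohom_class n A ` (F p n A \<inter> cocycles C d 1 n A)"
proof -
  define k where "k = n - 1"
  have kn: "n = k + 1" "n - 1 = k" by (simp_all add: k_def)
  define D where "D = coboundaries (subfunctor C (F p)) d 1 n A"
  have D: "D = d k A ` F p k A" by (simp add: D_def coboundaries_def subfunctor_def kn(2))
  interpret V: module K "ob C n A" by (rule ob_vectorspace[OF A])
  note sB = lax_ideal.ideal_submodule[OF complex_cohomology_ideal A, of n]
  have cocyc: "cocycles (subfunctor C (F p)) d 1 n A = F p n A \<inter> cocycles C d 1 n A"
    using filt_mem[OF A] by (auto simp: cocycles_def subfunctor_def)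
  have coset: "D +>\<^bsub>ob (subfunctor C (F p)) n A\<^esub> x = D +>\<^bsub>ob C n A\<^esub> x" for x
    by (simp add: a_r_coset_def' subfunctor_def)
  have DB: "D \<subseteq> coboundaries C d 1 n A"
    using coboundariesI[OF filt_mem[OF A] kn(1)] by (auto simp: D)
  have D0: "\<zero>\<^bsub>ob C n A\<^esub> \<in> D"
    using filt_zero[OF A, of k p] d_zero[OF A A A, of k] unfolding D kn(1) by (metis imageI)
  have ind: "induced_map (ob C n A) (coboundaries C d 1 n A) (\<lambda>x. x) (D +>\<^bsub>ob C n A\<^esub> x) = cohom_class n A x"
    if x: "x \<in> carrier (ob C n A)" for x
  proof -
    have "cohom_class n A y = cohom_class n A x" if y: "y \<in> D +>\<^bsub>ob C n A\<^esub> x" for y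
    proof -
      obtain b where b: "b \<in> coboundaries C d 1 n A" "y = b \<oplus>\<^bsub>ob C n A\<^esub> x"
        using y DB by (auto simp: a_r_coset_def')
      then have "b \<in> carrier (ob C n A)" using V.submodule_mem[OF sB] by blast
      then have "y \<in> carrier (ob C n A)" "y \<ominus>\<^bsub>ob C n A\<^esub> x = b"
        using b(2) x V.add_diff_cancel[of x b] by (simp_all add: V.M.a_comm)
      then show ?thesis using V.coset_eq_iff[OF sB _ x] b(1) by simp
    qed
    moreover have "x \<in> D +>\<^bsub>ob C n A\<^esub> x"
      using D0 V.M.l_zero[OF x] by (force simp: a_r_coset_def')
    ultimately show ?thesis unfolding induced_map_def by blast
  qed
  have "carrier (ob (cohomology_functor M (subfunctor C (F p)) d 1) n A) =
      (\<lambda>x. D +>\<^bsub>ob C n A\<^esub> x) ` (F p n A \<inter> cocycles C d 1 n A)"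
    by (simp add: cohomology_functor_def subquotient_functor_def subquotient_sel cocyc
        D_def[symmetric] coset)
  then show ?thesis
    unfolding cohomology_filtration_def
    by (simp add: image_image ind cocycles_def cong: image_cong_simp)
qed

lemma filtered_cocycles_submodule:
  "A \<in> Obj M \<Longrightarrow> submodule (F p n A \<inter> cocycles C d 1 n A) K (ob C n A)"
  using lax_ideal.axioms(1)[OF perm_ideal, THEN lax_subfunctor.sub_submodule, of A "(p, n - p)"]
  by (simp add: perm_cycles_def total_degree_def)

end

section \<open>Convergence\<close>

locale bounded_filtered_dg_functor = filtered_dg_lax_monoidal_functor K M C d F
  for K :: "'k ring" and M :: "('o, 'm, 'k, 'z) monoidal_cat_scheme" (structure)
    and C :: "(int, 'o, 'm, 'k, 'v) graded_lax_functor"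
    and d :: "int \<Rightarrow> 'o \<Rightarrow> 'v \<Rightarrow> 'v"
    and F :: "int \<Rightarrow> int \<Rightarrow> 'o \<Rightarrow> 'v set" +
  assumes bounded: "A \<in> Obj M \<Longrightarrow> bounded_filtration C F n A"
begin

lemma filtration_vanishes:
  assumes A: "A \<in> Obj M"
  obtains t where "\<And>p. t \<le> p \<Longrightarrow> F p n A = {\<zero>\<^bsub>ob C n A\<^esub>}"
proof -
  obtain t where t: "F t n A = {\<zero>\<^bsub>ob C n A\<^esub>}"
    using bounded[OF A, of n] by (auto simp: bounded_filtration_def)
  then have "F p n A = {\<zero>\<^bsub>ob C n A\<^esub>}" if "t \<le> p" for p
    using filtration_decreasing[OF A that, of n] filt_zero[OF A, of n p] by auto
  then show thesis by (rule that)
qed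

text \<open>
  Boundedness makes the sequence \<open>Z\<^sub>j\<close> stationary: the filtration vanishes in degree \<open>n + 1\<close> from some
  \<open>t\<close> on, so \<open>Z\<^sub>j\<close> consists of cocycles once \<open>p + j \<ge> t\<close>.
\<close>

lemma limit_cycles_intersection:
  assumes A: "A \<in> Obj M"
  shows "(\<Inter>j. limit_cycles j i A) = page_class 0 i A ` perm_cycles i A"
proof
  show "page_class 0 i A ` perm_cycles i A \<subseteq> (\<Inter>j. limit_cycles j i A)"
    unfolding limit_cycles_eq[OF A] using perm_cycles_sub[OF A] by blast
  obtain t where t: "\<And>p. t \<le> p \<Longrightarrow> F p (total_degree i + 1) A = {\<zero>\<^bsub>ob C (total_degree i + 1) A\<^esub>}"
    using filtration_vanishes[OF A] by blast
  have "Z (nat (t - fst i)) i A \<subseteq> perm_cycles i A"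
    using t[of "fst i + int (nat (t - fst i))"] filt_mem[OF A]
    by (auto simp: approx_cycles_def perm_cycles_def cocycles_def)
  then have "limit_cycles (nat (t - fst i)) i A \<subseteq> page_class 0 i A ` perm_cycles i A"
    unfolding limit_cycles_eq[OF A] by (rule image_mono)
  then show "(\<Inter>j. limit_cycles j i A) \<subseteq> page_class 0 i A ` perm_cycles i A" by blast
qed

theorem cohomology_filtered:
  "filtered_graded_lax_monoidal_functor K M cohom (cohomology_filtration M C d F)"
proof -
  interpret Q: lax_quotient K M C "cocycles C d 1" "coboundaries C d 1" cohom cohom_class
    by (rule cohom_quotient)
  note eq = cohomology_filtration_eq
  show ?thesis
  proof (intro filtered_graded_lax_monoidal_functor.intro filtered_graded_lax_monoidal_functor_axioms.intro)
    show "graded_lax_monoidal_functor K M cohom" by (rule Q.quotient_graded_lax)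
  next
    fix A p n assume A: "A \<in> Obj M"
    show "submodule (cohomology_filtration M C d F p n A) K (ob cohom n A)"
      unfolding eq[OF A] by (rule Q.image_submodule[OF A filtered_cocycles_submodule[OF A]]) simp
  next
    fix A p q n assume A: "A \<in> Obj M" and pq: "p \<le> (q :: int)"
    show "cohomology_filtration M C d F q n A \<subseteq> cohomology_filtration M C d F p n A"
      unfolding eq[OF A] using filtration_decreasing[OF A pq, of n] by blast
  next
    fix A n assume A: "A \<in> Obj M"
    have "(\<Union>p. cohomology_filtration M C d F p n A) =
        cohom_class n A ` ((\<Union>p. F p n A) \<inter> cocycles C d 1 n A)"
      unfolding eq[OF A] by blast
    also have "\<dots> = cohom_class n A ` cocycles C d 1 n A"
      by (simp add: filtration_exhaustive[OF A] cocycles_def Int_def)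
    finally show "(\<Union>p. cohomology_filtration M C d F p n A) = carrier (ob cohom n A)"
      using Q.proj_image[OF A] by simp
    obtain t where t: "\<And>p. t \<le> p \<Longrightarrow> F p n A = {\<zero>\<^bsub>ob C n A\<^esub>}"
      using filtration_vanishes[OF A] by blast
    have "cohomology_filtration M C d F t n A \<subseteq> {\<zero>\<^bsub>ob cohom n A\<^esub>}"
      unfolding eq[OF A] using t[of t] Q.proj_zero[OF A, of n] by auto
    moreover have "\<zero>\<^bsub>ob cohom n A\<^esub> \<in> cohomology_filtration M C d F p n A" for p
      unfolding eq[OF A] Q.proj_zero[OF A, symmetric] using filt_zero[OF A] Q.sub_zero[OF A] by blast
    ultimately show "(\<Inter>p. cohomology_filtration M C d F p n A) = {\<zero>\<^bsub>ob cohom n A\<^esub>}" by blast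
  next
    fix A B' f x p n
    assume AB: "A \<in> Obj M" "B' \<in> Obj M" "f \<in> carrier (Hom M A B')"
      and x: "x \<in> cohomology_filtration M C d F p n A"
    show "mor cohom n f x \<in> cohomology_filtration M C d F p n B'"
      unfolding eq[OF AB(2)]
      by (rule Q.image_mor[OF AB _ _ x[unfolded eq[OF AB(1)]]])
        (simp_all add: filtration_natural[OF AB] Q.sub_mor[OF AB])
  next
    fix A B' x y p q m n
    assume AB: "A \<in> Obj M" "B' \<in> Obj M" and x: "x \<in> cohomology_filtration M C d F p m A"
      and y: "y \<in> cohomology_filtration M C d F q n B'"
    show "prd cohom m n A B' x y \<in> cohomology_filtration M C d F (p + q) (m + n) (A \<otimes>\<^sub>o B')"
      unfolding eq[OF tensor_ob_closed[OF AB]]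
      by (rule Q.image_prd[OF AB _ _ _ x[unfolded eq[OF AB(1)]] y[unfolded eq[OF AB(2)]]])
        (simp_all add: filtration_prd[OF AB] Q.sub_prd[OF AB])
  next
    show "unt cohom \<in> cohomology_filtration M C d F 0 0 (Unit_ob M)"
      unfolding eq[OF unit_ob_closed] Q.proj_unt using filtration_unt Q.sub_unt by blast
  qed
qed

definition limit_kernel :: "int \<times> int \<Rightarrow> 'o \<Rightarrow> 'v set" where
  "limit_kernel i A =
     {x \<in> perm_cycles i A. page_class 0 i A x \<in> page_class 0 i A ` perm_boundaries i A}"

lemma perm_boundaries_sub: "A \<in> Obj M \<Longrightarrow> x \<in> perm_boundaries i A \<Longrightarrow> x \<in> perm_cycles i A"
  by (rule lax_ideal.ideal_subset[OF perm_ideal])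

lemma limit_page_quotient:
  "lax_quotient K M (bigrade C) perm_cycles limit_kernel (limit_page M 0 page page_d next_page_iso)
    (\<lambda>i A x. (\<Union>j. limit_boundaries j i A) +>\<^bsub>ob (page 0) i A\<^esub> page_class 0 i A x)"
  unfolding limit_page_def
proof (rule lax_quotient.quotient_subquotient[OF page_quotient])
  show "lax_subfunctor K M (bigrade C) perm_cycles" by (rule lax_ideal.axioms(1)[OF perm_ideal])
  have sub: "perm_cycles i A \<subseteq> Z 0 i A" if "A \<in> Obj M" for i A
    using perm_cycles_sub[OF that] by blast
  show "lax_ideal K M (page 0) (\<lambda>i A. \<Inter>j. limit_cycles j i A) (\<lambda>i A. \<Union>j. limit_boundaries j i A)"
    by (rule lax_ideal_cong[OF lax_quotient.image_ideal[OF page_quotient perm_ideal]])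
      (rule sub limit_cycles_intersection limit_boundaries_union, assumption)+
  fix i A assume A: "A \<in> Obj M"
  show "perm_cycles i A \<subseteq> Z 0 i A" by (rule sub[OF A])
  show "page_class 0 i A ` perm_cycles i A = (\<Inter>j. limit_cycles j i A)"
    by (rule limit_cycles_intersection[OF A, symmetric])
  show "limit_kernel i A = {x \<in> perm_cycles i A. page_class 0 i A x \<in> (\<Union>j. limit_boundaries j i A)}"
    unfolding limit_kernel_def limit_boundaries_union[OF A] ..
qed

text \<open>
  Both conditions say that the cocycle \<open>x\<close> is the sum of a coboundary and a cocycle in
  \<open>F\<^sup>p\<^sup>+\<^sup>1\<close>: vanishing on the limit page singles out the first summand, vanishing in the associated
  graded of the cohomology the second, and each is \<open>x\<close> minus the other.
\<close>

lemma limit_kernel_iff: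
  assumes A: "A \<in> Obj M" and x: "x \<in> perm_cycles i A"
  shows "x \<in> limit_kernel i A \<longleftrightarrow>
    cohom_class (total_degree i) A x \<in>
      cohom_class (total_degree i) A ` (F (fst i + 1) (total_degree i) A \<inter> cocycles C d 1 (total_degree i) A)"
proof -
  define n where "n = total_degree i"
  interpret V: module K "ob C n A" by (rule ob_vectorspace[OF A])
  interpret I: lax_ideal K M "bigrade C" perm_cycles perm_boundaries by (rule perm_ideal)
  have xn: "x \<in> F (fst i) n A" "x \<in> cocycles C d 1 n A" "x \<in> carrier (ob C n A)"
    using x filt_mem[OF A] by (auto simp: perm_cycles_def n_def)
  have l: "x \<in> limit_kernel i A \<longleftrightarrow> (\<exists>b\<in>perm_boundaries i A. x \<ominus>\<^bsub>ob C n A\<^esub> b \<in> F (fst i + 1) n A)"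
  proof -
    have "page_class 0 i A x = page_class 0 i A b \<longleftrightarrow> x \<ominus>\<^bsub>ob C n A\<^esub> b \<in> F (fst i + 1) n A"
      if "b \<in> perm_boundaries i A" for b
      using page_class_eq_iff[OF A perm_cycles_sub[OF A x]
          perm_cycles_sub[OF A perm_boundaries_sub[OF A that]], of 0]
      by (simp add: boundaries_0[OF A] n_def)
    then show ?thesis using x unfolding limit_kernel_def by blast
  qed
  have r: "cohom_class n A x \<in> cohom_class n A ` (F (fst i + 1) n A \<inter> cocycles C d 1 n A) \<longleftrightarrow>
      (\<exists>c\<in>F (fst i + 1) n A \<inter> cocycles C d 1 n A. x \<ominus>\<^bsub>ob C n A\<^esub> c \<in> coboundaries C d 1 n A)"
    using lax_quotient.proj_eq_iff[OF cohom_quotient A xn(2)] by blast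
  have "x \<in> limit_kernel i A \<longleftrightarrow>
    (\<exists>c\<in>F (fst i + 1) n A \<inter> cocycles C d 1 n A. x \<ominus>\<^bsub>ob C n A\<^esub> c \<in> coboundaries C d 1 n A)"
    unfolding l
  proof
    assume "\<exists>b\<in>perm_boundaries i A. x \<ominus>\<^bsub>ob C n A\<^esub> b \<in> F (fst i + 1) n A"
    then obtain b where b: "b \<in> perm_boundaries i A" "x \<ominus>\<^bsub>ob C n A\<^esub> b \<in> F (fst i + 1) n A" by blast
    have bn: "b \<in> carrier (ob C n A)" "b \<in> coboundaries C d 1 n A"
      using b(1) filt_mem[OF A] by (auto simp: perm_boundaries_def n_def)
    have "x \<ominus>\<^bsub>ob C n A\<^esub> b \<in> perm_cycles i A"
      using I.sub_diff[OF A x perm_boundaries_sub[OF A b(1)]] by (simp add: n_def)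
    then have "x \<ominus>\<^bsub>ob C n A\<^esub> b \<in> cocycles C d 1 n A" by (simp add: perm_cycles_def n_def)
    then show "\<exists>c\<in>F (fst i + 1) n A \<inter> cocycles C d 1 n A. x \<ominus>\<^bsub>ob C n A\<^esub> c \<in> coboundaries C d 1 n A"
      using b(2) bn(2) V.diff_diff_cancel[OF xn(3) bn(1)] by (metis IntI)
  next
    assume "\<exists>c\<in>F (fst i + 1) n A \<inter> cocycles C d 1 n A. x \<ominus>\<^bsub>ob C n A\<^esub> c \<in> coboundaries C d 1 n A"
    then obtain c where c: "c \<in> F (fst i + 1) n A" "x \<ominus>\<^bsub>ob C n A\<^esub> c \<in> coboundaries C d 1 n A" by blast
    have "c \<in> F (fst i) n A" by (rule filt_le[OF A _ c(1)]) simp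
    then have "x \<ominus>\<^bsub>ob C n A\<^esub> c \<in> perm_boundaries i A"
      using filt_diff[OF A xn(1)] c(2) by (simp add: perm_boundaries_def n_def)
    then show "\<exists>b\<in>perm_boundaries i A. x \<ominus>\<^bsub>ob C n A\<^esub> b \<in> F (fst i + 1) n A"
      using c(1) V.diff_diff_cancel[OF xn(3) filt_mem[OF A c(1)]] by metis
  qed
  then show ?thesis using r by (simp add: n_def)
qed

lemma associated_graded_quotient:
  "\<exists>\<beta>. lax_quotient K M (bigrade C) perm_cycles limit_kernel
    (associated_graded M cohom (cohomology_filtration M C d F)) \<beta>"
proof -
  define G0 where "G0 = (\<lambda>(p, q). cohomology_filtration M C d F p (p + q))"
  define G1 where "G1 = (\<lambda>(p, q). cohomology_filtration M C d F (p + 1) (p + q))"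
  have G0: "G0 i A = cohom_class (total_degree i) A ` perm_cycles i A"
    and G1: "G1 i A = cohom_class (total_degree i) A `
      (F (fst i + 1) (total_degree i) A \<inter> cocycles C d 1 (total_degree i) A)"
    if "A \<in> Obj M" for i A
    using cohomology_filtration_eq[OF that]
    by (simp_all add: G0_def G1_def perm_cycles_def total_degree_def split: prod.splits)
  have sub: "perm_cycles i A \<subseteq> cocycles C d 1 (total_degree i) A" for i A
    by (simp add: perm_cycles_def)
  have ideal: "lax_ideal K M (bigrade cohom) G0 G1"
    using lax_quotient.image_ideal[OF bigrade_cohom_quotient perm_next_ideal sub]
    by (rule lax_ideal_cong) (rule G0 G1, assumption)+
  have "lax_quotient K M (bigrade C) perm_cycles limit_kernel (subquotient_lax_functor M (bigrade cohom) G0 G1)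
      (\<lambda>i A x. G1 i A +>\<^bsub>ob (bigrade cohom) i A\<^esub> cohom_class (total_degree i) A x)"
  proof (rule lax_quotient.quotient_subquotient[OF bigrade_cohom_quotient ideal])
    show "lax_subfunctor K M (bigrade C) perm_cycles" by (rule lax_ideal.axioms(1)[OF perm_ideal])
    fix i A assume A: "A \<in> Obj M"
    show "perm_cycles i A \<subseteq> cocycles C d 1 (total_degree i) A" by (rule sub)
    show "cohom_class (total_degree i) A ` perm_cycles i A = G0 i A" by (rule G0[OF A, symmetric])
    have "x \<in> perm_cycles i A" if "x \<in> limit_kernel i A" for x
      using that by (simp add: limit_kernel_def)
    then show "limit_kernel i A =
        {x \<in> perm_cycles i A. cohom_class (total_degree i) A x \<in> G1 i A}"
      using limit_kernel_iff[OF A] unfolding G1[OF A] by blast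
  qed
  then show ?thesis unfolding associated_graded_def G0_def G1_def by blast
qed

theorem convergence:
  "converges_multiplicatively K M 0 page page_d next_page_iso cohom (cohomology_filtration M C d F)"
  unfolding converges_multiplicatively_def
  using cohomology_filtered associated_graded_quotient
    quotient_comparison_isomorphism[OF limit_page_quotient] by blast

end

theorem theorem1p26:
  fixes K :: "'k ring"
    and M :: "('o, 'm, 'k) monoidal_cat"
    and C :: "(int, 'o, 'm, 'k, 'v) graded_lax_functor"
    and d :: "int \<Rightarrow> 'o \<Rightarrow> 'v \<Rightarrow> 'v"
    and F :: "int \<Rightarrow> int \<Rightarrow> 'o \<Rightarrow> 'v set"
  assumes "linear_monoidal_abelian_category K M"
    and "filtered_dg_lax_monoidal_functor K M C d F"
    and "\<And>n A. A \<in> Obj M \<Longrightarrow> bounded_filtration C F n A"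
  shows "\<exists>(E :: nat \<Rightarrow> (int \<times> int, 'o, 'm, 'k, 'v set) graded_lax_functor) d' \<phi>.
    functorial_multiplicative_spectral_sequence K M 0 E d' \<phi> \<and>
    (\<exists>\<theta>. natural_isomorphism K M (E 1) (graded_piece_cohomology M C d F) \<theta>) \<and>
    converges_multiplicatively K M 0 E d' \<phi>
      (cohomology_lax_functor M C d 1) (cohomology_filtration M C d F)"
proof -
  interpret bounded_filtered_dg_functor K M C d F
    using assms(2,3)
    by (intro bounded_filtered_dg_functor.intro bounded_filtered_dg_functor_axioms.intro)
  show ?thesis
    using spectral_sequence first_page convergence by blast
qed

end
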